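(* Let $m>0$, $\sigma>0$, $\tau>0$, let $H$ be a complex Hilbert space, let $A$ be a self-adjoint positive definite operator with compact resolvent on $H$, and for parameters $(\alpha,\beta,\gamma)\in[0,1]\times[0,1]\times(0,1]$ let $e^{\mathcal{A}t}$ be the $C_0$-semigroup of contractions on $\mathcal{H}$ generated by the operator $\mathcal{A}$ (associated with the abstract thermoelastic system of Cattaneo type; $\mathcal{A}$, $\mathcal{H}$ and the parameter regions $V_1,V_2,V_3$ are defined in the context). Then: (i) if $(\alpha,\beta,\gamma)\in V_1$, $e^{\mathcal{A}t}$ is polynomially stable of order $k_1=\dfrac{2\alpha-\gamma}{2(2\alpha-\beta-\gamma)}$; (ii) if $(\alpha,\beta,\gamma)\in V_2$, $e^{\mathcal{A}t}$ is polynomially stable of order $k_2=\dfrac{1-\gamma}{2(-2\alpha-\beta-\gamma+2)}$; (iii) if $(\alpha,\beta,\gamma)\in V_3$, $e^{\mathcal{A}t}$ is polynomially stable of order $k_3=\dfrac{1-\gamma}{2(-2\alpha+\beta+\gamma)}$.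
   Context: The abstract system is $$u_{tt}+mA^\gamma u_{tt}+\sigma Au-A^\alpha\theta=0,\quad \theta_t-A^{\beta/2}q+A^\alpha u_t=0,\quad \tau q_t+q+A^{\beta/2}\theta=0,$$ with initial data $u(0)=u_0$, $u_t(0)=u_1$, $\theta(0)=\theta_0$, $q(0)=q_0$. $(\cdot,\cdot)$ and $\|\cdot\|$ are the inner product and norm of $H$. Powers $A^s$, $s\in\mathbb{R}$, are defined by the spectral theorem; for $s>0$, $\mathcal{D}(A^{-s})$ denotes the completion of $H$ in the norm $\|A^{-s}\cdot\|$, and $A^s$ is extended to act on this scale of spaces. State space: $\mathcal{H}=\mathcal{D}(A^{1/2})\times\mathcal{D}(A^{\gamma/2})\times H\times H$ with inner product $$\langle U_1,U_2\rangle_{\mathcal{H}}=\sigma(A^{1/2}u_1,A^{1/2}u_2)+m(A^{\gamma/2}v_1,A^{\gamma/2}v_2)+(v_1,v_2)+(\theta_1,\theta_2)+\tau(q_1,q_2),$$ for $U_i=(u_i,v_i,\theta_i,q_i)^\top$. Operator (with $v=u_t$, the system reads $\frac{d}{dt}U=\mathcal{A}U$ for $U=(u,v,\theta,q)^\top$): $$\mathcal{A}(u,v,\theta,q)^\top=\Big(v,\ -(I+mA^\gamma)^{-1}(\sigma Au-A^\alpha\theta),\ -A^\alpha v+A^{\beta/2}q,\ \tfrac1\tau(-q-A^{\beta/2}\theta)\Big)^\top,$$ $$\mathcal{D}(\mathcal{A})=\{(u,v,\theta,q)^\top\in\mathcal{H}: v\in\mathcal{D}(A^{1/2}),\ \sigma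 Au-A^\alpha\theta\in\mathcal{D}(A^{-\gamma/2}),\ -A^\alpha v+A^{\beta/2}q\in H,\ q+A^{\beta/2}\theta\in H\}.$$ When $\beta\ge 2\alpha-1$ (which holds on all the regions below), $0\in\rho(\mathcal{A})$ and $\mathcal{A}$ generates a $C_0$-semigroup of contractions $e^{\mathcal{A}t}$ on $\mathcal{H}$. Polynomial stability: $e^{\mathcal{A}t}$ is polynomially stable of order $k>0$ if there is a constant $C>0$ such that $\|e^{\mathcal{A}t}\mathcal{A}^{-1}\|_{\mathcal{L}(\mathcal{H})}\le Ct^{-k}$ for all $t>0$. Parameter regions (subsets of $E=\{(\alpha,\beta,\gamma): \alpha\in[0,1],\beta\in[0,1],\gamma\in(0,1]\}$): $V_1=T_1\cup F_{12}\cup F_{14}\cup L_{124}$, where $T_1=\{\frac12<\alpha<\frac{\beta+1}{2},\ 0<\beta\le1,\ 0<\gamma<2\alpha-\beta\}$, $F_{12}=\{\alpha=\frac12,\ 0<\beta<1-\gamma,\ 0<\gamma<1\}$, $F_{14}=\{\alpha=\frac{\beta+1}{2},\ 0<\beta\le1,\ 0<\gamma<1\}$, $L_{124}=\{\alpha=\frac12,\ \beta=0,\ 0<\gamma<1\}$. $V_2=T_2\cup F_2$, where $T_2=\{0\le\alpha<\frac12,\ 0<\beta<1,\ 0<\gamma<1-\beta\}$, $F_2=\{0\le\alpha<\frac12,\ \beta=0,\ 0<\gamma<1\}$. $V_3=T_3\cup F_{23}$, where $T_3=\{0\le\alpha<\frac{\beta+\gamma}{2},\ 1-\gamma<\beta\le1,\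 0<\gamma\le1\}$, $F_{23}=\{0\le\alpha<\frac12,\ \beta=1-\gamma,\ 0<\gamma<1\}$. *)

theory Defs
  imports "HOL-Analysis.Analysis"
begin

section \<open>Complex Hilbert spaces\<close>

class complex_vector = real_vector +
  fixes scaleC :: "complex \<Rightarrow> 'a \<Rightarrow> 'a"  (infixr "*\<^sub>C" 75)
  assumes scaleC_add_right: "c *\<^sub>C (x + y) = c *\<^sub>C x + c *\<^sub>C y"
    and scaleC_add_left: "(c + d) *\<^sub>C x = c *\<^sub>C x + d *\<^sub>C x"
    and scaleC_scaleC: "c *\<^sub>C d *\<^sub>C x = (c * d) *\<^sub>C x"
    and scaleR_scaleC: "r *\<^sub>R x = complex_of_real r *\<^sub>C x"

text \<open>The inner product is linear in its first argument and induces the given Banach norm; the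
  last axiom contains positivity and definiteness.\<close>

class complex_hilbert_space = banach + complex_vector +
  fixes cinner :: "'a \<Rightarrow> 'a \<Rightarrow> complex"
  assumes cinner_commute: "cinner x y = cnj (cinner y x)"
    and cinner_add_left: "cinner (x + y) z = cinner x z + cinner y z"
    and cinner_scaleC_left: "cinner (c *\<^sub>C x) y = c * cinner x y"
    and cinner_self: "cinner x x = complex_of_real ((norm x)\<^sup>2)"

instantiation prod :: (complex_vector, complex_vector) complex_vector
begin

definition scaleC_prod :: "complex \<Rightarrow> 'a \<times> 'b \<Rightarrow> 'a \<times> 'b" where
  "scaleC_prod c x = (c *\<^sub>C fst x, c *\<^sub>C snd x)"

instance
  by standard
    (simp_all add: scaleC_prod_def scaleC_add_right scaleC_add_left scaleC_scaleC
      scaleR_scaleC prod_eq_iff)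

end


section \<open>Unbounded operators\<close>

text \<open>An operator is a pair (domain, action); the action is irrelevant off the domain.\<close>

type_synonym 'a unbounded_op = "'a set \<times> ('a \<Rightarrow> 'a)"

abbreviation op_dom :: "'a unbounded_op \<Rightarrow> 'a set" where
  "op_dom A \<equiv> fst A"

abbreviation op_app :: "'a unbounded_op \<Rightarrow> 'a \<Rightarrow> 'a" where
  "op_app A \<equiv> snd A"

definition csubspace :: "'a::complex_vector set \<Rightarrow> bool" where
  "csubspace S \<longleftrightarrow> 0 \<in> S \<and> (\<forall>x\<in>S. \<forall>y\<in>S. x + y \<in> S) \<and> (\<forall>c. \<forall>x\<in>S. c *\<^sub>C x \<in> S)"

definition clinear_on :: "'a::complex_vector set \<Rightarrow> ('a \<Rightarrow> 'a) \<Rightarrow> bool" where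
  "clinear_on S f \<longleftrightarrow>
     csubspace S \<and>
     (\<forall>x\<in>S. \<forall>y\<in>S. f (x + y) = f x + f y) \<and>
     (\<forall>c. \<forall>x\<in>S. f (c *\<^sub>C x) = c *\<^sub>C f x)"

definition adjoint_rel :: "'a::complex_hilbert_space unbounded_op \<Rightarrow> 'a \<Rightarrow> 'a \<Rightarrow> bool" where
  "adjoint_rel A y z \<longleftrightarrow> (\<forall>x\<in>op_dom A. cinner (op_app A x) y = cinner x z)"

text \<open>Since the domain is dense, \<open>adjoint_rel A\<close> is the graph of the adjoint of \<open>A\<close>; the last
  conjunct says that it coincides with the graph of \<open>A\<close>.\<close>

definition self_adjoint :: "'a::complex_hilbert_space unbounded_op \<Rightarrow> bool" where
  "self_adjoint A \<longleftrightarrow>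
     clinear_on (op_dom A) (op_app A) \<and>
     closure (op_dom A) = UNIV \<and>
     (\<forall>y z. adjoint_rel A y z \<longleftrightarrow> y \<in> op_dom A \<and> op_app A y = z)"

text \<open>\<open>cinner (A x) x\<close> is real for self-adjoint \<open>A\<close>.\<close>

definition positive_definite :: "'a::complex_hilbert_space unbounded_op \<Rightarrow> bool" where
  "positive_definite A \<longleftrightarrow> (\<forall>x\<in>op_dom A. x \<noteq> 0 \<longrightarrow> 0 < Re (cinner (op_app A x) x))"

definition resolvent :: "'a::complex_hilbert_space unbounded_op \<Rightarrow> complex \<Rightarrow> 'a \<Rightarrow> 'a" where
  "resolvent A c = inv_into (op_dom A) (\<lambda>x. c *\<^sub>C x - op_app A x)"

definition resolvent_set :: "'a::complex_hilbert_space unbounded_op \<Rightarrow> complex set" where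
  "resolvent_set A = {c.
     bij_betw (\<lambda>x. c *\<^sub>C x - op_app A x) (op_dom A) UNIV \<and>
     (\<exists>K. \<forall>y. norm (resolvent A c y) \<le> K * norm y)}"

definition compact_resolvent :: "'a::complex_hilbert_space unbounded_op \<Rightarrow> bool" where
  "compact_resolvent A \<longleftrightarrow>
     (\<exists>c\<in>resolvent_set A. \<forall>B. bounded B \<longrightarrow> compact (closure (resolvent A c ` B)))"


section \<open>Powers and the scale of spaces\<close>

text \<open>Throughout, \<open>A\<close> is self-adjoint, positive definite and has compact resolvent. Its spectral
  measure is then the sum of the orthogonal projections \<open>P\<^sub>l\<close> onto the eigenspaces of the
  (positive real) eigenvalues \<open>l\<close>, and the spectral theorem reads \<open>A\<^sup>s x = (\<Sum>l. l\<^sup>s P\<^sub>l x)\<close>.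
  Sums over all real \<open>l\<close> are sums over the eigenvalues, as all other eigenspaces are zero.\<close>

definition eigenspace :: "'a::complex_hilbert_space unbounded_op \<Rightarrow> real \<Rightarrow> 'a set" where
  "eigenspace A l = {x \<in> op_dom A. op_app A x = l *\<^sub>R x}"

definition eigen_proj :: "'a::complex_hilbert_space unbounded_op \<Rightarrow> real \<Rightarrow> 'a \<Rightarrow> 'a" where
  "eigen_proj A l x =
     (THE y. y \<in> eigenspace A l \<and> (\<forall>z\<in>eigenspace A l. cinner (x - y) z = 0))"

text \<open>Elements of the scale are represented by their families of spectral components; a vector
  \<open>x\<close> of \<open>H\<close> is identified with the family \<open>comps A x\<close>, and \<open>vec_of\<close> recovers \<open>x\<close> from it.\<close>

definition comps :: "'a::complex_hilbert_space unbounded_op \<Rightarrow> 'a \<Rightarrow> real \<Rightarrow> 'a" where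
  "comps A x = (\<lambda>l. eigen_proj A l x)"

definition vec_of :: "(real \<Rightarrow> 'a::complex_hilbert_space) \<Rightarrow> 'a" where
  "vec_of w = (\<Sum>\<^sub>\<infinity>l. w l)"

text \<open>\<open>scale A r\<close> is \<open>\<D>(A\<^sup>r)\<close> for every real \<open>r\<close>, inside the space of all families of
  components. For \<open>r < 0\<close> it is the completion of \<open>H\<close> in the norm \<open>\<parallel>A\<^sup>r \<cdot>\<parallel>\<close>: this norm is the
  square root of the sum below, the weighted square-summable families are complete for it, and
  the families with finitely many nonzero components, which come from \<open>H\<close>, are dense.\<close>

definition scale :: "'a::complex_hilbert_space unbounded_op \<Rightarrow> real \<Rightarrow> (real \<Rightarrow> 'a) set" where
  "scale A r = {w. (\<forall>l. w l \<in> eigenspace A l) \<and>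
     (\<lambda>l. (norm ((l powr r) *\<^sub>R w l))\<^sup>2) summable_on UNIV}"

definition scale_power :: "real \<Rightarrow> (real \<Rightarrow> 'a) \<Rightarrow> real \<Rightarrow> 'a::complex_hilbert_space" where
  "scale_power s w = (\<lambda>l. (l powr s) *\<^sub>R w l)"

text \<open>The extended power \<open>A\<^sup>s\<close> applied to a vector of \<open>H\<close>, as an element of the scale.\<close>

definition ext_power :: "'a::complex_hilbert_space unbounded_op \<Rightarrow> real \<Rightarrow> 'a \<Rightarrow> real \<Rightarrow> 'a" where
  "ext_power A s x = scale_power s (comps A x)"

definition power_dom :: "'a::complex_hilbert_space unbounded_op \<Rightarrow> real \<Rightarrow> 'a set" where
  "power_dom A s = {x. comps A x \<in> scale A s}"

definition op_power :: "'a::complex_hilbert_space unbounded_op \<Rightarrow> real \<Rightarrow> 'a \<Rightarrow> 'a" where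
  "op_power A s x = vec_of (ext_power A s x)"


section \<open>Semigroups on a normed space given by a carrier and a norm\<close>

definition c0_contraction_semigroup ::
  "'a::complex_vector set \<Rightarrow> ('a \<Rightarrow> real) \<Rightarrow> (real \<Rightarrow> 'a \<Rightarrow> 'a) \<Rightarrow> bool" where
  "c0_contraction_semigroup X N S \<longleftrightarrow>
     (\<forall>t\<ge>0. S t ` X \<subseteq> X \<and> clinear_on X (S t)) \<and>
     (\<forall>x\<in>X. S 0 x = x) \<and>
     (\<forall>s\<ge>0. \<forall>t\<ge>0. \<forall>x\<in>X. S (s + t) x = S s (S t x)) \<and>
     (\<forall>x\<in>X. ((\<lambda>t. N (S t x - x)) \<longlongrightarrow> 0) (at_right 0)) \<and>
     (\<forall>t\<ge>0. \<forall>x\<in>X. N (S t x) \<le> N x)"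

definition is_generator ::
  "'a::complex_vector set \<Rightarrow> ('a \<Rightarrow> real) \<Rightarrow> (real \<Rightarrow> 'a \<Rightarrow> 'a) \<Rightarrow> 'a unbounded_op \<Rightarrow> bool" where
  "is_generator X N S G \<longleftrightarrow>
     op_dom G \<subseteq> X \<and>
     (\<forall>x\<in>X. \<forall>y\<in>X. x \<in> op_dom G \<and> op_app G x = y \<longleftrightarrow>
        ((\<lambda>t. N ((1 / t) *\<^sub>R (S t x - x) - y)) \<longlongrightarrow> 0) (at_right 0)) \<and>
     op_app G ` op_dom G \<subseteq> X"

text \<open>The bound on the operator norm of \<open>S t \<circ> G\<^sup>-\<^sup>1\<close> is written out. No sign condition on \<open>k\<close> is
  included: the exponents of interest can degenerate to 0, where the estimate is plain
  boundedness.\<close>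

definition polynomially_stable ::
  "'a::complex_vector set \<Rightarrow> ('a \<Rightarrow> real) \<Rightarrow> (real \<Rightarrow> 'a \<Rightarrow> 'a) \<Rightarrow> 'a unbounded_op \<Rightarrow> real \<Rightarrow> bool"
  where
  "polynomially_stable X N S G k \<longleftrightarrow>
     (\<exists>C>0. \<forall>t>0. \<forall>x\<in>X. N (S t (inv_into (op_dom G) (op_app G) x)) \<le> C * t powr (- k) * N x)"


section \<open>The thermoelastic system of Cattaneo type\<close>

type_synonym 'a state = "'a \<times> 'a \<times> 'a \<times> 'a"

definition state_space :: "'a::complex_hilbert_space unbounded_op \<Rightarrow> real \<Rightarrow> 'a state set" where
  "state_space A \<gamma> = power_dom A (1 / 2) \<times> power_dom A (\<gamma> / 2) \<times> UNIV \<times> UNIV"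

definition state_inner ::
  "'a::complex_hilbert_space unbounded_op \<Rightarrow> real \<Rightarrow> real \<Rightarrow> real \<Rightarrow> real
    \<Rightarrow> 'a state \<Rightarrow> 'a state \<Rightarrow> complex" where
  "state_inner A m \<sigma> \<tau> \<gamma> = (\<lambda>(u\<^sub>1, v\<^sub>1, \<theta>\<^sub>1, q\<^sub>1) (u\<^sub>2, v\<^sub>2, \<theta>\<^sub>2, q\<^sub>2).
     complex_of_real \<sigma> * cinner (op_power A (1 / 2) u\<^sub>1) (op_power A (1 / 2) u\<^sub>2) +
     complex_of_real m * cinner (op_power A (\<gamma> / 2) v\<^sub>1) (op_power A (\<gamma> / 2) v\<^sub>2) +
     cinner v\<^sub>1 v\<^sub>2 + cinner \<theta>\<^sub>1 \<theta>\<^sub>2 + complex_of_real \<tau> * cinner q\<^sub>1 q\<^sub>2)"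

definition state_norm ::
  "'a::complex_hilbert_space unbounded_op \<Rightarrow> real \<Rightarrow> real \<Rightarrow> real \<Rightarrow> real \<Rightarrow> 'a state \<Rightarrow> real" where
  "state_norm A m \<sigma> \<tau> \<gamma> U = sqrt (Re (state_inner A m \<sigma> \<tau> \<gamma> U U))"

text \<open>The element \<open>\<sigma>Au - A\<^sup>\<alpha>\<theta>\<close> of the scale.\<close>

definition elastic_force ::
  "'a::complex_hilbert_space unbounded_op \<Rightarrow> real \<Rightarrow> real \<Rightarrow> 'a \<Rightarrow> 'a \<Rightarrow> real \<Rightarrow> 'a" where
  "elastic_force A \<sigma> \<alpha> u \<theta> = (\<lambda>l. \<sigma> *\<^sub>R ext_power A 1 u l - ext_power A \<alpha> \<theta> l)"

text \<open>The inverse of \<open>I + mA\<^sup>\<gamma>\<close> as a map from \<open>\<D>(A\<^sup>\<gamma>\<^sup>/\<^sup>2)\<close> onto \<open>\<D>(A\<^sup>-\<^sup>\<gamma>\<^sup>/\<^sup>2)\<close>.\<close>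

definition inertia_inverse ::
  "'a::complex_hilbert_space unbounded_op \<Rightarrow> real \<Rightarrow> real \<Rightarrow> (real \<Rightarrow> 'a) \<Rightarrow> real \<Rightarrow> 'a" where
  "inertia_inverse A m \<gamma> =
     inv_into (scale A (\<gamma> / 2)) (\<lambda>w l. w l + m *\<^sub>R scale_power \<gamma> w l)"

text \<open>The last two conditions of the domain say that an element of the scale belongs
  to \<open>H\<close>, that is, is the family of components of a vector.\<close>

definition thermo_op ::
  "'a::complex_hilbert_space unbounded_op \<Rightarrow> real \<Rightarrow> real \<Rightarrow> real \<Rightarrow> real \<Rightarrow> real \<Rightarrow> real
    \<Rightarrow> 'a state unbounded_op" where
  "thermo_op A m \<sigma> \<tau> \<alpha> \<beta> \<gamma> =
    ({(u, v, \<theta>, q). (u, v, \<theta>, q) \<in> state_space A \<gamma> \<and>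
        v \<in> power_dom A (1 / 2) \<and>
        elastic_force A \<sigma> \<alpha> u \<theta> \<in> scale A (- (\<gamma> / 2)) \<and>
        (\<lambda>l. - ext_power A \<alpha> v l + ext_power A (\<beta> / 2) q l) \<in> range (comps A) \<and>
        (\<lambda>l. comps A q l + ext_power A (\<beta> / 2) \<theta> l) \<in> range (comps A)},
     \<lambda>(u, v, \<theta>, q).
       (v,
        - vec_of (inertia_inverse A m \<gamma> (elastic_force A \<sigma> \<alpha> u \<theta>)),
        vec_of (\<lambda>l. - ext_power A \<alpha> v l + ext_power A (\<beta> / 2) q l),
        (1 / \<tau>) *\<^sub>R vec_of (\<lambda>l. - comps A q l - ext_power A (\<beta> / 2) \<theta> l)))"


section \<open>Parameter regions\<close>

definition E :: "(real \<times> real \<times> real) set" where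
  "E = {0..1} \<times> {0..1} \<times> {0<..1}"

definition T\<^sub>1 where
  "T\<^sub>1 = {(\<alpha>, \<beta>, \<gamma>) \<in> E. 1 / 2 < \<alpha> \<and> \<alpha> < (\<beta> + 1) / 2 \<and> 0 < \<beta> \<and> \<beta> \<le> 1 \<and> 0 < \<gamma> \<and> \<gamma> < 2 * \<alpha> - \<beta>}"

definition F\<^sub>1\<^sub>2 where
  "F\<^sub>1\<^sub>2 = {(\<alpha>, \<beta>, \<gamma>) \<in> E. \<alpha> = 1 / 2 \<and> 0 < \<beta> \<and> \<beta> < 1 - \<gamma> \<and> 0 < \<gamma> \<and> \<gamma> < 1}"

definition F\<^sub>1\<^sub>4 where
  "F\<^sub>1\<^sub>4 = {(\<alpha>, \<beta>, \<gamma>) \<in> E. \<alpha> = (\<beta> + 1) / 2 \<and> 0 < \<beta> \<and> \<beta> \<le> 1 \<and> 0 < \<gamma> \<and> \<gamma> < 1}"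

definition L\<^sub>1\<^sub>2\<^sub>4 where
  "L\<^sub>1\<^sub>2\<^sub>4 = {(\<alpha>, \<beta>, \<gamma>) \<in> E. \<alpha> = 1 / 2 \<and> \<beta> = 0 \<and> 0 < \<gamma> \<and> \<gamma> < 1}"

definition V\<^sub>1 where
  "V\<^sub>1 = T\<^sub>1 \<union> F\<^sub>1\<^sub>2 \<union> F\<^sub>1\<^sub>4 \<union> L\<^sub>1\<^sub>2\<^sub>4"

definition T\<^sub>2 where
  "T\<^sub>2 = {(\<alpha>, \<beta>, \<gamma>) \<in> E. 0 \<le> \<alpha> \<and> \<alpha> < 1 / 2 \<and> 0 < \<beta> \<and> \<beta> < 1 \<and> 0 < \<gamma> \<and> \<gamma> < 1 - \<beta>}"

definition F\<^sub>2 where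
  "F\<^sub>2 = {(\<alpha>, \<beta>, \<gamma>) \<in> E. 0 \<le> \<alpha> \<and> \<alpha> < 1 / 2 \<and> \<beta> = 0 \<and> 0 < \<gamma> \<and> \<gamma> < 1}"

definition V\<^sub>2 where
  "V\<^sub>2 = T\<^sub>2 \<union> F\<^sub>2"

definition T\<^sub>3 where
  "T\<^sub>3 = {(\<alpha>, \<beta>, \<gamma>) \<in> E. 0 \<le> \<alpha> \<and> \<alpha> < (\<beta> + \<gamma>) / 2 \<and> 1 - \<gamma> < \<beta> \<and> \<beta> \<le> 1 \<and> 0 < \<gamma> \<and> \<gamma> \<le> 1}"

definition F\<^sub>2\<^sub>3 where
  "F\<^sub>2\<^sub>3 = {(\<alpha>, \<beta>, \<gamma>) \<in> E. 0 \<le> \<alpha> \<and> \<alpha> < 1 / 2 \<and> \<beta> = 1 - \<gamma> \<and> 0 < \<gamma> \<and> \<gamma> < 1}"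

definition V\<^sub>3 where
  "V\<^sub>3 = T\<^sub>3 \<union> F\<^sub>2\<^sub>3"

end

theory Submission
  imports Defs "HOL-Computational_Algebra.Fundamental_Theorem_Algebra"
begin

text \<open>Expanding in the eigenspaces of \<open>A\<close> splits the system into \<open>4 \<times> 4\<close> dissipative systems \<open>x' = B\<^sub>l x\<close>,
  one for each eigenvalue \<open>l\<close>, and by Parseval it suffices to bound \<open>\<parallel>exp (t B\<^sub>l) B\<^sub>l\<inverse>\<parallel>\<close> by
  \<open>C t\<^sup>-\<^sup>k\<close> uniformly in \<open>l\<close>. For dissipative matrices of fixed size such a bound follows from the
  location of the eigenvalues \<open>\<mu>\<close> alone, namely from \<open>exp (t Re \<mu>) \<le> K \<bar>\<mu>\<bar> t\<^sup>-\<^sup>k\<close>: split off one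
  eigenspace at a time, the coupling between the parts being controlled by dissipativity. This
  replaces the resolvent criterion of Borichev and Tomilov. An eigenvector of \<open>B\<^sub>l\<close> with heat flux
  component 1 has energy \<open>-1 / (\<tau> Re \<mu>)\<close>, so the eigenvalues are located by bounding the
  other three components: either they are bounded, or \<open>\<bar>\<mu>\<bar>\<close> is at least of the order of the dominant
  frequency and the energy has at most a known polynomial growth in \<open>l\<close>.\<close>

text \<open>The eigenvectors of \<open>B l\<close> are not orthogonal and eigenvalues may coincide,
  so diagonalising would bring in condition numbers with no evident bound in \<open>l\<close>. The
  decay estimate is therefore built so that its constant depends only on the exponent and on the
  number of eigenvalues. The three orders are quotients of growth exponents. If -Re \<mu> is at
  least of order 1/s and |\<mu>| at least of order f, then exp (t Re \<mu>) / |\<mu>| is at most of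
  order (t/s)^(-k) / f, and s^k / f stays bounded as soon as k times the growth exponent of s does
  not exceed that of f. The modal coefficients a, b, c grow like l to the powers (1-\<gamma>)/2,
  \<alpha>-\<gamma>/2 and \<beta>/2. The pair (s, f) is ((b/c)^2, b) on \<open>V\<^sub>1\<close>,
  ((a^2/(bc))^2, a) on \<open>V\<^sub>2\<close> and ((c/b)^2, a) on \<open>V\<^sub>3\<close>; the
  exponent of f divided by that of s is the order claimed there.\<close>

section \<open>Complex scalars and the inner product\<close>

lemma scaleC_of_real: "complex_of_real r *\<^sub>C x = r *\<^sub>R (x :: 'a::complex_vector)"
  by (simp add: scaleR_scaleC)

lemma scaleC_one [simp]: "1 *\<^sub>C x = (x :: 'a::complex_vector)"
  using scaleC_of_real[of 1 x] by simp

lemma scaleC_zero_left [simp]: "0 *\<^sub>C x = (0 :: 'a::complex_vector)"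
  using scaleC_of_real[of 0 x] by simp

lemma scaleC_zero_right [simp]: "c *\<^sub>C (0 :: 'a::complex_vector) = 0"
  using scaleC_add_right[of c 0 "0::'a"] by simp

lemma scaleC_minus_left: "(- c) *\<^sub>C x = - (c *\<^sub>C (x :: 'a::complex_vector))"
  using scaleC_add_left[of c "- c" x] by (simp add: eq_neg_iff_add_eq_0 add.commute)

lemma scaleC_minus_right: "c *\<^sub>C (- x) = - (c *\<^sub>C (x :: 'a::complex_vector))"
  using scaleC_add_right[of c x "- x"] by (simp add: eq_neg_iff_add_eq_0 add.commute)

lemma scaleC_diff_right: "c *\<^sub>C (x - y) = c *\<^sub>C x - c *\<^sub>C (y :: 'a::complex_vector)"
  using scaleC_add_right[of c x "- y"] by (simp add: scaleC_minus_right)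

lemma scaleC_diff_left: "(c - d) *\<^sub>C x = c *\<^sub>C x - d *\<^sub>C (x :: 'a::complex_vector)"
  using scaleC_add_left[of c "- d" x] by (simp add: scaleC_minus_left)

lemma scaleC_scaleR: "c *\<^sub>C r *\<^sub>R x = r *\<^sub>R c *\<^sub>C (x :: 'a::complex_vector)"
  by (simp add: scaleR_scaleC scaleC_scaleC mult.commute)

lemma cinner_add_right: "cinner x (y + z) = cinner x y + cinner x (z :: 'a::complex_hilbert_space)"
  by (subst (1 2 3) cinner_commute) (simp add: cinner_add_left)

lemma cinner_scaleC_right: "cinner x (c *\<^sub>C y) = cnj c * cinner x (y :: 'a::complex_hilbert_space)"
  by (subst (1 2) cinner_commute) (simp add: cinner_scaleC_left)

lemma cinner_scaleR_left: "cinner (r *\<^sub>R x) y = r *\<^sub>R cinner x (y :: 'a::complex_hilbert_space)"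
  by (simp add: scaleR_scaleC cinner_scaleC_left scaleR_conv_of_real)

lemma cinner_scaleR_right: "cinner x (r *\<^sub>R y) = r *\<^sub>R cinner x (y :: 'a::complex_hilbert_space)"
  by (simp add: scaleR_scaleC cinner_scaleC_right scaleR_conv_of_real)

lemma cnj_mult_self: "cnj c * c = (of_real (cmod c))^2"
  using complex_norm_square[of c] by (simp add: mult.commute)

lemma norm_scaleC: "norm (c *\<^sub>C x) = cmod c * norm (x :: 'a::complex_hilbert_space)"
proof -
  have "of_real ((norm (c *\<^sub>C x))^2) = (c * cnj c) * cinner x x"
    by (simp add: cinner_self[symmetric] cinner_scaleC_left cinner_scaleC_right del: of_real_power)
  also have "\<dots> = complex_of_real ((cmod c * norm x)^2)"
    using cnj_mult_self[of c] by (simp add: cinner_self power_mult_distrib mult.commute)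
  finally have "(norm (c *\<^sub>C x))^2 = (cmod c * norm x)^2"
    using of_real_eq_iff by blast
  then show ?thesis
    by (metis norm_ge_zero power2_eq_iff_nonneg zero_le_mult_iff)
qed

lemma Re_cinner_commute: "Re (cinner x y) = Re (cinner y (x :: 'a::complex_hilbert_space))"
  by (subst cinner_commute) simp

lemma norm_add_square:
  "(norm (x + y :: 'a::complex_hilbert_space))^2 = (norm x)^2 + (norm y)^2 + 2 * Re (cinner x y)"
proof -
  have "of_real ((norm (x + y))^2) = cinner x x + cinner y y + (cinner x y + cinner y x)"
    by (simp add: cinner_self[symmetric] cinner_add_left cinner_add_right algebra_simps del: of_real_power)
  then have "Re (of_real ((norm (x + y))^2)) = Re (cinner x x) + Re (cinner y y) + 2 * Re (cinner x y)"
    using Re_cinner_commute[of x y] by simp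
  then show ?thesis
    by (simp add: cinner_self)
qed

lemma cauchy_schwarz_aux: "\<bar>Re (cinner x y)\<bar> \<le> norm x * norm (y :: 'a::complex_hilbert_space)"
proof -
  have *: "2 * Re (cinner x y) \<le> 2 * (norm x * norm y)" for x y :: 'a
  proof -
    have "(norm (x + y))^2 \<le> (norm x + norm y)^2"
      by (intro power_mono norm_triangle_ineq) simp
    then show ?thesis
      by (simp add: norm_add_square power2_sum)
  qed
  have "- Re (cinner x y) = Re (cinner (- x) y)"
    using cinner_scaleR_left[of "- 1" x y] by simp
  then show ?thesis
    using *[of x y] *[of "- x" y] by simp
qed

lemma cauchy_schwarz: "cmod (cinner x y) \<le> norm x * norm (y :: 'a::complex_hilbert_space)"
proof (cases "cinner x y = 0")
  case False
  define c where "c = cnj (sgn (cinner x y))"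
  have "c * cinner x y = of_real (cmod (cinner x y))"
    using False cnj_mult_self[of "cinner x y"] by (simp add: c_def sgn_eq power2_eq_square)
  then have "cmod (cinner x y) = Re (cinner (c *\<^sub>C x) y)"
    by (simp add: cinner_scaleC_left)
  also have "\<dots> \<le> norm (c *\<^sub>C x) * norm y"
    using cauchy_schwarz_aux by (meson abs_le_D1)
  also have "\<dots> = norm x * norm y"
    using False by (simp add: norm_scaleC c_def norm_sgn)
  finally show ?thesis .
qed simp

lemma bounded_bilinear_cinner: "bounded_bilinear (cinner :: 'a::complex_hilbert_space \<Rightarrow> 'a \<Rightarrow> complex)"
  by standard
    (auto simp: cinner_add_left cinner_add_right cinner_scaleR_left cinner_scaleR_right
      intro!: exI[of _ 1] cauchy_schwarz)

interpretation cinner: bounded_bilinear "cinner :: 'a::complex_hilbert_space \<Rightarrow> 'a \<Rightarrow> complex"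
  by (rule bounded_bilinear_cinner)

declare cinner.zero_left [simp] cinner.zero_right [simp]

lemma bounded_linear_scaleC: "bounded_linear (\<lambda>x :: 'a::complex_hilbert_space. c *\<^sub>C x)"
  by (rule bounded_linear_intro[of _ "cmod c"])
    (simp_all add: scaleC_add_right scaleC_scaleR norm_scaleC mult.commute)

lemma cinner_eq_0_commute: "cinner x y = 0 \<longleftrightarrow> cinner y (x :: 'a::complex_hilbert_space) = 0"
  by (subst cinner_commute) simp

lemma Re_cinner_self: "Re (cinner x (x :: 'a::complex_hilbert_space)) = (norm x)^2"
  by (simp add: cinner_self)

lemma norm_add_square_orthogonal:
  assumes "cinner x (y :: 'a::complex_hilbert_space) = 0"
  shows "(norm (x + y))^2 = (norm x)^2 + (norm y)^2"
  using assms by (simp add: norm_add_square)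

lemma norm_diff_square:
  "(norm (x - y :: 'a::complex_hilbert_space))^2 = (norm x)^2 + (norm y)^2 - 2 * Re (cinner x y)"
  using norm_add_square[of x "- y"] by (simp add: cinner.minus_right)

lemma parallelogram:
  "(norm (x + y :: 'a::complex_hilbert_space))^2 + (norm (x - y))^2 = 2 * (norm x)^2 + 2 * (norm y)^2"
  by (simp add: norm_add_square norm_diff_square)

section \<open>Orthogonal projections\<close>

lemma csubspaceD:
  assumes "csubspace M"
  shows "0 \<in> M" "x \<in> M \<Longrightarrow> y \<in> M \<Longrightarrow> x + y \<in> M" "x \<in> M \<Longrightarrow> c *\<^sub>C x \<in> M"
    "x \<in> M \<Longrightarrow> r *\<^sub>R x \<in> M" "x \<in> M \<Longrightarrow> - x \<in> M" "x \<in> M \<Longrightarrow> y \<in> M \<Longrightarrow> x - y \<in> M"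
proof -
  show "0 \<in> M" and add: "x \<in> M \<Longrightarrow> y \<in> M \<Longrightarrow> x + y \<in> M" and sc: "x \<in> M \<Longrightarrow> c *\<^sub>C x \<in> M" for x y c
    using assms by (auto simp: csubspace_def)
  show r: "x \<in> M \<Longrightarrow> r *\<^sub>R x \<in> M" for r x
    using sc by (simp add: scaleR_scaleC)
  show m: "x \<in> M \<Longrightarrow> - x \<in> M" for x
    using r[of x "- 1"] by simp
  show "x \<in> M \<Longrightarrow> y \<in> M \<Longrightarrow> x - y \<in> M"
    using add[of x "- y"] m[of y] by simp
qed

text \<open>A minimising sequence for the distance to \<open>M\<close> is Cauchy because midpoints
  stay in \<open>M\<close>; its limit is the foot of the perpendicular.\<close>

lemma ex_orthogonal_projection:
  fixes x :: "'a::complex_hilbert_space"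
  assumes M: "csubspace M" and cl: "closed M"
  shows "\<exists>y\<in>M. \<forall>z\<in>M. cinner (x - y) z = 0"
proof -
  note MD = csubspaceD[OF M]
  define d where "d = infdist x M"
  have ne: "M \<noteq> {}" using MD(1) by auto
  have d0: "d \<ge> 0" by (simp add: d_def infdist_nonneg)
  have dle: "d \<le> norm (x - y)" if "y \<in> M" for y
    using infdist_le[OF that, of x] by (simp add: d_def dist_norm)
  have ex: "\<exists>y\<in>M. norm (x - y) < d + inverse (Suc n)" for n
  proof (rule ccontr)
    assume "\<not> ?thesis"
    then have "d + inverse (Suc n) \<le> dist x y" if "y \<in> M" for y
      using that by (force simp: dist_norm)
    then have "d + inverse (Suc n) \<le> d"
      unfolding d_def infdist_notempty[OF ne] by (intro cINF_greatest[OF ne]) (auto simp: d_def infdist_notempty[OF ne])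
    then show False by simp
  qed
  then have "\<forall>n. \<exists>y. y \<in> M \<and> norm (x - y) < d + inverse (Suc n)" by blast
  from choice[OF this] obtain f
    where f: "\<And>n. f n \<in> M" "\<And>n. norm (x - f n) < d + inverse (Suc n)"
    by blast
  have mid: "(norm (f i - f j))^2 \<le> 2 * (norm (x - f i))^2 + 2 * (norm (x - f j))^2 - 4 * d^2" for i j
  proof -
    have "(1/2) *\<^sub>R (f i + f j) \<in> M" by (intro MD f)
    from dle[OF this] have "d^2 \<le> (norm (x - (1/2) *\<^sub>R (f i + f j)))^2"
      using d0 by (intro power_mono)
    moreover have "(x - f i) + (x - f j) = 2 *\<^sub>R (x - (1/2) *\<^sub>R (f i + f j))"
      by (simp add: algebra_simps scaleR_2)
    then have "(norm ((x - f i) + (x - f j)))^2 = 4 * (norm (x - (1/2) *\<^sub>R (f i + f j)))^2"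
      by (simp add: power_mult_distrib)
    moreover have "(x - f i) - (x - f j) = f j - f i" by simp
    ultimately show ?thesis
      using parallelogram[of "x - f i" "x - f j"] by (simp add: norm_minus_commute)
  qed
  have lim: "(\<lambda>n. (norm (x - f n))^2) \<longlonglongrightarrow> d^2"
  proof (intro tendsto_power)
    show "(\<lambda>n. norm (x - f n)) \<longlonglongrightarrow> d"
    proof (rule tendsto_sandwich[where f = "\<lambda>n. d"])
      show "(\<lambda>n. d + inverse (real (Suc n))) \<longlonglongrightarrow> d"
        using tendsto_add[OF tendsto_const LIMSEQ_inverse_real_of_nat, of d] by simp
      show "\<forall>\<^sub>F n in sequentially. norm (x - f n) \<le> d + inverse (real (Suc n))"
        by (intro always_eventually allI less_imp_le f(2))
    qed (use f(1) dle in auto)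
  qed
  have "Cauchy f"
  proof (rule CauchyI)
    fix e :: real assume e: "0 < e"
    then have "\<forall>\<^sub>F n in sequentially. (norm (x - f n))^2 < d^2 + e^2 / 4"
      using lim by (intro order_tendstoD) auto
    then obtain N where N: "\<And>n. n \<ge> N \<Longrightarrow> (norm (x - f n))^2 < d^2 + e^2 / 4"
      by (auto simp: eventually_sequentially)
    show "\<exists>N. \<forall>i\<ge>N. \<forall>j\<ge>N. norm (f i - f j) < e"
    proof (intro exI allI impI)
      fix i j assume "N \<le> i" "N \<le> j"
      then have "(norm (f i - f j))^2 < e^2"
        using mid[of i j] N[of i] N[of j] by auto
      then show "norm (f i - f j) < e"
        using e by (simp add: power2_less_imp_less)
    qed
  qed
  then obtain y where y: "f \<longlonglongrightarrow> y"
    using Cauchy_convergent convergent_def by blast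
  have yM: "y \<in> M"
    using cl f(1) y closed_sequentially by blast
  have "(\<lambda>n. (norm (x - f n))^2) \<longlonglongrightarrow> (norm (x - y))^2"
    by (intro tendsto_intros y)
  then have ny: "(norm (x - y))^2 = d^2"
    using lim LIMSEQ_unique by blast
  have "cinner (x - y) z = 0" if z: "z \<in> M" for z
  proof (cases "z = 0")
    case False
    \<comment> \<open>The coefficient of \<open>x - y\<close> along \<open>z\<close>: moving from
      \<open>y\<close> to \<open>y + c z\<close> would lower the squared distance by |c|^2 |z|^2, so
      minimality forces \<open>c = 0\<close>.\<close>
    define c where "c = cinner (x - y) z / of_real ((norm z)^2)"
    have "y + c *\<^sub>C z \<in> M" by (intro MD yM z)
    from dle[OF this] have "d^2 \<le> (norm (x - y - c *\<^sub>C z))^2"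
      using d0 by (intro power_mono) (auto simp: algebra_simps)
    also have "\<dots> = d^2 + (cmod c)^2 * (norm z)^2 - 2 * Re (cnj c * cinner (x - y) z)"
      by (simp add: norm_diff_square[of "x - y" "c *\<^sub>C z"] ny norm_scaleC power_mult_distrib cinner_scaleC_right)
    also have "cinner (x - y) z = c * complex_of_real ((norm z)^2)"
      using False by (simp add: c_def)
    also have "cnj c * (c * complex_of_real ((norm z)^2)) = complex_of_real ((cmod c)^2 * (norm z)^2)"
      using cnj_mult_self[of c] by (simp add: mult.assoc[symmetric])
    finally have "(cmod c)^2 * (norm z)^2 \<le> 0" by (simp add: mult.commute)
    then have "c = 0" using False
      by (simp add: mult_le_0_iff)
    then show ?thesis using False by (simp add: c_def)
  qed simp
  then show ?thesis using yM by blast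
qed

text \<open>Same shape as \<open>eigen_proj\<close>, so that \<open>eigen_proj_eq\<close> is a mere
  unfolding. The general subspace is needed for eigenspaces of the modal operators and for the range
  of \<open>shift\<close>.\<close>

definition oproj :: "'a::complex_hilbert_space set \<Rightarrow> 'a \<Rightarrow> 'a" where
  "oproj M x = (THE y. y \<in> M \<and> (\<forall>z\<in>M. cinner (x - y) z = 0))"

lemma oproj_unique:
  fixes x :: "'a::complex_hilbert_space"
  assumes M: "csubspace M" and "y \<in> M" "\<And>z. z \<in> M \<Longrightarrow> cinner (x - y) z = 0"
  shows "oproj M x = y"
  unfolding oproj_def
proof (rule the_equality)
  fix y' assume y': "y' \<in> M \<and> (\<forall>z\<in>M. cinner (x - y') z = 0)"
  then have "y' - y \<in> M" using csubspaceD(6)[OF M] assms(2) by auto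
  then have "cinner (y' - y) (y' - y) = 0"
    using y' assms(3)[of "y' - y"] cinner.diff_left[of "x - y" "x - y'" "y' - y"] by simp
  then show "y' = y" by (simp add: cinner_self)
qed (use assms in auto)

context
  fixes M :: "'a::complex_hilbert_space set"
  assumes M: "csubspace M" and cl: "closed M"
begin

lemma oproj:
  shows "oproj M x \<in> M" "z \<in> M \<Longrightarrow> cinner (x - oproj M x) z = 0"
proof -
  obtain y where "y \<in> M" "\<And>z. z \<in> M \<Longrightarrow> cinner (x - y) z = 0"
    using ex_orthogonal_projection[OF M cl] by blast
  with oproj_unique[OF M this] show "oproj M x \<in> M" "z \<in> M \<Longrightarrow> cinner (x - oproj M x) z = 0"
    by auto
qed

lemma oproj_pythagoras:
  shows "(norm x)^2 = (norm (oproj M x))^2 + (norm (x - oproj M x))^2"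
  using norm_add_square_orthogonal[of "x - oproj M x" "oproj M x"] oproj(2)[of "oproj M x" x] oproj(1)[of x]
  by simp

lemma norm_oproj_le:
  shows "norm (oproj M x) \<le> norm x"
  using oproj_pythagoras[of x] by (simp add: power2_le_imp_le)

lemma oproj_add:
  shows "oproj M (x + y) = oproj M x + oproj M y"
proof (rule oproj_unique[OF M])
  show "cinner (x + y - (oproj M x + oproj M y)) z = 0" if "z \<in> M" for z
    using oproj(2)[OF that, of x] oproj(2)[OF that, of y]
    by (simp add: cinner.diff_left cinner.add_left)
qed (intro csubspaceD(2)[OF M] oproj(1))

lemma oproj_scaleC:
  shows "oproj M (c *\<^sub>C x) = c *\<^sub>C oproj M x"
proof (rule oproj_unique[OF M])
  show "cinner (c *\<^sub>C x - c *\<^sub>C oproj M x) z = 0" if "z \<in> M" for z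
    using oproj(2)[OF that, of x] cinner_scaleC_left[of c "x - oproj M x" z]
    by (simp add: scaleC_diff_right)
qed (intro csubspaceD(3)[OF M] oproj(1))

lemma bounded_linear_oproj:
  shows "bounded_linear (oproj M)"
  by (rule bounded_linear_intro[of _ 1])
    (simp_all add: oproj_add oproj_scaleC scaleR_scaleC norm_oproj_le)

end

lemma csubspace_orthogonal:
  "csubspace {x :: 'a::complex_hilbert_space. \<forall>z\<in>M. cinner x z = 0}"
  by (auto simp: csubspace_def cinner.add_left cinner.zero_left cinner_scaleC_left)

lemma closed_orthogonal:
  "closed {x :: 'a::complex_hilbert_space. \<forall>z\<in>M. cinner x z = 0}"
proof -
  have "{x :: 'a. \<forall>z\<in>M. cinner x z = 0} = (\<Inter>z\<in>M. {x. cinner x z = 0})" by auto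
  also have "closed \<dots>"
    by (intro closed_INT ballI closed_Collect_eq cinner.continuous_on continuous_on_id continuous_on_const)
  finally show ?thesis .
qed

text \<open>The norm on pairs is Euclidean, so the sum of the inner products induces it. This makes
  the four variables of a mode one Hilbert space, to which \<open>dissipative_decay\<close>
  applies.\<close>

instantiation prod :: (complex_hilbert_space, complex_hilbert_space) complex_hilbert_space
begin

definition cinner_prod :: "'a \<times> 'b \<Rightarrow> 'a \<times> 'b \<Rightarrow> complex" where
  "cinner_prod x y = cinner (fst x) (fst y) + cinner (snd x) (snd y)"

instance
proof
  fix x y z :: "'a \<times> 'b" and c :: complex
  show "cinner x y = cnj (cinner y x)"
    by (simp add: cinner_prod_def cinner_commute[symmetric])
  show "cinner (x + y) z = cinner x z + cinner y z"
    by (simp add: cinner_prod_def cinner_add_left)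
  show "cinner (c *\<^sub>C x) y = c * cinner x y"
    by (simp add: cinner_prod_def scaleC_prod_def cinner_scaleC_left algebra_simps)
  show "cinner x x = of_real ((norm x)^2)"
    by (simp add: cinner_prod_def cinner_self norm_prod_def)
qed

end

section \<open>Decay of dissipative systems annihilated by a polynomial\<close>

text \<open>Here \<open>a\<close> is an energy damped at rate \<open>r\<close> and fed by
  \<open>2 * D\<close>, while \<open>b\<close> is an energy that loses exactly \<open>D\<close>.
  Whatever is fed into \<open>a\<close> after time \<open>s\<close> is therefore at most
  \<open>2 * b s\<close>.\<close>

lemma forced_decay_estimate:
  fixes a b a' D :: "real \<Rightarrow> real"
  assumes st: "0 < s" "s \<le> t"
    and r: "0 < r"
    and a: "\<And>u. 0 < u \<Longrightarrow> (a has_real_derivative a' u) (at u)"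
    and a': "\<And>u. 0 < u \<Longrightarrow> a' u \<le> - r * a u + 2 * D u"
    and b: "\<And>u. 0 < u \<Longrightarrow> (b has_real_derivative - D u) (at u)"
    and D: "\<And>u. 0 < u \<Longrightarrow> 0 \<le> D u"
    and b0: "0 \<le> b t"
  shows "a t \<le> exp (- r * (t - s)) * a s + 2 * b s"
proof -
  have bmono: "b u \<le> b s" if "s \<le> u" for u
  proof (rule DERIV_nonpos_imp_nonincreasing[OF that])
    fix v assume "s \<le> v" "v \<le> u"
    then have "0 < v" using st by simp
    then show "\<exists>d. (b has_real_derivative d) (at v) \<and> d \<le> 0"
      using b[of v] D[of v] by (intro exI[of _ "- D v"]) simp
  qed
  \<comment> \<open>Adding \<open>2 * b\<close> cancels the forcing, and subtracting the constant
    \<open>2 * b s\<close> leaves a term of the right sign because \<open>b\<close>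
    decreases.\<close>
  define F where "F u = exp (r * u) * (a u + 2 * b u - 2 * b s)" for u
  define F' where "F' u = exp (r * u) * r * (a u + 2 * b u - 2 * b s) + exp (r * u) * (a' u + 2 * (- D u))" for u
  have F: "(F has_real_derivative F' u) (at u)" if "0 < u" for u
    unfolding F_def F'_def using a[OF that] b[OF that]
    by (auto intro!: derivative_eq_intros)
  have F'_le: "F' u \<le> 0" if "s \<le> u" for u
  proof -
    have "F' u = exp (r * u) * (r * (a u + 2 * b u - 2 * b s) + a' u - 2 * D u)"
      by (simp add: F'_def algebra_simps)
    also have "\<dots> \<le> exp (r * u) * (2 * r * (b u - b s))"
      using a'[of u] that st by (intro mult_left_mono) (auto simp: algebra_simps)
    also have "\<dots> \<le> 0"
      using bmono[OF that] r by (intro mult_nonneg_nonpos) auto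
    finally show ?thesis .
  qed
  have "F t \<le> F s"
  proof (intro DERIV_nonpos_imp_nonincreasing[OF st(2)])
    fix u assume "s \<le> u" "u \<le> t"
    with F[of u] F'_le[of u] st(1)
    show "\<exists>d. (F has_real_derivative d) (at u) \<and> d \<le> 0" by (intro exI[of _ "F' u"]) simp
  qed
  moreover have "F t = exp (r * t) * (a t - 2 * b s) + 2 * (exp (r * t) * b t)" "F s = exp (r * s) * a s"
    by (simp_all add: F_def algebra_simps)
  moreover have "0 \<le> exp (r * t) * b t" using b0 by simp
  ultimately have "exp (r * t) * (a t - 2 * b s) \<le> exp (r * s) * a s" by linarith
  moreover have e1: "exp (- (r * t)) * exp (r * t) = 1" by (simp add: exp_minus)
  have e2: "exp (- (r * t)) * exp (r * s) = exp (- r * (t - s))"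
    by (simp only: mult_exp_exp) (simp add: algebra_simps)
  ultimately have "exp (- (r * t)) * (exp (r * t) * (a t - 2 * b s)) \<le> exp (- (r * t)) * (exp (r * s) * a s)"
    by (intro mult_left_mono) auto
  then show ?thesis
    using e1 e2 by (simp add: mult.assoc[symmetric])
qed

text \<open>The head of the list acts last: if the whole product annihilates \<open>x\<close>, the
  product over the tail lands in the eigenspace of the head, which is the subspace split off in the
  induction.\<close>

abbreviation shifts :: "('a \<Rightarrow> 'a::complex_vector) \<Rightarrow> complex list \<Rightarrow> 'a \<Rightarrow> 'a" where
  "shifts B \<equiv> foldr (\<lambda>\<mu> x. B x - \<mu> *\<^sub>C x)"

text \<open>One step of the induction in \<open>dissipative_decay\<close>: \<open>4 powr k\<close>
  comes from using bounds at times t/2 and t/4, and 3 from 6 + 7 c^2 \<le> (3 (1 + c))^2. No data of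
  the operator enter, which gives uniformity over the modes.\<close>

primrec decay_const :: "real \<Rightarrow> nat \<Rightarrow> real" where
  "decay_const k 0 = 0"
| "decay_const k (Suc n) = 3 * 4 powr k * (1 + decay_const k n)"

lemma decay_const_nonneg: "0 \<le> decay_const k n"
  by (induction n) auto

lemma has_real_derivative_norm_square:
  fixes x :: "real \<Rightarrow> 'a::complex_hilbert_space"
  assumes "(x has_vector_derivative x') (at t)"
  shows "((\<lambda>t. (norm (x t))^2) has_real_derivative 2 * Re (cinner x' (x t))) (at t)"
proof -
  have "((\<lambda>t. cinner (x t) (x t)) has_vector_derivative (cinner (x t) x' + cinner x' (x t))) (at t)"
    by (rule cinner.has_vector_derivative[OF assms assms])
  then have "((\<lambda>t. Re (cinner (x t) (x t))) has_vector_derivative Re (cinner (x t) x' + cinner x' (x t))) (at t)"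
    by (rule bounded_linear.has_vector_derivative[OF bounded_linear_Re])
  then show ?thesis
    using Re_cinner_commute[of x' "x t"]
    by (simp add: Re_cinner_self has_real_derivative_iff_has_vector_derivative)
qed

text \<open>The induction splits off \<open>ker (B - \<mu>)\<close>: on its orthogonal complement the compression of \<open>B\<close>
  is annihilated by the remaining factors, and dissipativity bounds the coupling between the two
  parts by the geometric mean of their dissipation rates.\<close>

lemma dissipative_decay:
  fixes B :: "'k::complex_hilbert_space \<Rightarrow> 'k"
  assumes k: "0 \<le> k" and K: "0 \<le> K"
    and roots: "\<And>\<mu>. \<mu> \<in> set \<mu>s \<Longrightarrow> Re \<mu> < 0"
      "\<And>\<mu> t. \<mu> \<in> set \<mu>s \<Longrightarrow> 0 < t \<Longrightarrow> exp (Re \<mu> * t) \<le> K * cmod \<mu> * t powr (- k)"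
    and B: "bounded_linear B" "\<And>c x. B (c *\<^sub>C x) = c *\<^sub>C B x"
    and V: "csubspace V" "closed V" "\<And>x. x \<in> V \<Longrightarrow> B x \<in> V"
    and diss: "\<And>x. x \<in> V \<Longrightarrow> Re (cinner (B x) x) \<le> 0"
    and ann: "\<And>x. x \<in> V \<Longrightarrow> shifts B \<mu>s x = 0"
    and x: "\<And>t. 0 < t \<Longrightarrow> x t \<in> V"
      "\<And>t. 0 < t \<Longrightarrow> (x has_vector_derivative B (x t)) (at t)"
      "\<And>t. 0 < t \<Longrightarrow> norm (B (x t)) \<le> g"
    and t: "0 < t"
  shows "norm (x t) \<le> decay_const k (length \<mu>s) * K * t powr (- k) * g"
  using roots B V diss ann x t
proof (induction \<mu>s arbitrary: B V x t)
  case Nil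
  have "x t = 0" using Nil.prems(9)[of "x t"] Nil.prems(10)[OF Nil.prems(13)] by simp
  then show ?case by simp
next
  case (Cons \<mu> \<mu>s B V x t)
  note roots = Cons.prems(1,2) and B = Cons.prems(3,4) and V = Cons.prems(5-7)
    and diss = Cons.prems(8) and ann = Cons.prems(9) and x = Cons.prems(10-12) and t = Cons.prems(13)
  interpret B: bounded_linear B by (rule B(1))
  note VD = csubspaceD[OF V(1)]
  define r where "r = - Re \<mu>"
  have r: "0 < r" using roots(1)[of \<mu>] by (simp add: r_def)
  have \<mu>0: "\<mu> \<noteq> 0" using r by (auto simp: r_def)
  have r_le: "r \<le> cmod \<mu>" using abs_Re_le_cmod[of \<mu>] by (simp add: r_def)
  define V1 where "V1 = {x \<in> V. B x = \<mu> *\<^sub>C x}"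
  have V1: "csubspace V1"
    using V(1) B(2) B.zero B.add by (auto simp: V1_def csubspace_def scaleC_add_right scaleC_scaleC mult.commute)
  have "V1 = V \<inter> {x. B x = \<mu> *\<^sub>C x}" by (auto simp: V1_def)
  also have "closed \<dots>"
    by (intro closed_Int V(2) closed_Collect_eq B.continuous_on bounded_linear.continuous_on[OF bounded_linear_scaleC] continuous_on_id)
  finally have cl1: "closed V1" .
  note VD1 = csubspaceD[OF V1]
  define P where "P = oproj V1"
  define Q where "Q x = x - P x" for x
  have P_in: "P z \<in> V1" for z unfolding P_def by (rule oproj(1)[OF V1 cl1])
  have P_inV: "P z \<in> V" for z using P_in by (auto simp: V1_def)
  have Q_orth: "cinner (Q z) w = 0" if "w \<in> V1" for z w
    unfolding Q_def P_def by (rule oproj(2)[OF V1 cl1 that])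
  have Q_inV: "Q z \<in> V" if "z \<in> V" for z unfolding Q_def by (intro VD P_inV that)
  have blP: "bounded_linear P" unfolding P_def by (rule bounded_linear_oproj[OF V1 cl1])
  have blQ: "bounded_linear Q" unfolding Q_def using blP by (intro bounded_linear_sub bounded_linear_ident)
  interpret P: bounded_linear P by (rule blP)
  interpret Q: bounded_linear Q by (rule blQ)
  have P_sc: "P (c *\<^sub>C z) = c *\<^sub>C P z" for c z unfolding P_def by (rule oproj_scaleC[OF V1 cl1])
  have Q_sc: "Q (c *\<^sub>C z) = c *\<^sub>C Q z" for c z by (simp add: Q_def P_sc scaleC_diff_right)
  have P_V1: "P z = z" if "z \<in> V1" for z
    unfolding P_def by (rule oproj_unique[OF V1 that]) simp
  have Q_V1: "Q z = 0" if "z \<in> V1" for z by (simp add: Q_def P_V1[OF that])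
  have pyth: "(norm z)^2 = (norm (P z))^2 + (norm (Q z))^2" for z
    unfolding Q_def P_def by (rule oproj_pythagoras[OF V1 cl1])
  have QQ: "Q z = z" if "\<And>w. w \<in> V1 \<Longrightarrow> cinner z w = 0" for z
  proof -
    have "P z = 0" unfolding P_def by (rule oproj_unique[OF V1]) (use that VD1 in auto)
    then show ?thesis by (simp add: Q_def)
  qed
  have BV1: "B z \<in> V1" if "z \<in> V1" for z
    using that VD1(3)[OF that, of \<mu>] by (auto simp: V1_def)
  \<comment> \<open>The compression to the complement of \<open>V1\<close>. As \<open>V1\<close> is
    invariant under \<open>B\<close>, the projection satisfies \<open>Q (B z) = B' (Q z)\<close>, so
    it intertwines all polynomials in the two operators: trajectories, the bound \<open>g\<close>
    and the annihilation pass to \<open>B'\<close>.\<close>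
  define B' where "B' z = Q (B z)" for z
  define V' where "V' = V \<inter> {z. \<forall>w\<in>V1. cinner z w = 0}"
  have QB: "Q (B z) = B' (Q z)" for z
  proof -
    have "Q (B (P z)) = 0" by (intro Q_V1 BV1 P_in)
    moreover have "B z = B (P z) + B (Q z)" by (simp add: Q_def B.diff)
    ultimately show ?thesis by (simp add: B'_def Q.add)
  qed
  have B': "bounded_linear B'" "\<And>c z. B' (c *\<^sub>C z) = c *\<^sub>C B' z"
    unfolding B'_def by (intro bounded_linear_compose[OF blQ B(1)]) (simp add: B(2) Q_sc)
  have V': "csubspace V'" "closed V'"
    unfolding V'_def using V(1) csubspace_orthogonal[of V1]
    by (simp add: csubspace_def) (intro closed_Int V(2) closed_orthogonal)
  have B'V': "B' z \<in> V'" if "z \<in> V'" for z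
    using that Q_orth Q_inV[OF V(3)[of z]] by (auto simp: V'_def B'_def)
  have fold_V: "shifts B ms z \<in> V" if "z \<in> V" for ms z
    using that by (induction ms) (auto intro!: VD V(3))
  have fold_Q: "Q (shifts B ms z) = shifts B' ms (Q z)" for ms z
    by (induction ms) (auto simp: Q.diff Q_sc QB)
  have ann': "shifts B' \<mu>s z = 0" if "z \<in> V'" for z
  proof -
    have zV: "z \<in> V" and Qz: "Q z = z" using that QQ by (auto simp: V'_def)
    have "shifts B \<mu>s z \<in> V1"
      using ann[OF zV] fold_V[OF zV] by (auto simp: V1_def)
    then show ?thesis using Q_V1 fold_Q[of \<mu>s z] Qz by simp
  qed
  \<comment> \<open>The discarded part \<open>P (B z)\<close> is orthogonal to \<open>z\<close>, so
    compressing does not change the quadratic form and dissipativity is inherited.\<close>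
  have cin_B': "cinner (B' z) z = cinner (B z) z" if "z \<in> V'" for z
  proof -
    have "cinner (P (B z)) z = 0"
      using that P_in[of "B z"] cinner_eq_0_commute[of _ z] by (auto simp: V'_def)
    then show ?thesis by (simp add: B'_def Q_def cinner.diff_left)
  qed
  have diss': "Re (cinner (B' z) z) \<le> 0" if "z \<in> V'" for z
    using cin_B'[OF that] diss[of z] that by (auto simp: V'_def)
  define y where "y u = Q (x u)" for u
  define \<xi> where "\<xi> u = P (x u)" for u
  have yV: "y u \<in> V'" if "0 < u" for u
    using Q_inV[OF x(1)[OF that]] Q_orth by (auto simp: y_def V'_def)
  have yd: "(y has_vector_derivative B' (y u)) (at u)" if "0 < u" for u
    using bounded_linear.has_vector_derivative[OF blQ x(2)[OF that]] by (simp add: y_def[abs_def] QB)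
  have Bx: "B (x u) = \<mu> *\<^sub>C \<xi> u + B (y u)" for u
  proof -
    have "B (x u) = B (P (x u)) + B (Q (x u))" by (simp add: Q_def B.diff)
    then show ?thesis using P_in[of "x u"] by (simp add: V1_def \<xi>_def y_def)
  qed
  define w where "w u = P (B (y u))" for u
  have PB: "P (B (x u)) = \<mu> *\<^sub>C \<xi> u + w u" for u
    unfolding Bx w_def P.add P_sc using P_V1[OF P_in[of "x u"]] by (simp add: \<xi>_def)
  have \<xi>d: "(\<xi> has_vector_derivative \<mu> *\<^sub>C \<xi> u + w u) (at u)" if "0 < u" for u
    using bounded_linear.has_vector_derivative[OF blP x(2)[OF that]] PB[of u] by (simp add: \<xi>_def[abs_def])
  have Pg: "norm (P (B (x u))) \<le> g" "norm (B' (y u)) \<le> g" if "0 < u" for u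
  proof -
    have "(norm (P (B (x u))))^2 \<le> (norm (B (x u)))^2" "(norm (Q (B (x u))))^2 \<le> (norm (B (x u)))^2"
      using pyth[of "B (x u)"] by auto
    then show "norm (P (B (x u))) \<le> g" "norm (B' (y u)) \<le> g"
      using x(3)[OF that] QB[of "x u"] by (auto simp: y_def intro: power2_le_imp_le order_trans)
  qed
  have g0: "0 \<le> g" using x(3)[OF t] norm_ge_zero order_trans by blast
  define D where "D u = - 2 * Re (cinner (B' (y u)) (y u))" for u
  have D0: "0 \<le> D u" if "0 < u" for u using diss'[OF yV[OF that]] by (simp add: D_def)
  have Dg: "D u \<le> 2 * g * norm (y u)" if "0 < u" for u
  proof -
    have "D u \<le> 2 * (norm (B' (y u)) * norm (y u))"
      unfolding D_def using abs_le_D2[OF cauchy_schwarz_aux[of "B' (y u)" "y u"]] by linarith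
    also have "\<dots> \<le> 2 * (g * norm (y u))" using Pg(2)[OF that] by (simp add: mult_right_mono)
    finally show ?thesis by simp
  qed
  have wD: "(norm (w u))^2 \<le> 2 * r * D u" if u: "0 < u" for u
  proof -
    \<comment> \<open>Dissipativity tested on \<open>s w + y\<close> reads (s - s^2 r) |w|^2 \<le> D
      / 2 at time \<open>u\<close>; this \<open>s\<close> maximises the left side.\<close>
    define s where "s = 1 / (2 * r)"
    have wV1: "w u \<in> V1" unfolding w_def by (rule P_in)
    have yu: "y u \<in> V" "\<And>v. v \<in> V1 \<Longrightarrow> cinner (y u) v = 0" using yV[OF u] by (auto simp: V'_def)
    have z: "s *\<^sub>R w u + y u \<in> V" using wV1 yu by (intro VD) (auto simp: V1_def)
    have "B (s *\<^sub>R w u + y u) = s *\<^sub>R \<mu> *\<^sub>C w u + B (y u)"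
      using wV1 by (simp add: B.add B.scaleR V1_def)
    moreover have "cinner (w u) (y u) = 0" using yu(2)[OF wV1] cinner_eq_0_commute by blast
    moreover have "cinner (B (y u)) (w u) = of_real ((norm (w u))^2)"
      using Q_orth[OF wV1, of "B (y u)"] by (simp add: Q_def w_def cinner.diff_left cinner_self)
    ultimately have "cinner (B (s *\<^sub>R w u + y u)) (s *\<^sub>R w u + y u) =
        s^2 *\<^sub>R (\<mu> * of_real ((norm (w u))^2)) + s *\<^sub>R of_real ((norm (w u))^2) + cinner (B (y u)) (y u)"
      by (simp add: cinner.add_left cinner.add_right cinner_scaleR_left cinner_scaleR_right cinner_scaleC_left
          cinner_self power2_eq_square algebra_simps)
    then have "(s - s^2 * r) * (norm (w u))^2 \<le> D u / 2"
      using diss[OF z] cin_B'[OF yV[OF u]] by (simp add: D_def r_def algebra_simps)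
    also have "s - s^2 * r = 1 / (4 * r)" using r by (simp add: s_def power2_eq_square field_simps)
    finally show ?thesis using r by (simp add: field_simps)
  qed
  \<comment> \<open>The eigenspace part is damped at rate 2 r. Young's inequality spends half of
    that on the coupling \<open>w\<close>, and \<open>wD\<close> turns the remaining |w|^2 / r into
    \<open>2 * D\<close>, the loss of the energy of \<open>y\<close>.\<close>
  have est: "(norm (\<xi> t))^2 \<le> exp (- r * (t - t / 2)) * (norm (\<xi> (t / 2)))^2 + 2 * (norm (y (t / 2)))^2"
  proof (rule forced_decay_estimate[where D = D and a' = "\<lambda>u. 2 * Re (cinner (\<mu> *\<^sub>C \<xi> u + w u) (\<xi> u))" and r = r])
    show "2 * Re (cinner (\<mu> *\<^sub>C \<xi> u + w u) (\<xi> u)) \<le> - r * (norm (\<xi> u))^2 + 2 * D u" if u: "0 < u" for u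
    proof -
      have "2 * Re (cinner (\<mu> *\<^sub>C \<xi> u + w u) (\<xi> u)) = - 2 * r * (norm (\<xi> u))^2 + 2 * Re (cinner (w u) (\<xi> u))"
        by (simp add: cinner.add_left cinner_scaleC_left cinner_self r_def algebra_simps del: of_real_power)
      moreover have "2 * Re (cinner (w u) (\<xi> u)) \<le> 2 * (norm (w u) * norm (\<xi> u))"
        using abs_le_D1[OF cauchy_schwarz_aux[of "w u" "\<xi> u"]] by linarith
      moreover have "2 * (norm (w u) * norm (\<xi> u)) \<le> r * (norm (\<xi> u))^2 + (norm (w u))^2 / r"
      proof -
        have "0 \<le> (r * norm (\<xi> u) - norm (w u))^2 / r" using r by simp
        then show ?thesis using r by (simp add: power2_diff power2_eq_square field_simps)
      qed
      moreover have "(norm (w u))^2 / r \<le> 2 * D u" using wD[OF u] r by (simp add: field_simps)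
      ultimately show ?thesis by (simp add: algebra_simps)
    qed
  qed (use t r D0 has_real_derivative_norm_square[OF \<xi>d] has_real_derivative_norm_square[OF yd] in \<open>auto simp: D_def\<close>)
  define h where "h = t / 2"
  define E where "E = exp (- r * (t - t / 2))"
  have E: "0 \<le> E" "E \<le> 1" using r t by (simp_all add: E_def)
  have h: "0 < h" using t by (simp add: h_def)
  \<comment> \<open>The factor 1/|\<mu>| enters here: \<open>P (B x) = \<mu> \<xi> + w\<close> is
    bounded by \<open>g\<close>, and \<open>w\<close> is controlled through \<open>wD\<close>,
    \<open>Dg\<close> and \<open>r_le\<close>.\<close>
  have init: "(norm (\<xi> h))^2 \<le> 6 * g^2 / (cmod \<mu>)^2 + 4 * (norm (y h))^2"
  proof -
    have "norm (\<mu> *\<^sub>C \<xi> h) \<le> norm (P (B (x h))) + norm (w h)"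
      unfolding PB using norm_triangle_ineq4[of "\<mu> *\<^sub>C \<xi> h + w h" "w h"] by simp
    then have "cmod \<mu> * norm (\<xi> h) \<le> g + norm (w h)" using Pg(1)[OF h] by (simp add: norm_scaleC)
    then have "(cmod \<mu> * norm (\<xi> h))^2 \<le> (g + norm (w h))^2" by (intro power_mono) auto
    also have "\<dots> \<le> 2 * g^2 + 2 * (norm (w h))^2"
      using zero_le_power2[of "g - norm (w h)"] by (simp add: power2_sum power2_diff)
    also have "(norm (w h))^2 \<le> 2 * r * (2 * g * norm (y h))"
      using wD[OF h] mult_left_mono[OF Dg[OF h], of "2 * r"] r by linarith
    also have "2 * r * (2 * g * norm (y h)) \<le> 2 * cmod \<mu> * (2 * g * norm (y h))"
      using r_le g0 by (intro mult_right_mono) auto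
    also have "2 * (2 * cmod \<mu> * (2 * g * norm (y h))) \<le> 4 * g^2 + 4 * (cmod \<mu> * norm (y h))^2"
      using zero_le_power2[of "g - cmod \<mu> * norm (y h)"] by (simp add: power2_diff algebra_simps)
    finally show ?thesis using \<mu>0 by (simp add: field_simps)
  qed
  define c where "c = decay_const k (length \<mu>s)"
  have c0: "0 \<le> c" by (simp add: c_def decay_const_nonneg)
  have IH: "norm (y h) \<le> c * K * h powr (- k) * g"
    unfolding c_def
  proof (rule Cons.IH[OF _ _ B' V' B'V' diss' ann' yV yd Pg(2) h])
    show "Re m < 0" if "m \<in> set \<mu>s" for m using roots(1) that by simp
    show "exp (Re m * t) \<le> K * cmod m * t powr - k" if "m \<in> set \<mu>s" "0 < t" for m t using roots(2) that by simp
  qed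
  define G where "G = K * 4 powr k * t powr (- k) * g"
  have G0: "0 \<le> G" using K g0 by (simp add: G_def)
  have hG: "norm (y h) \<le> c * G"
  proof -
    have "h powr (- k) = 2 powr k * t powr (- k)"
      using t by (simp add: h_def powr_divide powr_minus field_simps)
    moreover have "(2::real) powr k \<le> 4 powr k" using k by (intro powr_mono2) auto
    ultimately have "h powr (- k) \<le> 4 powr k * t powr (- k)" by (simp add: mult_right_mono)
    then have "c * K * h powr (- k) * g \<le> c * K * (4 powr k * t powr (- k)) * g"
      using K g0 c0 by (intro mult_right_mono mult_left_mono) auto
    then show ?thesis using IH by (simp add: G_def algebra_simps)
  qed
  \<comment> \<open>\<open>E\<close> is the square of \<open>exp (Re \<mu> * (t / 4))\<close>, so
    the hypothesis on the root is used at time t/4.\<close>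
  have "E * (6 * g^2 / (cmod \<mu>)^2) \<le> 6 * G^2"
  proof -
    have "exp (Re \<mu> * (t / 4)) \<le> K * cmod \<mu> * (t / 4) powr (- k)" using roots(2)[of \<mu> "t / 4"] t by simp
    also have "(t / 4) powr (- k) = 4 powr k * t powr (- k)"
      using t by (simp add: powr_divide powr_minus field_simps)
    finally have "exp (Re \<mu> * (t / 4)) * (g / cmod \<mu>) \<le> K * cmod \<mu> * (4 powr k * t powr (- k)) * (g / cmod \<mu>)"
      using g0 by (intro mult_right_mono) auto
    then have "exp (Re \<mu> * (t / 4)) * (g / cmod \<mu>) \<le> G" using \<mu>0 by (simp add: G_def)
    then have "(exp (Re \<mu> * (t / 4)) * (g / cmod \<mu>))^2 \<le> G^2" using g0 by (intro power_mono) auto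
    moreover have "(exp (Re \<mu> * (t / 4)))^2 = E"
      by (simp add: power2_eq_square exp_add[symmetric] r_def E_def)
    ultimately have "E * (g^2 / (cmod \<mu>)^2) \<le> G^2"
      by (simp add: power_mult_distrib power_divide)
    moreover have "E * (6 * g^2 / (cmod \<mu>)^2) = 6 * (E * (g^2 / (cmod \<mu>)^2))"
      by simp
    ultimately show ?thesis by (simp only:)
  qed
  \<comment> \<open>7 = 4 + 2 + 1, the contributions of \<open>init\<close>, of \<open>est\<close>
    and of \<open>y\<close> at time \<open>t\<close>.\<close>
  moreover have "(norm (x t))^2 \<le> E * (6 * g^2 / (cmod \<mu>)^2) + 7 * (norm (y h))^2"
  proof -
    have "(norm (y t))^2 \<le> (norm (y h))^2"
    proof (rule DERIV_nonpos_imp_nonincreasing[of h t])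
      show "\<exists>d. ((\<lambda>u. (norm (y u))^2) has_real_derivative d) (at u) \<and> d \<le> 0" if "h \<le> u" "u \<le> t" for u
        using has_real_derivative_norm_square[OF yd, of u] diss'[OF yV, of u] that h by force
    qed (use t in \<open>simp add: h_def\<close>)
    moreover have "E * (norm (\<xi> h))^2 \<le> E * (6 * g^2 / (cmod \<mu>)^2) + 4 * (norm (y h))^2"
    proof -
      have "E * (norm (\<xi> h))^2 \<le> E * (6 * g^2 / (cmod \<mu>)^2 + 4 * (norm (y h))^2)"
        by (intro mult_left_mono init E)
      moreover have "E * (4 * (norm (y h))^2) \<le> 1 * (4 * (norm (y h))^2)"
        by (intro mult_right_mono E) auto
      ultimately show ?thesis by (simp add: distrib_left)
    qed
    ultimately show ?thesis
      using est pyth[of "x t"] unfolding E_def[symmetric] unfolding h_def[symmetric] \<xi>_def[symmetric] y_def[symmetric] by linarith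
  qed
  moreover have "(norm (y h))^2 \<le> (c * G)^2" using hG by (intro power_mono) auto
  ultimately have "(norm (x t))^2 \<le> 6 * G^2 + 7 * (c * G)^2"
    by linarith
  also have "\<dots> \<le> (3 * (1 + c) * G)^2"
  proof -
    have "6 + 7 * c^2 \<le> (3 * (1 + c))^2" using c0 by (simp add: power2_eq_square algebra_simps)
    then have "(6 + 7 * c^2) * G^2 \<le> (3 * (1 + c))^2 * G^2" by (intro mult_right_mono) auto
    then show ?thesis unfolding power_mult_distrib[of _ G] by (simp only: distrib_right mult.assoc)
  qed
  finally have "norm (x t) \<le> 3 * (1 + c) * G"
    by (rule power2_le_imp_le) (use c0 G0 in simp)
  then show ?case by (simp add: G_def c_def algebra_simps)
qed

section \<open>The modal system\<close>

text \<open>The mode with eigenvalue \<open>l\<close> in the variables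
  \<open>(sqrt (\<sigma> l) u, sqrt (1 + m l\<^sup>\<gamma>) v, \<theta>, sqrt \<tau> q)\<close>, in which the energy is the squared norm.\<close>

definition modal_op :: "real \<Rightarrow> real \<Rightarrow> real \<Rightarrow> real \<Rightarrow> 'h::complex_hilbert_space state \<Rightarrow> 'h state" where
  "modal_op a b c d = (\<lambda>(x, y, z, w).
     (a *\<^sub>R y, b *\<^sub>R z - a *\<^sub>R x, c *\<^sub>R w - b *\<^sub>R y, - (c *\<^sub>R z) - d *\<^sub>R w))"

lemma bounded_linear_modal_op: "bounded_linear (modal_op a b c d)"
proof -
  have *: "modal_op a b c d = (\<lambda>X. (a *\<^sub>R fst (snd X), b *\<^sub>R fst (snd (snd X)) - a *\<^sub>R fst X,
      c *\<^sub>R snd (snd (snd X)) - b *\<^sub>R fst (snd X), - (c *\<^sub>R fst (snd (snd X))) - d *\<^sub>R snd (snd (snd X))))"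
    by (auto simp: modal_op_def)
  show ?thesis
    unfolding * by (intro bounded_linear_Pair bounded_linear_sub bounded_linear_minus bounded_linear_scaleR_right
        bounded_linear_compose[OF bounded_linear_scaleR_right]
        bounded_linear_compose[OF bounded_linear_fst] bounded_linear_compose[OF bounded_linear_snd]
        bounded_linear_ident)
qed

lemma modal_op_scaleC: "modal_op a b c d (k *\<^sub>C X) = k *\<^sub>C modal_op a b c d X"
  by (cases X) (simp add: modal_op_def scaleC_prod_def scaleC_diff_right scaleC_minus_right scaleC_scaleR)

lemma modal_op_dissipative:
  assumes "0 \<le> d"
  shows "Re (cinner (modal_op a b c d X) X) \<le> 0"
proof (cases X)
  case (fields x y z w)
  have "Re (cinner (modal_op a b c d X) X) = - d * (norm w)^2"
    using Re_cinner_commute[of x y] Re_cinner_commute[of y z] Re_cinner_commute[of z w]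
    by (simp add: fields modal_op_def cinner_prod_def cinner.diff_left cinner.minus_left
        cinner_scaleR_left cinner_self del: of_real_power)
  then show ?thesis using assms by simp
qed

text \<open>The characteristic polynomial of the tridiagonal 4 by 4 matrix behind
  \<open>modal_op\<close>, coefficients listed from the constant term upwards.\<close>

definition modal_poly :: "real \<Rightarrow> real \<Rightarrow> real \<Rightarrow> real \<Rightarrow> complex poly" where
  "modal_poly a b c d = map_poly complex_of_real
     [:a^2 * c^2, d * (a^2 + b^2), a^2 + b^2 + c^2, d, 1:]"

lemma modal_poly_eq: "modal_poly a b c d =
    [:of_real (a^2 * c^2), of_real (d * (a^2 + b^2)),
      of_real (a^2 + b^2 + c^2), of_real d, 1:]"
  by (simp add: modal_poly_def map_poly_pCons)

text \<open>The entries of the modal matrix act as scalars, so Cayley-Hamilton for a numerical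
  matrix carries over to components in any Hilbert space.\<close>

lemma modal_op_cayley_hamilton:
  fixes a b c d :: real and X :: "'h::complex_hilbert_space state"
  defines "B \<equiv> modal_op a b c d :: 'h state \<Rightarrow> 'h state"
  shows "B (B (B (B X))) + d *\<^sub>R B (B (B X)) + (a^2 + b^2 + c^2) *\<^sub>R B (B X)
     + (d * (a^2 + b^2)) *\<^sub>R B X + (a^2 * c^2) *\<^sub>R X = 0"
  unfolding B_def
  by (cases X) (simp add: modal_op_def zero_prod_def power2_eq_square algebra_simps)

text \<open>Provides the annihilating list for \<open>dissipative_decay\<close>. Roots are listed
  with multiplicity, so coinciding eigenvalues need no separate treatment.\<close>

lemma ex_modal_roots:
  "\<exists>\<mu>s. length \<mu>s = 4 \<and> (\<forall>\<mu>\<in>set \<mu>s. poly (modal_poly a b c d) \<mu> = 0) \<and>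
     (\<forall>X :: 'h::complex_hilbert_space state.
        foldr (\<lambda>\<mu> X. modal_op a b c d X - \<mu> *\<^sub>C X) \<mu>s X = 0)"
proof -
  let ?p = "modal_poly a b c d"
  have deg: "degree ?p = 4" and lc: "lead_coeff ?p = 1" and p0: "?p \<noteq> 0"
    by (auto simp: modal_poly_eq)
  from alg_closed_imp_factorization[OF p0] obtain M
    where M: "size M = 4" "?p = (\<Prod>x\<in>#M. [:-x, 1:])"
    using deg lc by auto
  obtain \<mu>s where \<mu>s: "mset \<mu>s = M" using ex_mset by blast
  have len: "length \<mu>s = 4" using M(1) \<mu>s by (metis size_mset)
  then obtain m1 m2 m3 m4 where ms: "\<mu>s = [m1, m2, m3, m4]"
    by (auto simp: numeral_eq_Suc length_Suc_conv)
  have p: "?p = [:- m1, 1:] * ([:- m2, 1:] * ([:- m3, 1:] * [:- m4, 1:]))"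
    using M(2) \<mu>s[symmetric] by (simp add: ms mult_ac)
  have roots: "\<forall>\<mu>\<in>set \<mu>s. poly ?p \<mu> = 0"
    unfolding p poly_mult by (auto simp: ms)
  interpret B: bounded_linear "modal_op a b c d :: 'h state \<Rightarrow> 'h state"
    by (rule bounded_linear_modal_op)
  have "foldr (\<lambda>\<mu> X. modal_op a b c d X - \<mu> *\<^sub>C X) \<mu>s X = 0" for X :: "'h state"
  proof -
    let ?B = "modal_op a b c d :: 'h state \<Rightarrow> 'h state"
    \<comment> \<open>Vieta's formulas, by comparing coefficients. They turn the product of the
      factors into the Cayley-Hamilton expression.\<close>
    have e: "of_real d = - (m1 + m2 + m3 + m4)"
      "of_real (a^2 + b^2 + c^2) = m1*m2 + m1*m3 + m1*m4 + m2*m3 + m2*m4 + m3*m4"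
      "of_real (d * (a^2 + b^2)) = - (m1*m2*m3 + m1*m2*m4 + m1*m3*m4 + m2*m3*m4)"
      "of_real (a^2 * c^2) = m1*m2*m3*m4"
      using p unfolding modal_poly_eq by (simp_all add: algebra_simps)
    have "foldr (\<lambda>\<mu> X. modal_op a b c d X - \<mu> *\<^sub>C X) \<mu>s X =
      ?B (?B (?B (?B X))) + d *\<^sub>R ?B (?B (?B X)) + (a^2 + b^2 + c^2) *\<^sub>R ?B (?B X)
     + (d * (a^2 + b^2)) *\<^sub>R ?B X + (a^2 * c^2) *\<^sub>R X"
      unfolding scaleR_scaleC e ms
      by (simp add: B.diff B.add modal_op_scaleC scaleC_add_left scaleC_add_right scaleC_diff_left
          scaleC_diff_right scaleC_minus_left scaleC_scaleC algebra_simps)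
    then show ?thesis using modal_op_cayley_hamilton[of a b c d X] by simp
  qed
  with len roots show ?thesis by blast
qed

section \<open>Location of the modal eigenvalues\<close>

text \<open>With the last component set to 1 the eigenvector is computed from the last row upwards.
  The couplings \<open>a\<close>, \<open>b\<close>, \<open>c\<close> enter skew-symmetrically, so
  the real part of the energy identity sees only the damping of the last component.\<close>

lemma modal_root_eigenvector:
  assumes "0 < a" "0 < b" "0 < c" and root: "poly (modal_poly a b c d) \<mu> = 0"
  obtains x y z :: complex where "\<mu> * x = a * y" "\<mu> * y = b * z - a * x" "\<mu> * z = c - b * y"
    "\<mu> = - (c * z) - d"
    "- Re \<mu> * ((cmod x)^2 + (cmod y)^2 + (cmod z)^2 + 1) = d"
proof -
  define z where "z = - (\<mu> + d) / of_real c"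
  define y where "y = (c - \<mu> * z) / of_real b"
  define x where "x = (b * z - \<mu> * y) / of_real a"
  have e4: "\<mu> = - (c * z) - d" and e3: "\<mu> * z = c - b * y" and e2: "\<mu> * y = b * z - a * x"
    using assms(1-3) by (simp_all add: x_def y_def z_def)
  \<comment> \<open>Once the other rows are solved, the first row is the characteristic equation up
    to a nonzero factor.\<close>
  have "a * b * c * (\<mu> * x - a * y) = poly (modal_poly a b c d) \<mu> * (-1)"
    using assms(1-3)
    by (simp add: modal_poly_eq x_def y_def z_def field_simps power2_eq_square)
  then have e1: "\<mu> * x = a * y" using root assms(1-3) by simp
  have "\<mu> * (x * cnj x + y * cnj y + z * cnj z + 1) =
      a * (y * cnj x - x * cnj y) + b * (z * cnj y - y * cnj z) + c * (cnj z - z) - d"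
  proof -
    have "\<mu> * (x * cnj x + y * cnj y + z * cnj z + 1) =
      (\<mu> * x) * cnj x + (\<mu> * y) * cnj y + (\<mu> * z) * cnj z + \<mu>" by (simp add: algebra_simps)
    also have "\<dots> = (a * y) * cnj x + (b * z - a * x) * cnj y + (c - b * y) * cnj z + (- (c * z) - d)"
      unfolding e1 e2 e3 using e4 by simp
    finally show ?thesis by (simp add: algebra_simps)
  qed
  then have "Re (\<mu> * (x * cnj x + y * cnj y + z * cnj z + 1)) = - d"
    by simp
  moreover have "x * cnj x + y * cnj y + z * cnj z + 1 = of_real ((cmod x)^2 + (cmod y)^2 + (cmod z)^2 + 1)"
    by (simp only: of_real_add complex_norm_square of_real_1)
  ultimately have "- Re \<mu> * ((cmod x)^2 + (cmod y)^2 + (cmod z)^2 + 1) = d" by simp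
  then show ?thesis using that e1 e2 e3 e4 by blast
qed

text \<open>\<open>x\<close>, \<open>y\<close>, \<open>z\<close> are the moduli of the first three components of the eigenvector whose fourth
  component is 1.\<close>

lemma modal_root_norms:
  fixes \<mu> :: complex
  defines "\<nu> \<equiv> cmod \<mu>"
  assumes abc: "0 < a" "0 < b" "0 < c" "0 < d" and root: "poly (modal_poly a b c d) \<mu> = 0"
  obtains x y z :: real where "0 \<le> x" "0 \<le> y" "0 \<le> z"
    "\<nu> * x = a * y" "a * x \<le> b * z + \<nu> * y" "b * y \<le> c + \<nu> * z"
    "\<nu> * z \<le> c + b * y" "c \<le> \<nu> * z + b * y" "c * z \<le> \<nu> + d" "\<nu> \<le> c * z + d"
    "- Re \<mu> * (x^2 + y^2 + z^2 + 1) = d" "\<nu> \<le> a + b + c + d"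
    "2 * \<nu> \<le> a \<Longrightarrow> 3 * a^2 * y \<le> 4 * b * \<nu> * z"
    "2 * \<nu> \<le> b \<Longrightarrow> 3 * b^2 * (\<nu> * z) \<le> 4 * c * (a^2 + (\<nu>)^2)"
proof -
  note \<nu> = \<nu>_def[symmetric]
  have \<nu>0: "0 \<le> \<nu>" by (simp add: \<nu>_def)
  obtain x y z :: complex where e: "\<mu> * x = a * y" "\<mu> * y = b * z - a * x" "\<mu> * z = c - b * y"
    "\<mu> = - (c * z) - d"
    and S: "- Re \<mu> * ((cmod x)^2 + (cmod y)^2 + (cmod z)^2 + 1) = d"
    using modal_root_eigenvector[OF abc(1-3) root] by metis
  have cm: "cmod (complex_of_real s * u) = s * cmod u" if "0 < s" for s u
    using that by (simp add: norm_mult)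
  note cm = cm[OF abc(1)] cm[OF abc(2)] cm[OF abc(3)]
  have n1: "\<nu> * cmod x = a * cmod y"
    using arg_cong[OF e(1), of cmod] by (simp add: \<nu> norm_mult abc less_imp_le)
  have n2: "\<nu> * cmod y \<le> b * cmod z + a * cmod x" "a * cmod x \<le> b * cmod z + \<nu> * cmod y"
  proof -
    have "cmod (\<mu> * y) \<le> cmod (b * z) + cmod (a * x)" unfolding e(2) by (rule norm_triangle_ineq4)
    then show "\<nu> * cmod y \<le> b * cmod z + a * cmod x" by (simp only: cm norm_mult[of \<mu>] \<nu>)
    have "a * x = b * z - \<mu> * y" using e(2) by simp
    then have "cmod (a * x) \<le> cmod (b * z) + cmod (\<mu> * y)" using norm_triangle_ineq4 by metis
    then show "a * cmod x \<le> b * cmod z + \<nu> * cmod y" by (simp only: cm norm_mult[of \<mu>] \<nu>)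
  qed
  have cc: "cmod (complex_of_real c) = c" "cmod (complex_of_real d) = d" using abc by auto
  have n3: "\<nu> * cmod z \<le> c + b * cmod y" "b * cmod y \<le> c + \<nu> * cmod z" "c \<le> \<nu> * cmod z + b * cmod y"
  proof -
    have "cmod (\<mu> * z) \<le> cmod c + cmod (b * y)" unfolding e(3) by (rule norm_triangle_ineq4)
    then show "\<nu> * cmod z \<le> c + b * cmod y" by (simp only: cm cc norm_mult[of \<mu>] \<nu>)
    have "b * y = c - \<mu> * z" using e(3) by simp
    then have "cmod (b * y) \<le> cmod c + cmod (\<mu> * z)" using norm_triangle_ineq4 by metis
    then show "b * cmod y \<le> c + \<nu> * cmod z" by (simp only: cm cc norm_mult[of \<mu>] \<nu>)
    have "of_real c = \<mu> * z + b * y" using e(3) by simp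
    then have "cmod c \<le> cmod (\<mu> * z) + cmod (b * y)" using norm_triangle_ineq by metis
    then show "c \<le> \<nu> * cmod z + b * cmod y" by (simp only: cm cc norm_mult[of \<mu>] \<nu>)
  qed
  have n4: "c * cmod z \<le> \<nu> + d" "\<nu> \<le> c * cmod z + d"
  proof -
    have "\<nu> \<le> cmod (- (c * z)) + cmod d" using norm_triangle_ineq4 e(4) unfolding \<nu>_def by metis
    then show "\<nu> \<le> c * cmod z + d" by (simp only: cm cc norm_minus_cancel \<nu>)
    have "c * z = - \<mu> - d" using e(4) by simp
    then have "cmod (c * z) \<le> cmod (- \<mu>) + cmod d" using norm_triangle_ineq4 by metis
    then show "c * cmod z \<le> \<nu> + d" by (simp only: cm cc norm_minus_cancel \<nu>)
  qed
  \<comment> \<open>As in Gershgorin's theorem: the row of a component of largest modulus bounds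
    |\<mu>| by the coefficients in that row.\<close>
  have up: "\<nu> \<le> a + b + c + d"
  proof -
    define N where "N = max (max (cmod x) (cmod y)) (max (cmod z) 1)"
    have N: "cmod x \<le> N" "cmod y \<le> N" "cmod z \<le> N" "1 \<le> N" by (auto simp: N_def)
    have m: "a * cmod y \<le> a * N" "b * cmod z \<le> b * N" "a * cmod x \<le> a * N" "c \<le> c * N"
      "b * cmod y \<le> b * N" "c * cmod z \<le> c * N" "d \<le> d * N" "0 \<le> a * N" "0 \<le> b * N" "0 \<le> c * N" "0 \<le> d * N"
      using N abc by (auto intro: mult_left_mono)
    have "\<nu> * N \<le> (a + b + c + d) * N"
    proof -
      have "N = cmod x \<or> N = cmod y \<or> N = cmod z \<or> N = 1" by (auto simp: N_def max_def)
      then show ?thesis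
      proof (elim disjE)
        assume N: "N = cmod x"
        show ?thesis using n1 m unfolding distrib_right N by linarith
      next
        assume N: "N = cmod y"
        show ?thesis using n2(1) m unfolding distrib_right N by linarith
      next
        assume N: "N = cmod z"
        show ?thesis using n3(1) m unfolding distrib_right N by linarith
      next
        assume N: "N = 1"
        have "0 \<le> a + b" "c * cmod z \<le> c" using abc m unfolding N by auto
        then show ?thesis using n4(2) unfolding N by simp
      qed
    qed
    then show ?thesis using N by simp
  qed
  \<comment> \<open>Eliminating \<open>x\<close> leaves (a^2 + \<mu>^2) y = b \<mu> z, where a^2
    dominates \<mu>^2 for a slow root.\<close>
  have n5: "3 * a^2 * cmod y \<le> 4 * b * \<nu> * cmod z" if "2 * \<nu> \<le> a"
  proof -
    have "((of_real a)^2 + \<mu>^2) * y = b * (\<mu> * z)"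
      using e(1,2) by algebra
    then have "cmod (((of_real a)^2 + \<mu>^2) * y) = cmod (b * (\<mu> * z))"
      by (rule arg_cong)
    then have "cmod (a^2 + \<mu>^2) * cmod y = b * \<nu> * cmod z"
      by (simp only: cm norm_mult[of _ y] norm_mult[of \<mu>] \<nu> of_real_power mult.assoc)
    moreover have "4 * cmod (a^2 + \<mu>^2) \<ge> 3 * a^2"
    proof -
      have "(2 * \<nu>)^2 \<le> a^2" using that \<nu>0 by (intro power_mono) auto
      then show ?thesis
        using norm_diff_ineq[of "complex_of_real (a^2)" "\<mu>^2"] by (simp add: \<nu> norm_power power_mult_distrib)
    qed
    then have "3 * a^2 * cmod y \<le> 4 * cmod (a^2 + \<mu>^2) * cmod y" by (intro mult_right_mono) auto
    ultimately show ?thesis by simp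
  qed
  \<comment> \<open>Eliminating \<open>x\<close> and \<open>y\<close> leaves (a^2 + b^2 + \<mu>^2)
    \<mu> z = c (a^2 + \<mu>^2), where b^2 dominates \<mu>^2 for a slow root.\<close>
  have n6: "3 * b^2 * (\<nu> * cmod z) \<le> 4 * c * (a^2 + (\<nu>)^2)" if "2 * \<nu> \<le> b"
  proof -
    have "((of_real a)^2 + (of_real b)^2 + \<mu>^2) * (\<mu> * z) = c * ((of_real a)^2 + \<mu>^2)"
      using e(1,2,3) by algebra
    then have "cmod (((of_real a)^2 + (of_real b)^2 + \<mu>^2) * (\<mu> * z)) = cmod (c * ((of_real a)^2 + \<mu>^2))"
      by (rule arg_cong)
    then have "cmod (a^2 + b^2 + \<mu>^2) * (\<nu> * cmod z) = c * cmod (a^2 + \<mu>^2)"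
      by (simp only: cm norm_mult[of _ "\<mu> * z"] norm_mult[of \<mu>] \<nu> of_real_power of_real_add)
    also have "\<dots> \<le> c * (a^2 + (\<nu>)^2)"
      using norm_triangle_ineq[of "complex_of_real (a^2)" "\<mu>^2"] abc by (simp add: \<nu> norm_power)
    finally have "cmod (a^2 + b^2 + \<mu>^2) * (\<nu> * cmod z) \<le> c * (a^2 + (\<nu>)^2)" .
    moreover have "4 * cmod (a^2 + b^2 + \<mu>^2) \<ge> 3 * b^2"
    proof -
      have "(2 * \<nu>)^2 \<le> b^2" using that \<nu>0 by (intro power_mono) auto
      moreover have "cmod (complex_of_real (a^2 + b^2)) = a^2 + b^2" by (simp only: norm_of_real) simp
      then have "a^2 + b^2 - (\<nu>)^2 \<le> cmod (a^2 + b^2 + \<mu>^2)"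
        using norm_diff_ineq[of "complex_of_real (a^2 + b^2)" "\<mu>^2"] by (simp add: \<nu> norm_power)
      moreover have "4 * (\<nu>)^2 = (2 * \<nu>)^2" by (simp add: power_mult_distrib)
      ultimately show ?thesis
        using zero_le_power2[of a] by linarith
    qed
    then have "3 * b^2 * (\<nu> * cmod z) \<le> 4 * cmod (a^2 + b^2 + \<mu>^2) * (\<nu> * cmod z)"
      using \<nu>0 by (intro mult_right_mono) auto
    ultimately show ?thesis by simp
  qed
  show ?thesis
    by (rule that[of "cmod x" "cmod y" "cmod z"]) (use n1 n2 n3 n4 up n5 n6 S in auto)
qed

text \<open>Applied with \<open>r = - Re \<mu>\<close>: a common bound \<open>W\<close> on all four
  components of the eigenvector bounds its energy by \<open>4 * W^2\<close>, and the damping rate is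
  \<open>d\<close> divided by the energy.\<close>

lemma rate_from_norms:
  fixes r x y z W d :: real
  assumes "r * (x^2 + y^2 + z^2 + 1) = d" "0 < d" "0 \<le> x" "0 \<le> y" "0 \<le> z" "x \<le> W" "y \<le> W" "z \<le> W" "1 \<le> W"
  shows "d \<le> 4 * W^2 * r"
proof -
  have "x^2 \<le> W^2" "y^2 \<le> W^2" "z^2 \<le> W^2" "1^2 \<le> W^2"
    using assms by (auto intro: power_mono)
  then have le: "x^2 + y^2 + z^2 + 1 \<le> 4 * W^2" by simp
  have "0 < r"
  proof (rule ccontr)
    assume "\<not> ?thesis"
    then have "r * (x^2 + y^2 + z^2 + 1) \<le> 0" by (intro mult_nonpos_nonneg) auto
    then show False using assms by simp
  qed
  then show ?thesis
    using mult_left_mono[OF le, of r] assms(1) by (simp add: mult.commute)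
qed

lemma rate_bound:
  fixes d W C r :: real
  assumes "d \<le> 4 * W^2 * r" "0 < d" "4 * W^2 \<le> C * d" "0 \<le> C"
  shows "1 \<le> C * r"
proof -
  have "0 < r"
  proof (rule ccontr)
    assume "\<not> ?thesis"
    then have "4 * W^2 * r \<le> 0" by (intro mult_nonneg_nonpos) auto
    then show False using assms by linarith
  qed
  then have "4 * W^2 * r \<le> C * d * r" using assms by (intro mult_right_mono) auto
  then have "d * 1 \<le> d * (C * r)" using assms(1) by (simp add: algebra_simps)
  then show ?thesis using assms(2) by simp
qed

text \<open>The dominant coefficient is \<open>b\<close> on \<open>V\<^sub>1\<close>, \<open>a\<close> on \<open>V\<^sub>2\<close> and \<open>c\<close> on \<open>V\<^sub>3\<close>. A premise that is itself an
  implication concerns only a bounded range of \<open>l\<close>, where all coefficients are comparable.\<close>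

lemma modal_root_dominant_coupling:
  fixes L \<kappa> c0 d :: real
  assumes "1 \<le> L" "0 < \<kappa>" "0 < c0" "0 < d"
  shows "\<exists>C\<ge>1. \<forall>a b c \<mu>. 0 < a \<longrightarrow> 0 < b \<longrightarrow> c0 \<le> c \<longrightarrow> a \<le> L * b \<longrightarrow> c \<le> L * b \<longrightarrow> d \<le> L * b \<longrightarrow>
    \<kappa> * b \<le> a * c \<longrightarrow> (b < 3 * c \<longrightarrow> b \<le> L * a) \<longrightarrow> poly (modal_poly a b c d) \<mu> = 0 \<longrightarrow>
    1 \<le> C * - Re \<mu> \<or> (b \<le> C * cmod \<mu> \<and> 1 \<le> C * (b / c)^2 * - Re \<mu>)"
proof -
  \<comment> \<open>\<open>Z\<close> and \<open>X\<close> bound \<open>z\<close> and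
    \<open>x\<close> for slow roots with \<open>3 * c \<le> b\<close>, each large enough for both
    ranges of \<nu> distinguished below. \<open>Z'\<close> and \<open>X'\<close> serve the case
    \<open>b < 3 * c\<close>.\<close>
  define Z where "Z = 3 * d / c0 + 3 * L"
  define X where "X = (3 * d + 2 * d * (1 + Z)) / \<kappa> + 4 + Z"
  define Z' where "Z' = 2 + d / c0"
  define X' where "X' = L * (L + 2 * Z')"
  define C where "C = 2 + (4 * (42 * L ^ 3)^2 + 4 * X^2 + 4 * X'^2) / d"
  have pos: "0 < Z" "0 < Z'" using assms by (auto simp: Z_def Z'_def add_pos_nonneg)
  have C1: "2 \<le> C" and CX: "4 * (42 * L ^ 3)^2 \<le> C * d" "4 * X^2 \<le> C * d" "4 * X'^2 \<le> C * d"
    using assms by (simp_all add: C_def field_simps)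
  show ?thesis
  proof (rule exI[of _ C], intro conjI allI impI)
    show "1 \<le> C" using C1 by simp
    fix a b c :: real and \<mu> :: complex
    assume a: "0 < a" and b: "0 < b" and c: "c0 \<le> c" and ab: "a \<le> L * b" and cb: "c \<le> L * b" and db: "d \<le> L * b"
      and slow: "\<kappa> * b \<le> a * c" and small: "b < 3 * c \<longrightarrow> b \<le> L * a" and root: "poly (modal_poly a b c d) \<mu> = 0"
    have c0: "0 < c" using c assms by simp
    define \<nu> where "\<nu> = cmod \<mu>"
    have \<nu>: "0 \<le> \<nu>" by (simp add: \<nu>_def)
    obtain x y z where n: "0 \<le> x" "0 \<le> y" "0 \<le> z"
      "\<nu> * x = a * y" "a * x \<le> b * z + \<nu> * y" "b * y \<le> c + \<nu> * z"
      "c * z \<le> \<nu> + d" "\<nu> \<le> c * z + d"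
      "- Re \<mu> * (x^2 + y^2 + z^2 + 1) = d" "\<nu> \<le> a + b + c + d"
      "2 * \<nu> \<le> b \<Longrightarrow> 3 * b^2 * (\<nu> * z) \<le> 4 * c * (a^2 + \<nu>^2)"
      unfolding \<nu>_def by (rule modal_root_norms[OF a b c0 assms(4) root]) blast
    note rate = rate_from_norms[OF n(9) assms(4) n(1-3)]
    \<comment> \<open>Roots of the order of the dominant coefficient \<open>b\<close> meet the
      second alternative. Slower roots turn out to have bounded components and meet the
      first.\<close>
    consider "b \<le> 2 * \<nu>" | "2 * \<nu> < b" "3 * c \<le> b" | "2 * \<nu> < b" "b < 3 * c" by linarith
    then show "1 \<le> C * - Re \<mu> \<or> (b \<le> C * cmod \<mu> \<and> 1 \<le> C * (b / c)^2 * - Re \<mu>)"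
    proof cases
      case 1
      define q where "q = b / c"
      have q: "0 < q" "b = q * c" using b c0 by (auto simp: q_def)
      have "b \<le> L * b" using assms(1) b by simp
      then have nu: "\<nu> \<le> 4 * L * b" using n(10) ab cb db by linarith
      have "c * z \<le> 5 * L * b" using n(7) nu db by linarith
      then have z: "z \<le> 5 * L * q" using c0 by (simp add: q(2) algebra_simps)
      have "\<nu> * z \<le> (4 * L * b) * (5 * L * q)" using nu z n(3) \<nu> by (intro mult_mono) auto
      moreover have q1: "1 \<le> L * q" using cb c0 by (simp add: q(2) algebra_simps)
      have "c * 1 \<le> L * b * (L * q)" using cb q1 c0 by (intro mult_mono) auto
      ultimately have "b * y \<le> b * (21 * L^2 * q)" using n(6) by (simp add: power2_eq_square algebra_simps)
      then have y: "y \<le> 21 * L^2 * q" using b by simp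
      have "b * x \<le> 2 * (a * y)" using n(1,4) 1 mult_right_mono[OF 1 n(1)] by simp
      also have "\<dots> \<le> 2 * (L * b * (21 * L^2 * q))" using ab y n(2) a by (intro mult_left_mono mult_mono) auto
      also have "\<dots> = b * (42 * L ^ 3 * q)" by (simp add: power2_eq_square power3_eq_cube)
      finally have x: "x \<le> 42 * L ^ 3 * q" using b by simp
      have LL: "1 \<le> L^2" "L \<le> L ^ 3" "L^2 \<le> L ^ 3"
        using assms(1) power_increasing[of 1 3 L] power_increasing[of 2 3 L] power_increasing[of 0 2 L] by auto
      have Lq: "L * q \<le> L ^ 3 * q" "L^2 * q \<le> L ^ 3 * q" using LL q by (auto intro: mult_right_mono)
      have "d \<le> 4 * (42 * L ^ 3 * q)^2 * - Re \<mu>"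
        by (rule rate) (use x y z q1 Lq in linarith)+
      then have "1 \<le> (C * q^2) * - Re \<mu>"
        by (rule rate_bound) (use assms(4) C1 mult_right_mono[OF CX(1), of "q^2"] in \<open>auto simp: power_mult_distrib algebra_simps\<close>)
      moreover have "b \<le> C * \<nu>" using 1 C1 mult_right_mono[OF C1 \<nu>] by simp
      ultimately show ?thesis by (simp add: q_def \<nu>_def)
    next
      case 2
      have y: "y \<le> 1 + z"
      proof -
        have "\<nu> * z \<le> b * z" using 2 n(3) \<nu> by (intro mult_right_mono) auto
        then have "b * y \<le> b * (1 + z)" using n(6) 2 c0 by (simp add: distrib_left)
        then show ?thesis using b by simp
      qed
      have "z \<le> Z \<and> x \<le> X"
      \<comment> \<open>For bounded \<nu> the last row bounds \<open>c * z\<close>, and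
        \<open>slow\<close> converts this into a bound of \<open>b * z\<close> by a multiple of
        \<open>a\<close>, as needed to bound \<open>x\<close> through the second row. For larger
        \<nu> the damping is subordinate and \<open>c * z\<close> is comparable to \<nu>.\<close>
      proof (cases "\<nu> \<le> 2 * d")
        case True
        then have cz: "c * z \<le> 3 * d" using n(7) by simp
        have "c0 * z \<le> 3 * d" using cz mult_right_mono[OF c n(3)] by simp
        then have zz: "z \<le> 3 * d / c0" using assms by (simp add: field_simps)
        then have z: "z \<le> Z" using assms by (simp add: Z_def)
        have "\<kappa> * (b * z) \<le> a * (c * z)" using mult_right_mono[OF slow n(3)] by (simp add: mult_ac)
        also have "\<dots> \<le> a * (3 * d)" using cz a by simp
        finally have 1: "\<kappa> * (b * z) \<le> a * (3 * d)" .
        have "\<kappa> * c \<le> \<kappa> * b" using 2(2) assms(2) c0 by (intro mult_left_mono) auto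
        then have "\<kappa> * c \<le> a * c" using slow by simp
        then have "\<kappa> \<le> a" using c0 by simp
        then have "\<kappa> * (\<nu> * y) \<le> a * (2 * d * (1 + Z))"
          using True y z n(2) \<nu> a assms by (intro mult_mono) auto
        then have "\<kappa> * (a * x) \<le> a * (3 * d + 2 * d * (1 + Z))"
          using 1 mult_left_mono[OF n(5), of \<kappa>] assms(2) by (simp add: algebra_simps)
        then have "a * (\<kappa> * x) \<le> a * (3 * d + 2 * d * (1 + Z))" by (simp add: mult_ac)
        then have "\<kappa> * x \<le> 3 * d + 2 * d * (1 + Z)" using a by simp
        then have "x \<le> (3 * d + 2 * d * (1 + Z)) / \<kappa>" using assms by (simp add: field_simps)
        then show ?thesis using z pos by (simp add: X_def)
      next
        case False
        then have "\<nu> / 2 \<le> c * z" and cz: "c * z \<le> 3 / 2 * \<nu>" using n(7,8) by simp_all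
        \<comment> \<open>Inserted into the equation for \<open>z\<close> alone, \<nu> \<le> 2 c z
          bounds b^2 \<nu>^2 by multiples of c^2 a^2 and c^2 \<nu>^2; the latter is absorbed since
          \<open>3 * c \<le> b\<close>.\<close>
        then have "3 * b^2 * \<nu> * (\<nu> / 2) \<le> 3 * b^2 * \<nu> * (c * z)" using \<nu> by (intro mult_left_mono) auto
        also have "\<dots> \<le> 4 * c^2 * (a^2 + \<nu>^2)"
          using mult_left_mono[OF n(11), of c] 2 c0 by (simp add: power2_eq_square algebra_simps)
        finally have "3 / 2 * (b^2 * \<nu>^2) \<le> 4 * (c^2 * a^2) + 4 * (c^2 * \<nu>^2)"
          by (simp add: power2_eq_square algebra_simps)
        moreover have "(3 * c)^2 * \<nu>^2 \<le> b^2 * \<nu>^2" using 2 c0 by (intro mult_right_mono power_mono) auto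
        then have "9 * (c^2 * \<nu>^2) \<le> b^2 * \<nu>^2" by (simp add: power_mult_distrib)
        moreover have "0 \<le> c^2 * a^2" by simp
        ultimately have "b^2 * \<nu>^2 \<le> 4 * (c^2 * a^2)" by linarith
        then have "(b * \<nu>)^2 \<le> (2 * c * a)^2" by (simp add: power_mult_distrib)
        then have bn: "b * \<nu> \<le> 2 * c * a" by (rule power2_le_imp_le) (use c0 a in simp)
        have "c * (b * z) \<le> b * (3 / 2 * \<nu>)" using mult_left_mono[OF cz, of b] b by (simp add: mult_ac)
        also have "\<dots> \<le> c * (3 * a)" using bn by (simp add: algebra_simps)
        finally have bz: "b * z \<le> 3 * a" using c0 by simp
        then have "b * z \<le> 3 * (L * b)" using ab by linarith
        then have "b * z \<le> b * (3 * L)" by (simp add: mult_ac)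
        then have z: "z \<le> 3 * L" using b by simp
        moreover have "0 \<le> 3 * d / c0" using assms by simp
        ultimately have zZ: "z \<le> Z" unfolding Z_def by linarith
        have "2 * c * a \<le> b * a" using 2(2) a c0 by (intro mult_right_mono) auto
        then have "b * \<nu> \<le> b * a" using bn by linarith
        then have "\<nu> \<le> a" using b by simp
        then have "\<nu> * y \<le> a * y" using n(2) by (rule mult_right_mono)
        then have "a * x \<le> a * (3 + y)" using n(5) bz by (simp add: distrib_left)
        then have "x \<le> 3 + y" using a by simp
        then have "x \<le> 4 + Z" using y zZ by simp
        moreover have "0 \<le> (3 * d + 2 * d * (1 + Z)) / \<kappa>" using assms pos by simp
        ultimately show ?thesis using zZ by (simp add: X_def)
      qed
      moreover have "4 + Z \<le> X" using assms pos by (simp add: X_def)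
      ultimately have "d \<le> 4 * X^2 * - Re \<mu>"
        using pos y by (intro rate) auto
      then have "1 \<le> C * - Re \<mu>"
        by (rule rate_bound) (use assms(4) C1 CX(2) in auto)
      then show ?thesis ..
    next
      case 3
      \<comment> \<open>From here on \<open>a\<close>, \<open>b\<close> and \<open>c\<close> are
        comparable, so crude row estimates suffice.\<close>
      then have ba: "b \<le> L * a" using small by simp
      have z: "z \<le> Z'"
      proof -
        have "c * (d / c0) \<ge> d" using c assms by (simp add: field_simps)
        then have "c * z \<le> c * Z'" using n(7) 3 c0 by (simp add: Z'_def distrib_left)
        then show ?thesis using c0 by simp
      qed
      have y: "y \<le> L + z"
      proof -
        have "\<nu> * z \<le> b * z" using 3 n(3) \<nu> by (intro mult_right_mono) auto
        then have "b * y \<le> b * (L + z)" using n(6) cb by (simp add: algebra_simps)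
        then show ?thesis using b by simp
      qed
      have x: "x \<le> L * (L + 2 * z)"
      proof -
        have "\<nu> * y \<le> b * y" using 3 n(2) \<nu> by (intro mult_right_mono) auto
        then have "a * x \<le> b * (y + z)" using n(5) by (simp add: algebra_simps)
        also have "\<dots> \<le> L * a * (L + 2 * z)" using ba y n assms a by (intro mult_mono) auto
        finally have "a * x \<le> a * (L * (L + 2 * z))" by (simp add: mult_ac)
        then show ?thesis using a by simp
      qed
      have le: "L + 2 * Z' \<le> X'" using mult_right_mono[OF assms(1), of "L + 2 * Z'"] assms pos by (simp add: X'_def)
      have "L * (L + 2 * z) \<le> X'" using z assms by (simp add: X'_def)
      then have "d \<le> 4 * X'^2 * - Re \<mu>"
        using x y z le pos assms(1) by (intro rate) auto
      then have "1 \<le> C * - Re \<mu>"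
        by (rule rate_bound) (use assms(4) C1 CX(3) in auto)
      then show ?thesis ..
    qed
  qed
qed

text \<open>The damped flux sees the displacement only through both couplings \<open>b\<close> and
  \<open>c\<close>. For a root of order \<open>a\<close> the last row makes z of order at most a/c,
  the third makes y of order at most a^2/(bc), and x is comparable to y; this yields the growth
  factor of the second alternative.\<close>

lemma modal_root_dominant_elasticity:
  fixes L c0 d :: real
  assumes "1 \<le> L" "0 < c0" "0 < d"
  shows "\<exists>C\<ge>1. \<forall>a b c \<mu>. 0 < a \<longrightarrow> 0 < b \<longrightarrow> c0 \<le> c \<longrightarrow> b \<le> L * a \<longrightarrow> c \<le> L * a \<longrightarrow> d \<le> L * a \<longrightarrow>
    (a < 2 * b \<longrightarrow> a \<le> L * c) \<longrightarrow> poly (modal_poly a b c d) \<mu> = 0 \<longrightarrow>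
    1 \<le> C * - Re \<mu> \<or> (a \<le> C * cmod \<mu> \<and> 1 \<le> C * (a^2 / (b * c))^2 * - Re \<mu>)"
proof -
  define Z where "Z = 2 + d / c0"
  define Z' where "Z' = L + d / c0"
  define X' where "X' = L * Z' + 2 * L + Z'"
  define C where "C = 2 + (4 * (42 * L^2)^2 + 4 * Z^2 + 4 * X'^2) / d"
  have pos: "0 < Z" "0 < Z'" using assms by (auto simp: Z_def Z'_def add_pos_nonneg)
  have C1: "2 \<le> C" and CX: "4 * (42 * L^2)^2 \<le> C * d" "4 * Z^2 \<le> C * d" "4 * X'^2 \<le> C * d"
    using assms by (simp_all add: C_def field_simps)
  show ?thesis
  proof (rule exI[of _ C], intro conjI allI impI)
    show "1 \<le> C" using C1 by simp
    fix a b c :: real and \<mu> :: complex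
    assume a: "0 < a" and b: "0 < b" and c: "c0 \<le> c" and ba: "b \<le> L * a" and ca: "c \<le> L * a" and da: "d \<le> L * a"
      and small: "a < 2 * b \<longrightarrow> a \<le> L * c" and root: "poly (modal_poly a b c d) \<mu> = 0"
    have c0: "0 < c" using c assms by simp
    define \<nu> where "\<nu> = cmod \<mu>"
    have \<nu>: "0 \<le> \<nu>" by (simp add: \<nu>_def)
    obtain x y z where n: "0 \<le> x" "0 \<le> y" "0 \<le> z"
      "\<nu> * x = a * y" "a * x \<le> b * z + \<nu> * y" "b * y \<le> c + \<nu> * z" "\<nu> * z \<le> c + b * y"
      "c * z \<le> \<nu> + d"
      "- Re \<mu> * (x^2 + y^2 + z^2 + 1) = d" "\<nu> \<le> a + b + c + d"
      "2 * \<nu> \<le> a \<Longrightarrow> 3 * a^2 * y \<le> 4 * b * \<nu> * z"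
      unfolding \<nu>_def by (rule modal_root_norms[OF a b c0 assms(3) root]) blast
    note rate = rate_from_norms[OF n(9) assms(3) n(1-3)]
    consider "a \<le> 2 * \<nu>" | "2 * \<nu> < a" "2 * b \<le> a" | "2 * \<nu> < a" "a < 2 * b" by linarith
    then show "1 \<le> C * - Re \<mu> \<or> (a \<le> C * cmod \<mu> \<and> 1 \<le> C * (a^2 / (b * c))^2 * - Re \<mu>)"
    proof cases
      case 1
      \<comment> \<open>All components are bounded by a multiple of \<open>q\<close>; the constant
        42 doubles the 21 = 1 + 4 * 5 obtained for \<open>y\<close>, because
        \<open>x \<le> 2 * y\<close>.\<close>
      define q where "q = a^2 / (b * c)"
      have q: "0 < q" "a^2 = q * b * c" using a b c0 by (auto simp: q_def)
      have "a \<le> L * a" using assms(1) a by simp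
      then have nu: "\<nu> \<le> 4 * L * a" using n(10) ba ca da by linarith
      have cz: "c * z \<le> 5 * L * a" using n(8) nu da by linarith
      have "c * (b * y) \<le> c * c + \<nu> * (c * z)" using mult_left_mono[OF n(6), of c] c0 by (simp add: algebra_simps)
      also have "\<dots> \<le> (L * a) * (L * a) + (4 * L * a) * (5 * L * a)"
        by (intro add_mono mult_mono[OF ca ca] mult_mono[OF nu cz]) (use c0 a n(3) \<nu> assms(1) in auto)
      also have "\<dots> = 21 * L^2 * a^2" by (simp add: power2_eq_square)
      finally have "b * c * y \<le> b * c * (21 * L^2 * q)" unfolding q(2) by (simp add: mult_ac)
      then have y: "y \<le> 21 * L^2 * q" using b c0 by simp
      have "b * (c * z) \<le> L * a * (5 * L * a)" by (rule mult_mono[OF ba cz]) (use b n(3) c0 a assms(1) in auto)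
      also have "\<dots> = 5 * L^2 * a^2" by (simp add: power2_eq_square)
      finally have "b * c * z \<le> b * c * (5 * L^2 * q)" unfolding q(2) by (simp add: mult_ac)
      then have z: "z \<le> 5 * L^2 * q" using b c0 by simp
      have "b * c \<le> (L * a) * (L * a)" using ba ca b c0 a assms(1) by (intro mult_mono) auto
      also have "\<dots> = b * c * (L^2 * q)" using q(2) by (simp add: power2_eq_square mult_ac)
      finally have q1: "1 \<le> L^2 * q" using b c0 by simp
      have "a * x \<le> 2 * (a * y)" using n(4) mult_right_mono[OF 1 n(1)] by simp
      then have "a * x \<le> a * (2 * y)" by simp
      then have x: "x \<le> 2 * y" using a by (simp only: mult_le_cancel_left_pos)
      have "d \<le> 4 * (42 * L^2 * q)^2 * - Re \<mu>"
        by (rule rate) (use x y z q1 in linarith)+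
      then have "1 \<le> (C * q^2) * - Re \<mu>"
        by (rule rate_bound) (use assms(3) C1 mult_right_mono[OF CX(1), of "q^2"] in \<open>auto simp: power_mult_distrib algebra_simps\<close>)
      moreover have "a \<le> C * \<nu>" using 1 mult_right_mono[OF C1 \<nu>] by simp
      ultimately show ?thesis by (simp add: q_def \<nu>_def)
    next
      case 2
      \<comment> \<open>For slow roots the elastic part responds weakly: 3 b y \<le> \<nu> z. In the
        third row this makes \<open>\<nu> * z\<close> at most a multiple of \<open>c\<close>, which
        bounds \<open>z\<close> when \<nu> is at least \<open>c\<close>; otherwise the last row
        does.\<close>
      have "3 * a^2 * y \<le> 4 * b * (\<nu> * z)" using n(11) 2 by (simp add: mult_ac)
      then have "b * (3 * a^2 * y) \<le> (2 * b)^2 * (\<nu> * z)"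
        using mult_left_mono[of _ _ b] b by (simp add: power2_eq_square mult_ac)
      also have "\<dots> \<le> a^2 * (\<nu> * z)" using 2 b n(3) \<nu> by (intro mult_right_mono power_mono) auto
      finally have "a^2 * (3 * (b * y)) \<le> a^2 * (\<nu> * z)" by (simp add: mult_ac)
      then have "3 * (b * y) \<le> \<nu> * z" using a by simp
      then have nz: "\<nu> * z \<le> 3 / 2 * c" using n(7) by simp
      have z: "z \<le> Z"
      proof (cases "c \<le> \<nu>")
        case True
        then have "c * z \<le> c * (3 / 2)" using nz mult_right_mono[OF True n(3)] by simp
        then have "z \<le> 3 / 2" using c0 by simp
        moreover have "0 \<le> d / c0" using assms by simp
        ultimately show ?thesis unfolding Z_def by linarith
      next
        case False
        have "c * (d / c0) \<ge> d" using c assms by (simp add: field_simps)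
        then have "c * z \<le> c * Z" using n(8) False c0 by (simp add: Z_def distrib_left)
        then show ?thesis using c0 by simp
      qed
      have "(2 * b) * (2 * \<nu>) * z \<le> a * a * z" using 2 b \<nu> n(3) a by (intro mult_mono) auto
      then have "a * a * (3 * y) \<le> a * a * z" using n(11) 2 by (simp add: power2_eq_square mult_ac)
      then have "3 * y \<le> z" using a by simp
      then have y: "y \<le> z" using n by simp
      have "2 * b * z \<le> a * z" using 2 n(3) by (intro mult_right_mono)
      moreover have "2 * \<nu> * y \<le> a * z" using 2 y n \<nu> a by (intro mult_mono) auto
      ultimately have "a * x \<le> a * z" using n(5) by simp
      then have x: "x \<le> z" using a by simp
      have "1 \<le> Z" using assms by (simp add: Z_def)
      then have "d \<le> 4 * Z^2 * - Re \<mu>" using x y z by (intro rate) auto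
      then have "1 \<le> C * - Re \<mu>"
        by (rule rate_bound) (use assms(3) C1 CX(2) in auto)
      then show ?thesis ..
    next
      case 3
      \<comment> \<open>Again \<open>a\<close>, \<open>b\<close> and \<open>c\<close> are
        comparable.\<close>
      then have ac: "a \<le> L * c" using small by simp
      have z: "z \<le> Z'"
      proof -
        have "c * (d / c0) \<ge> d" using c assms by (simp add: field_simps)
        then have "c * z \<le> c * Z'" using n(8) 3 ac \<nu> by (simp add: Z'_def algebra_simps)
        then show ?thesis using c0 by simp
      qed
      have y: "y \<le> 2 * L + z"
      proof -
        have "\<nu> * z \<le> b * z" using 3 n(3) \<nu> by (intro mult_right_mono) auto
        moreover have "L * a \<le> L * (2 * b)" using 3 assms(1) by (intro mult_left_mono) auto
        then have "c \<le> L * (2 * b)" using ca by linarith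
        ultimately have "b * y \<le> b * (2 * L + z)" using n(6) by (simp add: algebra_simps)
        then show ?thesis using b by simp
      qed
      have x: "x \<le> L * z + y"
      proof -
        have "\<nu> * y \<le> a * y" using 3 n(2) \<nu> by (intro mult_right_mono) auto
        moreover have "b * z \<le> L * a * z" using ba n(3) by (intro mult_right_mono)
        ultimately have "a * x \<le> a * (L * z + y)" using n(5) by (simp add: algebra_simps)
        then show ?thesis using a by simp
      qed
      have "L * z \<le> L * Z'" "0 \<le> L * Z'" using z assms pos by auto
      then have "d \<le> 4 * X'^2 * - Re \<mu>"
        using x y z pos assms(1) unfolding X'_def by (intro rate) linarith+
      then have "1 \<le> C * - Re \<mu>"
        by (rule rate_bound) (use assms(3) C1 CX(3) in auto)
      then show ?thesis ..
    qed
  qed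
qed

text \<open>No alternative appears: even the slowest roots are at least of order \<open>a\<close>,
  so the frequency bound is in terms of \<open>a\<close> although \<open>c\<close> dominates. The
  third row then makes \<open>y\<close>, and with it the whole eigenvector, of order at most
  c/b.\<close>

lemma modal_root_dominant_relaxation:
  fixes L \<kappa> d :: real
  assumes "1 \<le> L" "0 < \<kappa>" "0 < d"
  shows "\<exists>C\<ge>1. \<forall>a b c \<mu>. 0 < a \<longrightarrow> 0 < b \<longrightarrow> 0 < c \<longrightarrow> a \<le> L * c \<longrightarrow> b \<le> L * c \<longrightarrow> d \<le> L * c \<longrightarrow> d \<le> L * a \<longrightarrow>
    \<kappa> * (a^2 + b^2) \<le> c^2 \<longrightarrow> poly (modal_poly a b c d) \<mu> = 0 \<longrightarrow>
    a \<le> C * cmod \<mu> \<and> 1 \<le> C * (c / b)^2 * - Re \<mu>"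
proof -
  \<comment> \<open>The bound 1/2 makes a root below \<open>\<eta> * a\<close> slow enough for the
    estimate of \<open>y\<close> with \<open>x\<close> eliminated; the other bound gives 2 \<eta> (1
    + L) \<le> \<kappa>, which closes the contradiction in \<open>nu_ge\<close>.\<close>
  define \<eta> where "\<eta> = min (1 / 2) (\<kappa> / (2 * (1 + L)))"
  have \<eta>: "0 < \<eta>" using assms by (simp add: \<eta>_def)
  have \<eta>2: "\<eta> \<le> 1 / 2" and \<eta>': "\<eta> \<le> \<kappa> / (2 * (1 + L))"
    unfolding \<eta>_def by (rule min.cobounded1, rule min.cobounded2)
  note \<eta> = \<eta> \<eta>2
  define W where "W = 21 * L^2 / \<eta>"
  define C where "C = 1 / \<eta> + 4 * W^2 / d"
  have "2 \<le> 1 / \<eta>" using \<eta> by (simp add: field_simps)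
  moreover have "0 \<le> 4 * W^2 / d" using assms by simp
  ultimately have C1: "1 / \<eta> \<le> C" "2 \<le> C"
    unfolding C_def by linarith+
  have CW: "4 * W^2 \<le> C * d"
    using assms \<eta> by (simp add: C_def distrib_right)
  show ?thesis
  proof (rule exI[of _ C], rule conjI, simp add: order_trans[OF _ C1(2)], intro allI impI)
    fix a b c :: real and \<mu> :: complex
    assume a: "0 < a" and b: "0 < b" and c: "0 < c" and ac: "a \<le> L * c" and bc: "b \<le> L * c" and dc: "d \<le> L * c"
      and da: "d \<le> L * a" and k: "\<kappa> * (a^2 + b^2) \<le> c^2" and root: "poly (modal_poly a b c d) \<mu> = 0"
    define \<nu> where "\<nu> = cmod \<mu>"
    have \<nu>: "0 \<le> \<nu>" by (simp add: \<nu>_def)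
    obtain x y z where n: "0 \<le> x" "0 \<le> y" "0 \<le> z"
      "\<nu> * x = a * y" "b * y \<le> c + \<nu> * z" "c \<le> \<nu> * z + b * y"
      "c * z \<le> \<nu> + d"
      "- Re \<mu> * (x^2 + y^2 + z^2 + 1) = d" "\<nu> \<le> a + b + c + d"
      "2 * \<nu> \<le> a \<Longrightarrow> 3 * a^2 * y \<le> 4 * b * \<nu> * z"
      unfolding \<nu>_def by (rule modal_root_norms[OF a b c assms(3) root]) blast
    \<comment> \<open>For a smaller root, \<open>y\<close> is so small that the third row must be
      balanced by \<open>\<nu> * z\<close>. Since \<open>c * z\<close> is at most \<nu> + d \<le> (1
      + L) a, this gives 3 a^2 c^2 \<le> 2 a^2 c^2.\<close>
    have nu_ge: "\<eta> * a \<le> \<nu>"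
    proof (rule ccontr)
      assume "\<not> ?thesis"
      then have lt: "\<nu> < \<eta> * a" by simp
      moreover have "2 * (\<eta> * a) \<le> a" using \<eta> a by simp
      ultimately have "2 * \<nu> \<le> a" by simp
      then have "b * (3 * a^2 * y) \<le> b * (4 * b * \<nu> * z)" using n(10) b by simp
      then have "3 * a^2 * c \<le> \<nu> * z * (3 * a^2 + 4 * b^2)"
        using mult_left_mono[OF n(6), of "3 * a^2"] by (simp add: power2_eq_square algebra_simps)
      then have "c * (3 * a^2 * c) \<le> c * (\<nu> * z * (3 * a^2 + 4 * b^2))" using c by simp
      then have "3 * a^2 * c^2 \<le> \<nu> * (c * z) * (3 * a^2 + 4 * b^2)"
        by (simp add: power2_eq_square mult_ac)
      also have "\<dots> \<le> \<nu> * (\<nu> + d) * (4 * (a^2 + b^2))"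
        using n(7) n(3) c \<nu> assms by (intro mult_mono) auto
      also have "\<dots> \<le> (\<eta> * a) * ((1 + L) * a) * (4 * (a^2 + b^2))"
      proof (intro mult_right_mono mult_mono)
        have "\<eta> * a \<le> a" using \<eta> a by simp
        then show "\<nu> + d \<le> (1 + L) * a" using lt da by (simp add: distrib_right)
      qed (use lt \<nu> assms \<eta> a in auto)
      also have "\<dots> = (\<eta> * (2 * (1 + L))) * (2 * a^2 * (a^2 + b^2))"
        by (simp add: power2_eq_square algebra_simps)
      also have "\<dots> \<le> \<kappa> * (2 * a^2 * (a^2 + b^2))"
        using \<eta>' assms by (intro mult_right_mono) (auto simp: field_simps)
      also have "\<dots> = 2 * a^2 * (\<kappa> * (a^2 + b^2))" by simp
      also have "\<dots> \<le> 2 * a^2 * c^2" using k by (intro mult_left_mono) auto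
      finally have "a^2 * c^2 \<le> 0" by simp
      moreover have "0 < a^2 * c^2" using a c by simp
      ultimately show False by simp
    qed
    define q where "q = c / b"
    have q: "0 < q" "c = q * b" using b c by (auto simp: q_def)
    have "c \<le> L * c" using assms(1) c by simp
    then have nu: "\<nu> \<le> 4 * L * c" using n(9) ac bc dc by linarith
    have "c * z \<le> 5 * L * c" using n(7) nu dc by linarith
    then have "c * z \<le> c * (5 * L)" by (simp add: mult_ac)
    then have z: "z \<le> 5 * L" using c by simp
    have "\<nu> * z \<le> (4 * L * c) * (5 * L)" using nu z n(3) \<nu> by (intro mult_mono) auto
    moreover have "1 \<le> L^2" using assms(1) by (simp add: one_le_power)
    then have "c * 1 \<le> c * L^2" using c by (intro mult_left_mono) auto
    ultimately have "b * y \<le> c * (21 * L^2)" using n(5) by (simp add: power2_eq_square algebra_simps)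
    then have "b * y \<le> b * (21 * L^2 * q)" by (simp add: q(2) mult_ac)
    then have y: "y \<le> 21 * L^2 * q" using b by simp
    have q1: "1 \<le> L * q" using bc b by (simp add: q(2) algebra_simps)
    have "L * (1::real) \<le> L * (L * q)" using q1 assms(1) by (intro mult_left_mono) auto
    then have z': "z \<le> 5 * L^2 * q" using z by (simp add: power2_eq_square)
    have "a * (\<eta> * x) \<le> a * y" using n(4) mult_right_mono[OF nu_ge n(1)] by (simp add: mult_ac)
    then have x: "\<eta> * x \<le> y" using a by simp
    have W: "21 * L^2 * q = \<eta> * (W * q)" using \<eta> by (simp add: W_def)
    have big: "x \<le> W * q" using x y W \<eta> by (metis mult_le_cancel_left_pos order_trans)
    have "\<eta> * (W * q) \<le> 1 * (W * q)" using \<eta> assms q by (intro mult_right_mono) (auto simp: W_def)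
    then have Wq: "21 * L^2 * q \<le> W * q" using W by linarith
    have "L^2 * q = L * (L * q)" by (simp add: power2_eq_square)
    then have L1: "1 \<le> L^2 * q" using \<open>L * 1 \<le> L * (L * q)\<close> assms(1) by linarith
    have "d \<le> 4 * (W * q)^2 * - Re \<mu>"
      by (rule rate_from_norms[OF n(8) assms(3) n(1-3)]) (use big y z' Wq L1 in linarith)+
    then have "1 \<le> (C * q^2) * - Re \<mu>"
      by (rule rate_bound) (use assms(3) C1 mult_right_mono[OF CW, of "q^2"] in \<open>auto simp: power_mult_distrib algebra_simps\<close>)
    moreover have "a \<le> C * \<nu>"
    proof -
      have "a = 1 / \<eta> * (\<eta> * a)" using \<eta> by simp
      also have "\<dots> \<le> C * \<nu>" using C1 nu_ge \<eta> a by (intro mult_mono) auto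
      finally show ?thesis .
    qed
    ultimately show "a \<le> C * cmod \<mu> \<and> 1 \<le> C * (c / b)^2 * - Re \<mu>" by (simp add: q_def \<nu>_def)
  qed
qed

section \<open>Comparison with powers of the eigenvalue\<close>

text \<open>Two-sided comparability with a power on the whole half-line from \<open>l0\<close>, not
  only asymptotically. With \<open>l0\<close> a lower bound of the spectrum, inequalities between
  exponents become inequalities with one constant for all modes.\<close>

definition pow_like :: "real \<Rightarrow> (real \<Rightarrow> real) \<Rightarrow> real \<Rightarrow> bool" where
  "pow_like l0 f e \<longleftrightarrow> (\<exists>A>0. \<forall>l\<ge>l0. l powr e \<le> A * f l \<and> f l \<le> A * l powr e)"

lemma pow_likeI:
  assumes "0 < A" "0 < A'" "\<And>l. l0 \<le> l \<Longrightarrow> l powr e \<le> A * f l" "\<And>l. l0 \<le> l \<Longrightarrow> f l \<le> A' * l powr e"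
    "\<And>l. l0 \<le> l \<Longrightarrow> 0 \<le> f l"
  shows "pow_like l0 f e"
  unfolding pow_like_def
proof (intro exI[of _ "max A A'"] conjI allI impI)
  fix l assume l: "l0 \<le> l"
  have "A * f l \<le> max A A' * f l" using assms(5)[OF l] by (intro mult_right_mono) auto
  then show "l powr e \<le> max A A' * f l" using assms(3)[OF l] by linarith
  have "A' * l powr e \<le> max A A' * l powr e" by (intro mult_right_mono) auto
  then show "f l \<le> max A A' * l powr e" using assms(4)[OF l] by linarith
qed (use assms in auto)

lemma pow_like_pos:
  assumes "pow_like l0 f e" "0 < l0" "l0 \<le> l"
  shows "0 < f l"
proof -
  obtain A where A: "0 < A" "l powr e \<le> A * f l" using assms by (auto simp: pow_like_def)
  have "0 < l powr e" using assms by simp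
  then have "0 < A * f l" using A by linarith
  then show ?thesis using A(1) by (simp add: zero_less_mult_iff)
qed

lemma pow_like_powr: "pow_like l0 (\<lambda>l. l powr e) e"
  by (rule pow_likeI[of 1 1]) auto

lemma pow_like_const: "0 < l0 \<Longrightarrow> 0 < c \<Longrightarrow> pow_like l0 (\<lambda>l. c) 0"
  by (rule pow_likeI[of "1 / c" c]) auto

lemma pow_like_mult:
  assumes "pow_like l0 f e" "pow_like l0 g e'" "0 < l0"
  shows "pow_like l0 (\<lambda>l. f l * g l) (e + e')"
proof -
  obtain A where A: "0 < A" "\<And>l. l0 \<le> l \<Longrightarrow> l powr e \<le> A * f l \<and> f l \<le> A * l powr e"
    using assms by (auto simp: pow_like_def)
  obtain A' where A': "0 < A'" "\<And>l. l0 \<le> l \<Longrightarrow> l powr e' \<le> A' * g l \<and> g l \<le> A' * l powr e'"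
    using assms by (auto simp: pow_like_def)
  have pos: "0 < f l" "0 < g l" if "l0 \<le> l" for l
    using that pow_like_pos assms by blast+
  show ?thesis
  proof (rule pow_likeI[of "A * A'" "A * A'"])
    fix l assume l: "l0 \<le> l"
    have "l powr e * l powr e' \<le> (A * f l) * (A' * g l)"
      using A(2)[OF l] A'(2)[OF l] by (intro mult_mono) (auto intro: order_trans[OF powr_ge_zero])
    then show "l powr (e + e') \<le> A * A' * (f l * g l)" by (simp add: powr_add mult_ac)
    have "f l * g l \<le> (A * l powr e) * (A' * l powr e')"
      using A(2)[OF l] A'(2)[OF l] pos[OF l] A(1) by (intro mult_mono) auto
    then show "f l * g l \<le> A * A' * l powr (e + e')" by (simp add: powr_add mult_ac)
  qed (use A(1) A'(1) pos in \<open>auto simp: less_imp_le\<close>)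
qed

lemma pow_like_fun_powr:
  assumes "pow_like l0 f e" "0 < l0" "0 \<le> k"
  shows "pow_like l0 (\<lambda>l. f l powr k) (e * k)"
proof -
  obtain A where A: "0 < A" "\<And>l. l0 \<le> l \<Longrightarrow> l powr e \<le> A * f l \<and> f l \<le> A * l powr e"
    using assms by (auto simp: pow_like_def)
  have pos: "0 < f l" if "l0 \<le> l" for l
    using that pow_like_pos assms by blast+
  show ?thesis
  proof (rule pow_likeI[of "A powr k" "A powr k"])
    fix l assume l: "l0 \<le> l"
    have "(l powr e) powr k \<le> (A * f l) powr k" using A(2)[OF l] assms by (intro powr_mono2) auto
    then show "l powr (e * k) \<le> A powr k * f l powr k"
      using A(1) pos[OF l] by (simp add: powr_powr powr_mult)
    have "f l powr k \<le> (A * l powr e) powr k" using A(2)[OF l] pos[OF l] assms by (intro powr_mono2) auto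
    then show "f l powr k \<le> A powr k * l powr (e * k)"
      using A(1) by (simp add: powr_powr powr_mult)
  qed (use A(1) in auto)
qed

lemma pow_like_sqrt:
  assumes "pow_like l0 f e" "0 < l0"
  shows "pow_like l0 (\<lambda>l. sqrt (f l)) (e / 2)"
proof -
  have "pow_like l0 (\<lambda>l. f l powr (1/2)) (e * (1/2))" by (rule pow_like_fun_powr[OF assms]) simp
  moreover have "f l powr (1/2) = sqrt (f l)" if "l0 \<le> l" for l
    using pow_like_pos[OF assms that] by (simp add: powr_half_sqrt)
  ultimately show ?thesis by (simp add: pow_like_def)
qed

lemma pow_like_inverse:
  assumes "pow_like l0 f e" "0 < l0"
  shows "pow_like l0 (\<lambda>l. inverse (f l)) (- e)"
proof -
  obtain A where A: "0 < A" "\<And>l. l0 \<le> l \<Longrightarrow> l powr e \<le> A * f l \<and> f l \<le> A * l powr e"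
    using assms by (auto simp: pow_like_def)
  show ?thesis
  proof (rule pow_likeI[of A A])
    fix l assume l: "l0 \<le> l"
    have "0 < f l" "0 < l powr e" using pow_like_pos[OF assms l] l assms(2) by auto
    then show "l powr (- e) \<le> A * inverse (f l)" "inverse (f l) \<le> A * l powr (- e)" "0 \<le> inverse (f l)"
      using A(1) A(2)[OF l] by (simp_all add: powr_minus field_simps)
  qed (use A(1) in auto)
qed

lemma pow_like_divide:
  assumes "pow_like l0 f e" "pow_like l0 g e'" "0 < l0"
  shows "pow_like l0 (\<lambda>l. f l / g l) (e - e')"
  using pow_like_mult[OF assms(1) pow_like_inverse[OF assms(2,3)] assms(3)] by (simp add: divide_inverse)

lemma pow_like_power2:
  assumes "pow_like l0 f e" "0 < l0"
  shows "pow_like l0 (\<lambda>l. (f l)^2) (2 * e)"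
  using pow_like_mult[OF assms(1,1,2)] by (simp add: power2_eq_square)

text \<open>The quotient behaves like a nonpositive power, which is largest at the left end
  \<open>l0\<close>; hence \<open>l0\<close> must be positive.\<close>

lemma pow_like_le:
  assumes "pow_like l0 f e" "pow_like l0 g e'" "0 < l0" "e \<le> e'"
  shows "\<exists>\<Lambda>\<ge>1. \<forall>l\<ge>l0. f l \<le> \<Lambda> * g l"
proof -
  have "pow_like l0 (\<lambda>l. f l / g l) (e - e')" by (rule pow_like_divide[OF assms(1-3)])
  then obtain A where A: "0 < A" "\<And>l. l0 \<le> l \<Longrightarrow> f l / g l \<le> A * l powr (e - e')"
    by (auto simp: pow_like_def)
  show ?thesis
  proof (intro exI[of _ "max 1 (A * l0 powr (e - e'))"] conjI allI impI)
    fix l assume l: "l0 \<le> l"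
    have "l powr (e - e') \<le> l0 powr (e - e')" using l assms by (intro powr_mono2') auto
    then have "A * l powr (e - e') \<le> A * l0 powr (e - e')" using A by simp
    then have "f l / g l \<le> max 1 (A * l0 powr (e - e'))" using A(2)[OF l] by linarith
    then show "f l \<le> max 1 (A * l0 powr (e - e')) * g l"
      using pow_like_pos[OF assms(2,3) l] by (simp add: divide_le_eq)
  qed simp
qed

text \<open>The premise \<open>g l < N * f l\<close> confines \<open>l\<close> to a bounded interval.\<close>

lemma pow_like_le_if:
  assumes "pow_like l0 f e" "pow_like l0 g e'" "0 < l0" "e < e'"
    and h: "pow_like l0 h j" "pow_like l0 h' j'" and N: "0 < N"
  shows "\<exists>\<Lambda>\<ge>1. \<forall>l\<ge>l0. g l < N * f l \<longrightarrow> h l \<le> \<Lambda> * h' l"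
proof (cases "j \<le> j'")
  case True
  then show ?thesis using pow_like_le[OF h assms(3)] by blast
next
  case False
  have "pow_like l0 (\<lambda>l. g l / f l) (e' - e)" by (rule pow_like_divide[OF assms(2,1,3)])
  then obtain A where A: "0 < A" "\<And>l. l0 \<le> l \<Longrightarrow> l powr (e' - e) \<le> A * (g l / f l)"
    by (auto simp: pow_like_def)
  have "pow_like l0 (\<lambda>l. h l / h' l) (j - j')" by (rule pow_like_divide[OF h assms(3)])
  then obtain D where D: "0 < D" "\<And>l. l0 \<le> l \<Longrightarrow> h l / h' l \<le> D * l powr (j - j')"
    by (auto simp: pow_like_def)
  \<comment> \<open>Chosen so that the bounded quantity \<open>l powr (e' - e)\<close> raised to
    \<open>k\<close> is \<open>l powr (j - j')\<close>.\<close>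
  define k where "k = (j - j') / (e' - e)"
  have k: "0 \<le> k" "(e' - e) * k = j - j'" using False assms by (auto simp: k_def)
  define X where "X = D * (A * N) powr k"
  show ?thesis
  proof (intro exI[of _ "max 1 X"] conjI allI impI)
    fix l assume l: "l0 \<le> l" and lt: "g l < N * f l"
    have "g l / f l < N" using lt pow_like_pos[OF assms(1,3) l] by (simp add: divide_less_eq)
    then have "A * (g l / f l) \<le> A * N" by (intro mult_left_mono) (use A in auto)
    then have "(l powr (e' - e)) powr k \<le> (A * N) powr k"
      using A(2)[OF l] k by (intro powr_mono2) auto
    then have "l powr (j - j') \<le> (A * N) powr k" by (simp add: powr_powr k)
    then have "D * l powr (j - j') \<le> X" using D by (simp add: X_def)
    then have "h l / h' l \<le> max 1 X" using D(2)[OF l] by linarith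
    then show "h l \<le> max 1 X * h' l"
      using pow_like_pos[OF h(2) assms(3) l] by (simp add: divide_le_eq)
  qed simp
qed

section \<open>From eigenvalue location to decay\<close>

text \<open>With an integer n at least max k 1, x^k \<le> (1 + x)^n, and 1 + y \<le> exp y at y = x
  / (C n) bounds the latter by (C n)^n exp (x / C).\<close>

lemma exp_le_powr:
  fixes k C :: real
  assumes "0 \<le> k" "1 \<le> C"
  shows "\<exists>K\<ge>0. \<forall>x>0. exp (- x / C) \<le> K * x powr (- k)"
proof -
  obtain n :: nat where "max k 1 \<le> n"
    using real_arch_simple[of "max k 1"] ..
  then have n: "k \<le> n" "1 \<le> n" by auto
  show ?thesis
  proof (intro exI[of _ "(C * n) ^ n"] conjI allI impI)
    fix x :: real assume x: "0 < x"
    have Cn: "1 \<le> C * n" using mult_mono[of 1 C 1 "real n"] assms n by simp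
    have "1 + x \<le> C * n * (1 + x / (C * n))" using x Cn assms n by (simp add: distrib_left)
    also have "\<dots> \<le> C * n * exp (x / (C * n))" using Cn by (intro mult_left_mono exp_ge_add_one_self) auto
    finally have 1: "1 + x \<le> C * n * exp (x / (C * n))" .
    have "x powr k \<le> (1 + x) powr k" using x assms by (intro powr_mono2) auto
    also have "\<dots> \<le> (1 + x) powr n" using x n by (intro powr_mono) auto
    also have "\<dots> = (1 + x) ^ n" using x by (simp add: powr_realpow)
    also have "\<dots> \<le> (C * n * exp (x / (C * n))) ^ n" using 1 x by (intro power_mono) auto
    also have "\<dots> = (C * n) ^ n * exp (x / C)"
      using n by (simp add: power_mult_distrib exp_of_nat_mult[symmetric])
    finally have "x powr k \<le> (C * n) ^ n * exp (x / C)" .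
    then show "exp (- x / C) \<le> (C * n) ^ n * x powr (- k)"
      using x by (simp add: powr_minus exp_minus field_simps)
  qed (use assms in auto)
qed

text \<open>\<open>s\<close> plays the role of a relaxation time. The damping gives exp (- t / (C
  s)), hence (t/s)^(-k) up to a constant, and the loss s^k is paid for by the frequency
  |\<mu>|.\<close>

lemma decay_from_rate:
  fixes k C :: real
  assumes "0 \<le> k" "1 \<le> C"
  shows "\<exists>K\<ge>0. \<forall>\<mu> s. 0 < s \<longrightarrow> (1 \<le> C * - Re \<mu> \<or> (s powr k \<le> C * cmod \<mu> \<and> 1 \<le> C * s * - Re \<mu>)) \<longrightarrow>
    Re \<mu> < 0 \<and> (\<forall>t>0. exp (Re \<mu> * t) \<le> K * cmod \<mu> * t powr (- k))"
proof -
  obtain K where "0 \<le> K \<and> (\<forall>x>0. exp (- x / C) \<le> K * x powr (- k))"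
    using exp_le_powr[OF assms] ..
  then have K: "0 \<le> K" "\<And>x. 0 < x \<Longrightarrow> exp (- x / C) \<le> K * x powr (- k)"
    by simp_all
  have main: "Re \<mu> < 0 \<and> (\<forall>t>0. exp (Re \<mu> * t) \<le> K * C * cmod \<mu> * t powr (- k))"
    if s: "0 < s" "s powr k \<le> C * cmod \<mu>" and r: "1 \<le> C * s * - Re \<mu>" for \<mu> s
  proof (intro conjI allI impI)
    have "0 < (C * s) * - Re \<mu>" using r by linarith
    then show "Re \<mu> < 0" using s(1) assms(2) by (simp add: mult_less_0_iff)
    fix t :: real assume t: "0 < t"
    have Cs: "0 < C * s" using s assms by simp
    have "(1 / (C * s)) * 1 \<le> (1 / (C * s)) * (C * s * - Re \<mu>)" using r Cs by (intro mult_left_mono) auto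
    also have "\<dots> = - Re \<mu>" using s assms by simp
    finally have "1 / (C * s) \<le> - Re \<mu>" by simp
    then have "1 / (C * s) * t \<le> - Re \<mu> * t" using t by (intro mult_right_mono) auto
    then have "exp (Re \<mu> * t) \<le> exp (- (t / s) / C)" using s assms by (simp add: mult_ac)
    also have "\<dots> \<le> K * (t / s) powr (- k)" by (rule K(2)) (use s t in simp)
    also have "(t / s) powr (- k) = s powr k * t powr (- k)"
      using s t by (simp add: powr_divide powr_minus field_simps)
    also have "K * (s powr k * t powr (- k)) \<le> K * ((C * cmod \<mu>) * t powr (- k))"
      using s K by (intro mult_left_mono mult_right_mono) auto
    finally show "exp (Re \<mu> * t) \<le> K * C * cmod \<mu> * t powr (- k)" by (simp add: mult_ac)
  qed
  show ?thesis
  proof (intro exI[of _ "K * C"] conjI[of "0 \<le> K * C"] allI impI)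
    fix \<mu> s assume s: "(0::real) < s" and
      cs: "1 \<le> C * - Re \<mu> \<or> (s powr k \<le> C * cmod \<mu> \<and> 1 \<le> C * s * - Re \<mu>)"
    from cs show "Re \<mu> < 0 \<and> (\<forall>t>0. exp (Re \<mu> * t) \<le> K * C * cmod \<mu> * t powr (- k))"
    proof
      assume 1: "1 \<le> C * - Re \<mu>"
      also have "C * - Re \<mu> \<le> C * cmod \<mu>"
        using assms abs_Re_le_cmod[of \<mu>] by (intro mult_left_mono) auto
      \<comment> \<open>Damping bounded away from 0 is the case \<open>s = 1\<close>, since |\<mu>|
        is at least -Re \<mu>.\<close>
      finally show ?thesis using 1 by (intro main[of 1]) auto
    qed (use main[OF s] in blast)
  qed (use K assms in auto)
qed

lemma le_mult_mono: "x \<le> L' * y \<Longrightarrow> L' \<le> L \<Longrightarrow> 0 < y \<Longrightarrow> x \<le> L * y" for x y L L' :: real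
  using mult_right_mono[of L' L y] by linarith

section \<open>Modal coefficients and the three parameter regions\<close>

locale modal_coefficients =
  fixes m \<sigma> \<tau> \<alpha> \<beta> \<gamma> :: real
  assumes m: "0 < m" and \<sigma>: "0 < \<sigma>" and \<tau>: "0 < \<tau>"
    and \<alpha>: "0 \<le> \<alpha>" and \<beta>: "0 \<le> \<beta>" and \<gamma>: "0 < \<gamma>" "\<gamma> \<le> 1"
begin

text \<open>\<open>M\<close> is the symbol of I + m A^\<gamma>. The four coefficients below are what
  the system becomes in the energy variables of \<open>modal_op\<close>; \<open>B_Phi\<close>
  carries out the translation.\<close>

definition M :: "real \<Rightarrow> real" where "M l = 1 + m * l powr \<gamma>"
definition ca :: "real \<Rightarrow> real" where "ca l = sqrt (\<sigma> * l / M l)"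
definition cb :: "real \<Rightarrow> real" where "cb l = l powr \<alpha> / sqrt (M l)"
definition cc :: "real \<Rightarrow> real" where "cc l = l powr (\<beta> / 2) / sqrt \<tau>"
definition cd :: real where "cd = 1 / \<tau>"

abbreviation modal_root :: "real \<Rightarrow> complex \<Rightarrow> bool" where
  "modal_root l \<mu> \<equiv> poly (modal_poly (ca l) (cb l) (cc l) cd) \<mu> = 0"

text \<open>The condition on the roots in \<open>dissipative_decay\<close>, with one constant for
  all eigenvalues from \<open>l0\<close> on.\<close>

definition modes_decay :: "real \<Rightarrow> real \<Rightarrow> bool" where
  "modes_decay l0 k \<longleftrightarrow> (\<exists>K\<ge>0. \<forall>l\<ge>l0. \<forall>\<mu>. modal_root l \<mu> \<longrightarrow>
    Re \<mu> < 0 \<and> (\<forall>t>0. exp (Re \<mu> * t) \<le> K * cmod \<mu> * t powr (- k)))"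

lemma M_pos: "0 < M l"
  using m by (simp add: M_def add_pos_nonneg)

lemma cd_pos: "0 < cd" using \<tau> by (simp add: cd_def)

context
  fixes l0 :: real
  assumes l0: "0 < l0"
begin

lemma pow_like_M: "pow_like l0 M \<gamma>"
proof (rule pow_likeI[of "1 / m" "l0 powr (- \<gamma>) + m"])
  fix l assume l: "l0 \<le> l"
  show "l powr \<gamma> \<le> 1 / m * M l" using m by (simp add: M_def field_simps)
  have "l0 powr (- \<gamma>) * l0 powr \<gamma> \<le> l0 powr (- \<gamma>) * l powr \<gamma>"
    using l l0 \<gamma> by (intro mult_left_mono powr_mono2) auto
  then have "1 \<le> l0 powr (- \<gamma>) * l powr \<gamma>" using l0 by (simp add: powr_minus)
  then show "M l \<le> (l0 powr (- \<gamma>) + m) * l powr \<gamma>" by (simp add: M_def distrib_right)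
qed (use m l0 in \<open>auto simp: M_def add_pos_pos\<close>)

lemma pow_like_ca: "pow_like l0 ca ((1 - \<gamma>) / 2)"
proof -
  have "pow_like l0 (\<lambda>l. \<sigma> * l powr 1) (0 + 1)"
    by (intro pow_like_mult pow_like_const pow_like_powr l0 \<sigma>)
  then have "pow_like l0 (\<lambda>l. \<sigma> * l) 1" using l0 by (simp add: pow_like_def)
  from pow_like_sqrt[OF pow_like_divide[OF this pow_like_M l0] l0] show ?thesis
    by (simp add: ca_def[abs_def])
qed

lemma pow_like_cb: "pow_like l0 cb (\<alpha> - \<gamma> / 2)"
  unfolding cb_def[abs_def] by (intro pow_like_divide pow_like_powr pow_like_sqrt pow_like_M l0)

lemma pow_like_cc: "pow_like l0 cc (\<beta> / 2)"
  using pow_like_divide[OF pow_like_powr[of l0 "\<beta> / 2"] pow_like_const[OF l0, of "sqrt \<tau>"] l0] \<tau>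
  by (simp add: cc_def[abs_def])

lemma pow_like_cd: "pow_like l0 (\<lambda>l. cd) 0"
  by (rule pow_like_const[OF l0 cd_pos])

lemmas pos_c = pow_like_pos[OF pow_like_ca l0] pow_like_pos[OF pow_like_cb l0] pow_like_pos[OF pow_like_cc l0]

lemma cc_lower: "\<exists>c0>0. \<forall>l\<ge>l0. c0 \<le> cc l"
proof -
  obtain \<Lambda> where L: "1 \<le> \<Lambda>" "\<And>l. l0 \<le> l \<Longrightarrow> 1 \<le> \<Lambda> * cc l"
    using pow_like_le[OF pow_like_const[OF l0, of 1] pow_like_cc l0] \<beta> by auto
  show ?thesis
    by (rule exI[of _ "1 / \<Lambda>"]) (use L in \<open>auto simp: divide_le_eq mult.commute\<close>)
qed

text \<open>Interface between root location and decay: \<open>s\<close> is the relaxation time and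
  \<open>f\<close> the frequency of the slowly damped roots; \<open>D\<close> absorbs the constant
  in comparing s^k with f.\<close>

lemma modal_decay_of_rate:
  assumes k: "0 \<le> k" and C: "1 \<le> C" and D: "1 \<le> D"
    and s: "\<And>l. l0 \<le> l \<Longrightarrow> 0 < s l" "\<And>l. l0 \<le> l \<Longrightarrow> s l powr k \<le> D * f l"
    and rate: "\<And>l \<mu>. l0 \<le> l \<Longrightarrow> modal_root l \<mu> \<Longrightarrow>
      1 \<le> C * - Re \<mu> \<or> (f l \<le> C * cmod \<mu> \<and> 1 \<le> C * s l * - Re \<mu>)"
  shows "modes_decay l0 k"
proof -
  have "1 * C \<le> D * C" using C D by (intro mult_right_mono) auto
  then have CD: "C \<le> D * C" "1 \<le> D * C" using C by linarith+
  obtain K where "0 \<le> K \<and> (\<forall>\<mu> s. 0 < s \<longrightarrow> (1 \<le> (D * C) * - Re \<mu> \<or> (s powr k \<le> (D * C) * cmod \<mu> \<and> 1 \<le> (D * C) * s * - Re \<mu>)) \<longrightarrow>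
    Re \<mu> < 0 \<and> (\<forall>t>0. exp (Re \<mu> * t) \<le> K * cmod \<mu> * t powr (- k)))"
    using decay_from_rate[OF k CD(2)] ..
  then have K: "0 \<le> K" and K2: "\<forall>\<mu> s. 0 < s \<longrightarrow> (1 \<le> (D * C) * - Re \<mu> \<or> (s powr k \<le> (D * C) * cmod \<mu> \<and> 1 \<le> (D * C) * s * - Re \<mu>)) \<longrightarrow>
    Re \<mu> < 0 \<and> (\<forall>t>0. exp (Re \<mu> * t) \<le> K * cmod \<mu> * t powr (- k))"
    by (rule conjunct1, rule conjunct2)
  show ?thesis
    unfolding modes_decay_def
  proof (intro exI[of _ K] conjI[of "0 \<le> K"] allI impI K)
    fix l \<mu> assume l: "l0 \<le> l" and root: "modal_root l \<mu>"
    have up: "1 \<le> (D * C) * x" if "1 \<le> C * x" for x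
    proof -
      have "0 < C * x" using that by linarith
      then have "0 < x" using C by (simp add: zero_less_mult_iff)
      then have "C * x \<le> D * C * x" using CD(1) by (intro mult_right_mono) auto
      then show ?thesis using that by simp
    qed
    have "1 \<le> (D * C) * - Re \<mu> \<or> (s l powr k \<le> (D * C) * cmod \<mu> \<and> 1 \<le> (D * C) * s l * - Re \<mu>)"
      using rate[OF l root]
    proof
      assume "1 \<le> C * - Re \<mu>"
      then show ?thesis by (intro disjI1 up)
    next
      assume *: "f l \<le> C * cmod \<mu> \<and> 1 \<le> C * s l * - Re \<mu>"
      then have "D * f l \<le> D * (C * cmod \<mu>)" using D by simp
      then have "s l powr k \<le> (D * C) * cmod \<mu>" using s(2)[OF l] by (simp only: mult.assoc)
      moreover have "1 \<le> D * C * (s l * - Re \<mu>)" using * by (intro up) (simp only: mult.assoc)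
      then have "1 \<le> (D * C) * s l * - Re \<mu>" by (simp only: mult.assoc)
      ultimately show ?thesis by (intro disjI2 conjI)
    qed
    then show "Re \<mu> < 0 \<and> (\<forall>t>0. exp (Re \<mu> * t) \<le> K * cmod \<mu> * t powr (- k))"
      by (rule K2[rule_format, OF s(1)[OF l]])
  qed
qed

text \<open>The relaxation time grows like l^(2\<alpha>-\<beta>-\<gamma>) and the frequency like
  l^(\<alpha>-\<gamma>/2); \<open>k\<close> is the quotient of these exponents.\<close>

lemma modal_decay_V1:
  assumes "1 / 2 \<le> \<alpha>" "2 * \<alpha> \<le> \<beta> + 1" "\<gamma> < 2 * \<alpha> - \<beta>"
  defines "k \<equiv> (2 * \<alpha> - \<gamma>) / (2 * (2 * \<alpha> - \<beta> - \<gamma>))"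
  shows "modes_decay l0 k"
proof -
  have k: "0 \<le> k" using assms \<beta> by (simp add: k_def)
  obtain L1 where L1: "1 \<le> L1" "\<And>l. l0 \<le> l \<Longrightarrow> ca l \<le> L1 * cb l"
    using pow_like_le[OF pow_like_ca pow_like_cb l0] assms by auto
  obtain L2 where L2: "1 \<le> L2" "\<And>l. l0 \<le> l \<Longrightarrow> cc l \<le> L2 * cb l"
    using pow_like_le[OF pow_like_cc pow_like_cb l0] assms by auto
  obtain L3 where L3: "1 \<le> L3" "\<And>l. l0 \<le> l \<Longrightarrow> cd \<le> L3 * cb l"
    using pow_like_le[OF pow_like_cd pow_like_cb l0] assms \<beta> by auto
  \<comment> \<open>This is where 2 \<alpha> \<le> \<beta> + 1 enters; \<open>1 / L4\<close> serves
    as the constant \<kappa>.\<close>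
  obtain L4 where L4: "1 \<le> L4" "\<And>l. l0 \<le> l \<Longrightarrow> cb l \<le> L4 * (ca l * cc l)"
    using pow_like_le[OF pow_like_cb pow_like_mult[OF pow_like_ca pow_like_cc l0] l0] assms by (auto simp: field_simps)
  \<comment> \<open>The strict inequality \<gamma> < 2 \<alpha> - \<beta> makes \<open>cb\<close>
    outgrow \<open>cc\<close>, so the premise holds only in a bounded range.\<close>
  obtain L5 where L5: "1 \<le> L5" "\<And>l. l0 \<le> l \<Longrightarrow> cb l < 3 * cc l \<longrightarrow> cb l \<le> L5 * ca l"
    using pow_like_le_if[OF pow_like_cc pow_like_cb l0 _ pow_like_cb pow_like_ca, of 3] assms by auto
  obtain c0 where c0: "0 < c0" "\<And>l. l0 \<le> l \<Longrightarrow> c0 \<le> cc l" using cc_lower by blast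
  define L where "L = L1 + L2 + L3 + L5"
  have L: "1 \<le> L" "L1 \<le> L" "L2 \<le> L" "L3 \<le> L" "L5 \<le> L" using L1 L2 L3 L5 by (auto simp: L_def)
  have "0 < 1 / L4" using L4 by simp
  note root_bound = modal_root_dominant_coupling[OF L(1) this c0(1) cd_pos]
  have s: "pow_like l0 (\<lambda>l. (cb l / cc l)^2) (2 * (\<alpha> - \<gamma> / 2 - \<beta> / 2))"
    by (intro pow_like_power2 pow_like_divide pow_like_cb pow_like_cc l0)
  have "2 * (\<alpha> - \<gamma> / 2 - \<beta> / 2) * k \<le> \<alpha> - \<gamma> / 2"
  proof -
    define p where "p = 2 * \<alpha> - \<beta> - \<gamma>"
    have p: "0 < p" using assms by (simp add: p_def)
    have "2 * (\<alpha> - \<gamma> / 2 - \<beta> / 2) = p" by (simp add: p_def field_simps)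
    moreover have "k = (2 * \<alpha> - \<gamma>) / (2 * p)" by (simp add: k_def p_def)
    ultimately show ?thesis using p by (simp add: field_simps)
  qed
  then obtain D where D: "1 \<le> D" "\<And>l. l0 \<le> l \<Longrightarrow> ((cb l / cc l)^2) powr k \<le> D * cb l"
    using pow_like_le[OF pow_like_fun_powr[OF s l0 k] pow_like_cb l0] by auto
  from root_bound show ?thesis
    apply (elim exE conjE)
    subgoal premises C for C
  proof (rule modal_decay_of_rate[OF k C(1) D(1) _ D(2)])
    fix l \<mu> assume l: "l0 \<le> l" and root: "modal_root l \<mu>"
    note p = pos_c[OF l]
    show "1 \<le> C * - Re \<mu> \<or> (cb l \<le> C * cmod \<mu> \<and> 1 \<le> C * (cb l / cc l)^2 * - Re \<mu>)"
      using L1(2)[OF l] L2(2)[OF l] L3(2)[OF l] L4(1) L4(2)[OF l] L5(2)[OF l] L p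
      by (intro C(2)[rule_format, OF p(1,2) c0(2)[OF l] _ _ _ _ _ root])
        (auto intro: le_mult_mono simp: divide_le_eq mult_ac)
  qed (use pow_like_pos[OF s l0] in auto)
  done
qed

text \<open>The relaxation time grows like l^(2-2\<alpha>-\<beta>-\<gamma>) and the frequency like
  l^((1-\<gamma>)/2).\<close>

lemma modal_decay_V2:
  assumes "\<alpha> < 1 / 2" "\<gamma> < 1 - \<beta>"
  defines "k \<equiv> (1 - \<gamma>) / (2 * (- 2 * \<alpha> - \<beta> - \<gamma> + 2))"
  shows "modes_decay l0 k"
proof -
  have k: "0 \<le> k" using assms \<beta> \<gamma> by (simp add: k_def)
  obtain L1 where L1: "1 \<le> L1" "\<And>l. l0 \<le> l \<Longrightarrow> cb l \<le> L1 * ca l"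
    using pow_like_le[OF pow_like_cb pow_like_ca l0] assms by (auto simp: field_simps)
  obtain L2 where L2: "1 \<le> L2" "\<And>l. l0 \<le> l \<Longrightarrow> cc l \<le> L2 * ca l"
    using pow_like_le[OF pow_like_cc pow_like_ca l0] assms by auto
  obtain L3 where L3: "1 \<le> L3" "\<And>l. l0 \<le> l \<Longrightarrow> cd \<le> L3 * ca l"
    using pow_like_le[OF pow_like_cd pow_like_ca l0] assms \<gamma> by auto
  obtain L5 where L5: "1 \<le> L5" "\<And>l. l0 \<le> l \<Longrightarrow> ca l < 2 * cb l \<longrightarrow> ca l \<le> L5 * cc l"
    using pow_like_le_if[OF pow_like_cb pow_like_ca l0 _ pow_like_ca pow_like_cc, of 2] assms by (auto simp: field_simps)
  obtain c0 where c0: "0 < c0" "\<And>l. l0 \<le> l \<Longrightarrow> c0 \<le> cc l" using cc_lower by blast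
  define L where "L = L1 + L2 + L3 + L5"
  have L: "1 \<le> L" "L1 \<le> L" "L2 \<le> L" "L3 \<le> L" "L5 \<le> L" using L1 L2 L3 L5 by (auto simp: L_def)
  note root_bound = modal_root_dominant_elasticity[OF L(1) c0(1) cd_pos]
  have s: "pow_like l0 (\<lambda>l. ((ca l)^2 / (cb l * cc l))^2) (2 * (2 * ((1 - \<gamma>) / 2) - (\<alpha> - \<gamma> / 2 + \<beta> / 2)))"
    by (intro pow_like_power2 pow_like_divide pow_like_mult pow_like_ca pow_like_cb pow_like_cc l0)
  have "2 * (2 * ((1 - \<gamma>) / 2) - (\<alpha> - \<gamma> / 2 + \<beta> / 2)) * k \<le> (1 - \<gamma>) / 2"
  proof -
    define p where "p = - 2 * \<alpha> - \<beta> - \<gamma> + 2"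
    have p: "0 < p" using assms by (simp add: p_def)
    have "2 * (2 * ((1 - \<gamma>) / 2) - (\<alpha> - \<gamma> / 2 + \<beta> / 2)) = p" by (simp add: p_def field_simps)
    moreover have "k = (1 - \<gamma>) / (2 * p)" by (simp add: k_def p_def)
    ultimately show ?thesis using p by simp
  qed
  then obtain D where D: "1 \<le> D" "\<And>l. l0 \<le> l \<Longrightarrow> (((ca l)^2 / (cb l * cc l))^2) powr k \<le> D * ca l"
    using pow_like_le[OF pow_like_fun_powr[OF s l0 k] pow_like_ca l0] by auto
  from root_bound show ?thesis
    apply (elim exE conjE)
    subgoal premises C for C
  proof (rule modal_decay_of_rate[OF k C(1) D(1) _ D(2)])
    fix l \<mu> assume l: "l0 \<le> l" and root: "modal_root l \<mu>"
    note p = pos_c[OF l]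
    show "1 \<le> C * - Re \<mu> \<or> (ca l \<le> C * cmod \<mu> \<and> 1 \<le> C * ((ca l)^2 / (cb l * cc l))^2 * - Re \<mu>)"
      using L1(2)[OF l] L2(2)[OF l] L3(2)[OF l] L5(2)[OF l] L p
      by (intro C(2)[rule_format, OF p(1,2) c0(2)[OF l] _ _ _ _ root]) (auto intro: le_mult_mono)
  qed (use pow_like_pos[OF s l0] in auto)
  done
qed

text \<open>The relaxation time grows like l^(\<beta>+\<gamma>-2\<alpha>). The numerator is again 1
  - \<gamma> because the frequency is bounded below by \<open>ca\<close>, not by the dominant
  \<open>cc\<close>; at \<gamma> = 1 the order is 0.\<close>

lemma modal_decay_V3:
  assumes "2 * \<alpha> < \<beta> + \<gamma>" "1 - \<gamma> \<le> \<beta>"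
  defines "k \<equiv> (1 - \<gamma>) / (2 * (- 2 * \<alpha> + \<beta> + \<gamma>))"
  shows "modes_decay l0 k"
proof -
  have k: "0 \<le> k" using assms \<gamma> by (simp add: k_def)
  obtain L1 where L1: "1 \<le> L1" "\<And>l. l0 \<le> l \<Longrightarrow> ca l \<le> L1 * cc l"
    using pow_like_le[OF pow_like_ca pow_like_cc l0] assms by auto
  obtain L2 where L2: "1 \<le> L2" "\<And>l. l0 \<le> l \<Longrightarrow> cb l \<le> L2 * cc l"
    using pow_like_le[OF pow_like_cb pow_like_cc l0] assms by (auto simp: field_simps)
  obtain L3 where L3: "1 \<le> L3" "\<And>l. l0 \<le> l \<Longrightarrow> cd \<le> L3 * cc l"
    using pow_like_le[OF pow_like_cd pow_like_cc l0] \<beta> by auto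
  obtain L4 where L4: "1 \<le> L4" "\<And>l. l0 \<le> l \<Longrightarrow> cd \<le> L4 * ca l"
    using pow_like_le[OF pow_like_cd pow_like_ca l0] \<gamma> by auto
  define L where "L = L1 + L2 + L3 + L4"
  have L: "1 \<le> L" "L1 \<le> L" "L2 \<le> L" "L3 \<le> L" "L4 \<le> L" using L1 L2 L3 L4 by (auto simp: L_def)
  \<comment> \<open>The constant \<kappa>: two squares, each at most
    \<open>(L * cc l)^2\<close>.\<close>
  have "0 < 1 / (2 * L^2)" using L by simp
  note root_bound = modal_root_dominant_relaxation[OF L(1) this cd_pos]
  have s: "pow_like l0 (\<lambda>l. (cc l / cb l)^2) (2 * (\<beta> / 2 - (\<alpha> - \<gamma> / 2)))"
    by (intro pow_like_power2 pow_like_divide pow_like_cb pow_like_cc l0)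
  have "2 * (\<beta> / 2 - (\<alpha> - \<gamma> / 2)) * k \<le> (1 - \<gamma>) / 2"
  proof -
    define p where "p = - 2 * \<alpha> + \<beta> + \<gamma>"
    have p: "0 < p" using assms by (simp add: p_def)
    have "2 * (\<beta> / 2 - (\<alpha> - \<gamma> / 2)) = p" by (simp add: p_def field_simps)
    moreover have "k = (1 - \<gamma>) / (2 * p)" by (simp add: k_def p_def)
    ultimately show ?thesis using p by simp
  qed
  then obtain D where D: "1 \<le> D" "\<And>l. l0 \<le> l \<Longrightarrow> ((cc l / cb l)^2) powr k \<le> D * ca l"
    using pow_like_le[OF pow_like_fun_powr[OF s l0 k] pow_like_ca l0] by auto
  from root_bound show ?thesis
    apply (elim exE conjE)
    subgoal premises C for C
  proof (rule modal_decay_of_rate[OF k C(1) D(1) _ D(2)])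
    fix l \<mu> assume l: "l0 \<le> l" and root: "modal_root l \<mu>"
    note p = pos_c[OF l]
    have ac: "ca l \<le> L * cc l" and bc: "cb l \<le> L * cc l"
      using L1(2)[OF l] L2(2)[OF l] L p by (auto intro: le_mult_mono)
    have "(ca l)^2 + (cb l)^2 \<le> (L * cc l)^2 + (L * cc l)^2"
      using ac bc p by (intro add_mono power_mono) auto
    then have "1 / (2 * L^2) * ((ca l)^2 + (cb l)^2) \<le> (cc l)^2"
      using L by (simp add: power_mult_distrib field_simps)
    then show "1 \<le> C * - Re \<mu> \<or> (ca l \<le> C * cmod \<mu> \<and> 1 \<le> C * (cc l / cb l)^2 * - Re \<mu>)"
      using L3(2)[OF l] L4(2)[OF l] L p ac bc
      by (intro disjI2 C(2)[rule_format, OF p(1,2,3) _ _ _ _ _ root]) (auto intro: le_mult_mono)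
  qed (use pow_like_pos[OF s l0] in auto)
  done
qed

end

end

section \<open>Spectral theorem for positive definite operators with compact resolvent\<close>

locale positive_operator =
  fixes A :: "'h::complex_hilbert_space unbounded_op"
  assumes self_adjoint: "self_adjoint A" and positive: "positive_definite A" and compact: "compact_resolvent A"
begin

abbreviation "D \<equiv> op_dom A"
abbreviation "op \<equiv> op_app A"

lemma csubspace_D: "csubspace D"
  and op_add: "x \<in> D \<Longrightarrow> y \<in> D \<Longrightarrow> op (x + y) = op x + op y"
  and op_scaleC: "x \<in> D \<Longrightarrow> op (c *\<^sub>C x) = c *\<^sub>C op x"
  using self_adjoint by (auto simp: self_adjoint_def clinear_on_def)

lemmas DD = csubspaceD[OF csubspace_D]

lemma op_scaleR: "x \<in> D \<Longrightarrow> op (r *\<^sub>R x) = r *\<^sub>R op x"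
  by (simp add: scaleR_scaleC op_scaleC)

lemma op_minus: "x \<in> D \<Longrightarrow> op (- x) = - op x"
  using op_scaleR[of x "- 1"] by simp

lemma op_diff: "x \<in> D \<Longrightarrow> y \<in> D \<Longrightarrow> op (x - y) = op x - op y"
  using op_add[of x "- y"] DD(5)[of y] by (simp add: op_minus)

lemma adjoint_iff: "adjoint_rel A y z \<longleftrightarrow> y \<in> D \<and> op y = z"
  using self_adjoint by (simp add: self_adjoint_def)

lemma op_symmetric: "x \<in> D \<Longrightarrow> y \<in> D \<Longrightarrow> cinner (op x) y = cinner x (op y)"
  using adjoint_iff[of y "op y"] by (simp add: adjoint_rel_def)

lemma op_closed:
  assumes f: "\<And>n. f n \<in> D" "f \<longlonglongrightarrow> x" "(\<lambda>n. op (f n)) \<longlonglongrightarrow> z"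
  shows "x \<in> D \<and> op x = z"
  unfolding adjoint_iff[symmetric] adjoint_rel_def
proof
  fix w assume w: "w \<in> D"
  have "(\<lambda>n. cinner (op w) (f n)) \<longlonglongrightarrow> cinner (op w) x"
    by (intro cinner.tendsto tendsto_const f(2))
  moreover have "(\<lambda>n. cinner w (op (f n))) \<longlonglongrightarrow> cinner w z"
    by (intro cinner.tendsto tendsto_const f(3))
  ultimately show "cinner (op w) x = cinner w z"
    using LIMSEQ_unique by (simp add: op_symmetric[OF w f(1)])
qed

lemma op_nonneg: "x \<in> D \<Longrightarrow> 0 \<le> Re (cinner (op x) x)"
  using positive by (cases "x = 0") (auto simp: positive_definite_def less_imp_le)

text \<open>A + I instead of A, because positivity bounds it below by 1 before any spectral gap is
  known. Its inverse \<open>T\<close> is bounded, symmetric and compact, and has the same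
  eigenvectors.\<close>

definition shift :: "'h \<Rightarrow> 'h" where "shift x = op x + x"

lemma shift_add: "x \<in> D \<Longrightarrow> y \<in> D \<Longrightarrow> shift (x + y) = shift x + shift y"
  and shift_scaleC: "x \<in> D \<Longrightarrow> shift (c *\<^sub>C x) = c *\<^sub>C shift x"
  and shift_diff: "x \<in> D \<Longrightarrow> y \<in> D \<Longrightarrow> shift (x - y) = shift x - shift y"
  by (simp_all add: shift_def op_add op_scaleC op_diff scaleC_add_right)

lemma norm_le_shift: assumes x: "x \<in> D" shows "norm x \<le> norm (shift x)"
proof -
  have "(norm x)^2 \<le> Re (cinner (shift x) x)"
    using op_nonneg[OF x] by (simp add: shift_def cinner.add_left Re_cinner_self)
  also have "\<dots> \<le> norm (shift x) * norm x"
    using abs_le_D1[OF cauchy_schwarz_aux] .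
  finally have "norm x * norm x \<le> norm (shift x) * norm x" by (simp add: power2_eq_square)
  then show ?thesis by (cases "x = 0") auto
qed

lemma inj_on_shift: "inj_on shift D"
proof (rule inj_onI)
  fix x y assume xy: "x \<in> D" "y \<in> D" "shift x = shift y"
  then have "shift (x - y) = 0" by (simp add: shift_diff)
  then show "x = y" using norm_le_shift[OF DD(6)[OF xy(1,2)]] by simp
qed

lemma closed_range_shift: "closed (shift ` D)"
  unfolding closed_sequential_limits
proof (intro allI impI, elim conjE)
  fix g l assume g: "\<forall>n. g n \<in> shift ` D" and lim: "g \<longlonglongrightarrow> l"
  then have "\<forall>n. \<exists>x. x \<in> D \<and> g n = shift x" by auto
  from choice[OF this] obtain f where f: "\<And>n. f n \<in> D" "\<And>n. g n = shift (f n)" by auto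
  have "Cauchy f"
    unfolding Cauchy_def
  proof (intro allI impI)
    fix e :: real assume "0 < e"
    then obtain N where N: "\<And>m n. m \<ge> N \<Longrightarrow> n \<ge> N \<Longrightarrow> dist (g m) (g n) < e"
      using LIMSEQ_imp_Cauchy[OF lim] unfolding Cauchy_def by blast
    show "\<exists>M. \<forall>m\<ge>M. \<forall>n\<ge>M. dist (f m) (f n) < e"
    proof (intro exI allI impI)
      fix m n assume "N \<le> m" "N \<le> n"
      then have "norm (shift (f m - f n)) < e"
        using N[of m n] f by (simp add: dist_norm shift_diff)
      then show "dist (f m) (f n) < e"
        using norm_le_shift[OF DD(6)[OF f(1) f(1), of m n]] by (simp add: dist_norm)
    qed
  qed
  then obtain x where x: "f \<longlonglongrightarrow> x" using Cauchy_convergent convergent_def by blast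
  have "(\<lambda>n. g n - f n) \<longlonglongrightarrow> l - x" by (intro tendsto_diff lim x)
  then have "(\<lambda>n. op (f n)) \<longlonglongrightarrow> l - x" by (simp add: f(2) shift_def)
  from op_closed[OF f(1) x this] show "l \<in> shift ` D"
    by (intro image_eqI[of _ _ x]) (auto simp: shift_def)
qed

lemma csubspace_range_shift: "csubspace (shift ` D)"
  unfolding csubspace_def
proof (intro conjI ballI allI)
  show "0 \<in> shift ` D" using shift_diff[of 0 0] DD(1) by (intro image_eqI[of _ _ 0]) auto
next
  fix x y assume "x \<in> shift ` D" "y \<in> shift ` D"
  then obtain v w where "v \<in> D" "w \<in> D" "x = shift v" "y = shift w" by auto
  then show "x + y \<in> shift ` D" by (intro image_eqI[of _ _ "v + w"]) (simp_all add: shift_add DD(2))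
next
  fix c x assume "x \<in> shift ` D"
  then obtain v where "v \<in> D" "x = shift v" by auto
  then show "c *\<^sub>C x \<in> shift ` D" by (intro image_eqI[of _ _ "c *\<^sub>C v"]) (simp_all add: shift_scaleC DD(3))
qed

text \<open>A vector \<open>z\<close> orthogonal to the range lies in the domain of the adjoint,
  which is A itself, and satisfies \<open>op z = - z\<close>; positivity excludes this unless
  \<open>z = 0\<close>.\<close>

lemma range_shift: "shift ` D = UNIV"
proof -
  have "y \<in> shift ` D" for y
  proof -
    let ?p = "oproj (shift ` D) y"
    define z where "z = y - ?p"
    have orth: "cinner (shift x) z = 0" if "x \<in> D" for x
      using oproj(2)[OF csubspace_range_shift closed_range_shift, of "shift x" y] that
      by (simp add: z_def cinner_eq_0_commute)
    have "adjoint_rel A z (- z)"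
      using orth by (simp add: adjoint_rel_def shift_def cinner.add_left cinner.minus_right eq_neg_iff_add_eq_0)
    then have "z \<in> D" "op z = - z" by (simp_all add: adjoint_iff)
    then have "(norm z)^2 \<le> 0"
      using op_nonneg[of z] by (simp add: cinner.minus_left Re_cinner_self)
    then have "y = ?p" by (simp add: z_def)
    then show ?thesis using oproj(1)[OF csubspace_range_shift closed_range_shift, of y] by simp
  qed
  then show ?thesis by blast
qed

definition T :: "'h \<Rightarrow> 'h" where "T = inv_into D shift"

lemma T_in: "T y \<in> D" unfolding T_def by (rule inv_into_into) (simp add: range_shift)
lemma shift_T: "shift (T y) = y" unfolding T_def by (rule f_inv_into_f) (simp add: range_shift)
lemma op_T: "op (T y) = y - T y" using shift_T[of y] by (simp add: shift_def algebra_simps)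
lemma T_shift: "x \<in> D \<Longrightarrow> T (shift x) = x"
  unfolding T_def by (rule inv_into_f_f[OF inj_on_shift])

lemma T_add: "T (x + y) = T x + T y"
  using T_shift[OF DD(2)[OF T_in T_in], of x y] by (simp add: shift_add T_in shift_T)

lemma T_scaleC: "T (c *\<^sub>C x) = c *\<^sub>C T x"
  using T_shift[OF DD(3)[OF T_in], of c x] by (simp add: shift_scaleC T_in shift_T)

lemma norm_T_le: "norm (T x) \<le> norm x"
  using norm_le_shift[OF T_in, of x] by (simp add: shift_T)

lemma bounded_linear_T: "bounded_linear T"
  by (rule bounded_linear_intro[of _ 1]) (simp_all add: T_add scaleR_scaleC T_scaleC norm_T_le)

lemma T_symmetric: "cinner (T x) y = cinner x (T y)"
proof -
  have "cinner (T x) (shift (T y)) = cinner (shift (T x)) (T y)"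
    by (simp add: shift_def cinner.add_left cinner.add_right op_symmetric[OF T_in T_in])
  then show ?thesis by (simp add: shift_T)
qed

lemma T_eq_0: "T x = 0 \<Longrightarrow> x = 0"
  using shift_T[of x] shift_diff[of 0 0] DD(1) by simp

text \<open>The compactness hypothesis concerns the resolvent at some unknown point
  \<open>c\<close>; the resolvent identity transfers it to the point -1.\<close>

lemma T_compact:
  assumes "bounded (range y)"
  shows "\<exists>l r. strict_mono (r :: nat \<Rightarrow> nat) \<and> (\<lambda>n. T (y (r n))) \<longlonglongrightarrow> l"
proof -
  obtain c where c: "c \<in> resolvent_set A" and comp: "\<And>B. bounded B \<Longrightarrow> compact (closure (resolvent A c ` B))"
    using compact by (auto simp: compact_resolvent_def)
  \<comment> \<open>This is (c - A) applied to \<open>T (y n)\<close>, so the resolvent at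
    \<open>c\<close> maps it back to \<open>T (y n)\<close>.\<close>
  define z where "z n = (c + 1) *\<^sub>C T (y n) - y n" for n
  have inj: "inj_on (\<lambda>x. c *\<^sub>C x - op x) D"
    using c by (auto simp: resolvent_set_def bij_betw_def)
  have res: "resolvent A c (z n) = T (y n)" for n
  proof -
    have "z n = c *\<^sub>C T (y n) - op (T (y n))"
      by (simp add: z_def op_T scaleC_add_left)
    then show ?thesis unfolding resolvent_def using inv_into_f_f[OF inj T_in] by simp
  qed
  obtain N where N: "\<And>n. norm (y n) \<le> N" using assms by (auto simp: bounded_iff)
  have "norm (z n) \<le> cmod (c + 1) * N + N" for n
  proof -
    have "norm (z n) \<le> norm ((c + 1) *\<^sub>C T (y n)) + norm (y n)"
      unfolding z_def by (rule norm_triangle_ineq4)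
    also have "\<dots> \<le> cmod (c + 1) * N + N"
      unfolding norm_scaleC using order_trans[OF norm_T_le N] N[of n] by (intro add_mono mult_left_mono) auto
    finally show ?thesis .
  qed
  then have "bounded (range z)" by (auto simp: bounded_iff)
  from comp[OF this] have sc: "seq_compact (closure (resolvent A c ` range z))"
    by (simp add: compact_eq_seq_compact_metric)
  have "\<forall>n. T (y n) \<in> closure (resolvent A c ` range z)"
    unfolding res[symmetric] by (intro allI subsetD[OF closure_subset]) auto
  then obtain l r where "strict_mono (r :: nat \<Rightarrow> nat)" "((\<lambda>n. T (y n)) \<circ> r) \<longlonglongrightarrow> l"
    by (rule seq_compactE[OF sc])
  then show ?thesis by (auto simp: o_def)
qed

text \<open>Let \<open>s\<close> be the norm of \<open>T\<close> on \<open>M\<close>. A sequence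
  maximising |T x| on the unit sphere consists of approximate eigenvectors of T^2 for s^2, and
  compactness makes a subsequence converge to a true one.\<close>

lemma T_eigenvector:
  assumes M: "csubspace M" "closed M" "\<And>x. x \<in> M \<Longrightarrow> T x \<in> M" and ne: "x0 \<in> M" "x0 \<noteq> 0"
  shows "\<exists>e\<in>M. \<exists>s. e \<noteq> 0 \<and> T e = s *\<^sub>R e"
proof -
  interpret T: bounded_linear T by (rule bounded_linear_T)
  note MD = csubspaceD[OF M(1)]
  define X where "X = {x \<in> M. norm x = 1}"
  define s where "s = Sup ((\<lambda>x. norm (T x)) ` X)"
  have "(1 / norm x0) *\<^sub>R x0 \<in> X" using ne MD(4) by (auto simp: X_def)
  then have Xne: "X \<noteq> {}" by blast
  have bdd: "bdd_above ((\<lambda>x. norm (T x)) ` X)"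
  proof (rule bdd_aboveI[of _ 1])
    fix v assume "v \<in> (\<lambda>x. norm (T x)) ` X"
    then obtain x where "v = norm (T x)" "norm x = 1" by (auto simp: X_def)
    then show "v \<le> 1" using norm_T_le[of x] by simp
  qed
  have le: "norm (T x) \<le> s" if "x \<in> X" for x
    unfolding s_def using that by (intro cSup_upper bdd) auto
  have le': "norm (T x) \<le> s * norm x" if x: "x \<in> M" for x
  proof (cases "x = 0")
    case False
    then have "(1 / norm x) *\<^sub>R x \<in> X" using x MD(4) by (auto simp: X_def)
    from le[OF this] show ?thesis using False by (simp add: T.scaleR field_simps)
  qed (simp add: T.zero)
  obtain x1 where x1: "x1 \<in> X" using Xne by blast
  have "0 < norm (T x1)" using x1 T_eq_0[of x1] by (auto simp: X_def)
  then have s: "0 < s" using le[OF x1] by linarith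
  have "\<exists>x. x \<in> X \<and> s - inverse (real (Suc n)) < norm (T x)" for n
  proof -
    have "s - inverse (real (Suc n)) < Sup ((\<lambda>x. norm (T x)) ` X)" by (simp add: s_def)
    then show ?thesis using less_cSup_iff[OF _ bdd] Xne by auto
  qed
  then have "\<forall>n. \<exists>x. x \<in> X \<and> s - inverse (real (Suc n)) < norm (T x)" ..
  from choice[OF this] obtain f where f: "\<And>n. f n \<in> X" "\<And>n. s - inverse (real (Suc n)) < norm (T (f n))" by auto
  have fM: "f n \<in> M" "norm (f n) = 1" for n using f(1)[of n] by (auto simp: X_def)
  have lim: "(\<lambda>n. norm (T (f n))) \<longlonglongrightarrow> s"
  proof (rule tendsto_sandwich)
    show "(\<lambda>n. s - inverse (real (Suc n))) \<longlonglongrightarrow> s"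
      using tendsto_diff[OF tendsto_const LIMSEQ_inverse_real_of_nat, of s] by simp
    show "\<forall>\<^sub>F n in sequentially. s - inverse (real (Suc n)) \<le> norm (T (f n))"
      by (intro always_eventually allI less_imp_le f(2))
    show "\<forall>\<^sub>F n in sequentially. norm (T (f n)) \<le> s"
      by (intro always_eventually allI le f(1))
  qed auto
  \<comment> \<open>Expand the square; symmetry gives the mixed term s^2 |T f|^2, and |T (T f)|
    \<le> s |T f|.\<close>
  have sq: "(norm (T (T (f n)) - s^2 *\<^sub>R f n))^2 \<le> s^2 * (s^2 - (norm (T (f n)))^2)" for n
  proof -
    have "(norm (T (T (f n))))^2 \<le> (s * norm (T (f n)))^2"
      using le'[OF M(3)[OF fM(1)], of n] by (intro power_mono) auto
    moreover have "Re (cinner (T (T (f n))) (s^2 *\<^sub>R f n)) = s^2 * (norm (T (f n)))^2"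
      by (simp add: T_symmetric[of "T (f n)"] cinner_scaleR_right T.scaleR Re_cinner_self)
    ultimately show ?thesis
      unfolding norm_diff_square by (simp add: fM power_mult_distrib algebra_simps)
  qed
  have "(\<lambda>n. s^2 * (s^2 - (norm (T (f n)))^2)) \<longlonglongrightarrow> s^2 * (s^2 - s^2)"
    by (intro tendsto_intros lim)
  then have "(\<lambda>n. s^2 * (s^2 - (norm (T (f n)))^2)) \<longlonglongrightarrow> 0" by simp
  then have "(\<lambda>n. (norm (T (T (f n)) - s^2 *\<^sub>R f n))^2) \<longlonglongrightarrow> 0"
    by (rule tendsto_sandwich[rotated 2, OF tendsto_const]) (use sq in \<open>auto intro!: always_eventually\<close>)
  then have "(\<lambda>n. sqrt ((norm (T (T (f n)) - s^2 *\<^sub>R f n))^2)) \<longlonglongrightarrow> sqrt 0"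
    by (rule tendsto_real_sqrt)
  then have small: "(\<lambda>n. T (T (f n)) - s^2 *\<^sub>R f n) \<longlonglongrightarrow> 0"
    by (simp add: tendsto_norm_zero_iff)
  have "bounded (range f)" using fM(2) by (auto simp: bounded_iff)
  from T_compact[OF this] obtain y r where r: "strict_mono (r :: nat \<Rightarrow> nat)" "(\<lambda>n. T (f (r n))) \<longlonglongrightarrow> y"
    by auto
  have TT: "(\<lambda>n. T (T (f (r n)))) \<longlonglongrightarrow> T y"
    by (rule T.tendsto[OF r(2)])
  have "(\<lambda>n. T (T (f (r n))) - s^2 *\<^sub>R f (r n)) \<longlonglongrightarrow> 0"
    using LIMSEQ_subseq_LIMSEQ[OF small r(1)] by (simp add: o_def)
  from tendsto_diff[OF TT this] have "(\<lambda>n. s^2 *\<^sub>R f (r n)) \<longlonglongrightarrow> T y" by simp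
  then have "(\<lambda>n. (1 / s^2) *\<^sub>R s^2 *\<^sub>R f (r n)) \<longlonglongrightarrow> (1 / s^2) *\<^sub>R T y"
    by (intro tendsto_scaleR tendsto_const)
  then have fx: "(\<lambda>n. f (r n)) \<longlonglongrightarrow> (1 / s^2) *\<^sub>R T y" using s by simp
  define x where "x = (1 / s^2) *\<^sub>R T y"
  note fx = fx[folded x_def]
  have xM: "x \<in> M" using closed_sequentially[OF M(2) _ fx] fM(1) by simp
  have "(\<lambda>n. norm (f (r n))) \<longlonglongrightarrow> norm x" by (intro tendsto_norm fx)
  then have nx: "norm x = 1" using fM(2) by (simp add: LIMSEQ_const_iff)
  have "(\<lambda>n. T (f (r n))) \<longlonglongrightarrow> T x" by (rule T.tendsto[OF fx])
  then have "y = T x" by (rule LIMSEQ_unique[OF r(2)])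
  then have TTx: "T (T x) = s^2 *\<^sub>R x" using s by (simp add: x_def)
  show ?thesis
  \<comment> \<open>T^2 - s^2 = (T - s)(T + s): either \<open>x\<close> or \<open>T x + s x\<close>
    is an eigenvector of \<open>T\<close>.\<close>
  proof (cases "T x + s *\<^sub>R x = 0")
    case True
    then have "T x = (- s) *\<^sub>R x" by (simp add: eq_neg_iff_add_eq_0)
    then show ?thesis using xM nx by (intro bexI[of _ x] exI[of _ "- s"]) auto
  next
    case False
    have "T (T x + s *\<^sub>R x) = s *\<^sub>R (T x + s *\<^sub>R x)"
      by (simp add: T.add T.scaleR TTx power2_eq_square algebra_simps)
    then show ?thesis using False xM MD M(3) by (intro bexI[of _ "T x + s *\<^sub>R x"]) auto
  qed
qed

section \<open>Eigenspaces and the spectral expansion\<close>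

abbreviation "eig \<equiv> eigenspace A"

lemma eig_iff: "x \<in> eig l \<longleftrightarrow> x \<in> D \<and> op x = l *\<^sub>R x"
  by (simp add: eigenspace_def)

lemma csubspace_eig: "csubspace (eig l)"
  unfolding csubspace_def
proof (intro conjI ballI allI)
  show "0 \<in> eig l" using DD(1) op_diff[of 0 0] by (simp add: eig_iff)
qed (auto simp: eig_iff op_add op_scaleC scaleR_add_right scaleC_scaleR DD(2,3))

lemmas eigD = csubspaceD[OF csubspace_eig]

lemma closed_eig: "closed (eig l)"
  unfolding closed_sequential_limits
proof (intro allI impI, elim conjE)
  fix f x assume f: "\<forall>n. f n \<in> eig l" "f \<longlonglongrightarrow> x"
  have "(\<lambda>n. op (f n)) = (\<lambda>n. l *\<^sub>R f n)" using f(1) by (simp add: eig_iff)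
  then have "(\<lambda>n. op (f n)) \<longlonglongrightarrow> l *\<^sub>R x" using f(2) by (auto intro: tendsto_intros)
  then show "x \<in> eig l" unfolding eig_iff using f by (intro op_closed[of f]) (auto simp: eig_iff)
qed

lemma eig_nonpos: assumes "x \<in> eig l" "l \<le> 0" shows "x = 0"
proof (rule ccontr)
  assume "x \<noteq> 0"
  then have "0 < Re (cinner (op x) x)" using positive assms by (auto simp: positive_definite_def eig_iff)
  also have "\<dots> = l * (norm x)^2" using assms by (simp add: eig_iff cinner_scaleR_left Re_cinner_self)
  also have "\<dots> \<le> 0" using assms by (intro mult_nonpos_nonneg) auto
  finally show False by simp
qed

lemma eig_orthogonal: assumes "x \<in> eig l" "y \<in> eig l'" "l \<noteq> l'" shows "cinner x y = 0"
proof -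
  have "cinner (op x) y = cinner x (op y)" using assms by (intro op_symmetric) (auto simp: eig_iff)
  then have "(l - l') *\<^sub>R cinner x y = 0"
    using assms by (simp add: eig_iff cinner_scaleR_left cinner_scaleR_right scaleR_left_diff_distrib)
  then show ?thesis using assms by simp
qed

text \<open>The complement of all eigenspaces is \<open>T\<close>-invariant. Were it nonzero, it
  would contain an eigenvector of \<open>T\<close>, which is also one of A, with eigenvalue 1/s -
  1.\<close>

lemma eig_complete:
  assumes "\<And>l z. z \<in> eig l \<Longrightarrow> cinner x z = 0"
  shows "x = 0"
proof (rule ccontr)
  assume x: "x \<noteq> 0"
  define M where "M = (\<Inter>l. {x. \<forall>z\<in>eig l. cinner x z = 0})"
  have M: "csubspace M" "closed M"
    unfolding M_def
    by (auto simp: csubspace_def cinner.add_left cinner_scaleC_left intro!: closed_INT closed_orthogonal)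
  have TM: "T v \<in> M" if v: "v \<in> M" for v
  proof -
    have "cinner (T v) z = 0" if z: "z \<in> eig l" for l z
    proof (cases "z = 0")
      case False
      then have l: "0 < l" using eig_nonpos[OF z] by force
      have "shift z = (l + 1) *\<^sub>R z" using z by (simp add: shift_def eig_iff algebra_simps)
      then have "z = T ((l + 1) *\<^sub>R z)" using T_shift[of z] z by (simp add: eig_iff)
      also have "\<dots> = (l + 1) *\<^sub>R T z" by (simp add: scaleR_scaleC T_scaleC)
      finally have "cinner v z = cinner v ((l + 1) *\<^sub>R T z)" by (rule arg_cong)
      moreover have "cinner v z = 0" using v z by (auto simp: M_def)
      ultimately show ?thesis using l by (simp add: T_symmetric cinner_scaleR_right)
    qed simp
    then show ?thesis by (auto simp: M_def)
  qed
  have "x \<in> M" using assms by (auto simp: M_def)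
  from T_eigenvector[OF M TM this x] obtain e s where e: "e \<in> M" "e \<noteq> 0" "T e = s *\<^sub>R e" by auto
  have s: "s \<noteq> 0" using e T_eq_0[of e] by auto
  have eD: "e \<in> D" using DD(4)[OF T_in, of "1 / s" e] e(3) s by simp
  have "e = shift (s *\<^sub>R e)" using shift_T[of e] e(3) by simp
  also have "\<dots> = s *\<^sub>R shift e" using shift_scaleC[OF eD] by (simp add: scaleR_scaleC)
  finally have "(1 / s) *\<^sub>R e = (1 / s) *\<^sub>R s *\<^sub>R shift e" by (rule arg_cong)
  then have "(1 / s) *\<^sub>R e = shift e" using s by simp
  then have "op e = (1 / s - 1) *\<^sub>R e" by (simp add: shift_def scaleR_left_diff_distrib algebra_simps)
  then have "e \<in> eig (1 / s - 1)" using eD by (simp add: eig_iff)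
  then have "cinner e e = 0" using e(1) by (auto simp: M_def)
  then show False using e(2) by (simp add: cinner_self)
qed

text \<open>Eigenvalues tending to 0 would give unit eigenvectors f with A f tending to 0. As f =
  \<open>T (shift f)\<close>, a subsequence converges, and its limit is a unit vector in the kernel,
  against positivity.\<close>

lemma spectral_gap: "\<exists>l0>0. \<forall>l x. x \<in> eig l \<longrightarrow> x \<noteq> 0 \<longrightarrow> l0 \<le> l"
proof (rule ccontr)
  assume neg: "\<not> ?thesis"
  define P where "P n x \<longleftrightarrow> (\<exists>l. x \<in> eig l \<and> norm x = 1 \<and> 0 < l \<and> l < inverse (real (Suc n)))" for n :: nat and x
  have "\<exists>x. \<exists>l. x \<in> eig l \<and> norm x = 1 \<and> 0 < l \<and> l < inverse (real (Suc n))" for n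
  proof -
    have "0 < inverse (real (Suc n))" by simp
    then obtain l x where lx: "x \<in> eig l" "x \<noteq> 0" "l < inverse (real (Suc n))"
      using neg not_le by blast
    have "(1 / norm x) *\<^sub>R x \<in> eig l" by (intro eigD(4) lx)
    moreover have "norm ((1 / norm x) *\<^sub>R x) = 1" using lx by simp
    moreover have "0 < l" using eig_nonpos[OF lx(1)] lx(2) by force
    ultimately show ?thesis using lx(3) by blast
  qed
  then have "\<forall>n. \<exists>x. P n x" unfolding P_def ..
  from choice[OF this] obtain f where f: "\<And>n. P n (f n)" by auto
  have fn: "norm (f n) = 1" "f n \<in> D" "norm (op (f n)) \<le> inverse (real (Suc n))" for n
  proof -
    obtain l where "f n \<in> eig l \<and> norm (f n) = 1 \<and> 0 < l \<and> l < inverse (real (Suc n))" using f[of n] unfolding P_def ..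
    then show "norm (f n) = 1" "f n \<in> D" "norm (op (f n)) \<le> inverse (real (Suc n))" by (auto simp: eig_iff)
  qed
  have op0: "(\<lambda>n. op (f n)) \<longlonglongrightarrow> 0"
  proof (rule Lim_null_comparison[OF _ LIMSEQ_inverse_real_of_nat])
    show "\<forall>\<^sub>F n in sequentially. norm (op (f n)) \<le> inverse (real (Suc n))" by (intro always_eventually allI fn(3))
  qed
  have "norm (shift (f n)) \<le> 2" for n
  proof -
    have "inverse (real (Suc n)) \<le> 1" by (simp add: inverse_le_1_iff)
    then show ?thesis unfolding shift_def using norm_triangle_ineq[of "op (f n)" "f n"] fn[of n] by linarith
  qed
  then have "bounded (range (\<lambda>n. shift (f n)))" by (auto simp: bounded_iff)
  from T_compact[OF this] obtain x r where r: "strict_mono (r :: nat \<Rightarrow> nat)" "(\<lambda>n. T (shift (f (r n)))) \<longlonglongrightarrow> x" by auto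
  then have lim: "(\<lambda>n. f (r n)) \<longlonglongrightarrow> x" using T_shift[OF fn(2)] by simp
  have "x \<in> D \<and> op x = 0"
    using LIMSEQ_subseq_LIMSEQ[OF op0 r(1)] by (intro op_closed[OF fn(2) lim]) (simp add: o_def)
  then have "x \<in> eig 0" by (simp add: eig_iff)
  then have "x = 0" by (rule eig_nonpos) simp
  moreover have "(\<lambda>n. norm (f (r n))) \<longlonglongrightarrow> norm x" by (intro tendsto_norm lim)
  then have "norm x = 1" using fn(1) by (simp add: LIMSEQ_const_iff)
  ultimately show False by simp
qed

lemma eigen_proj_eq: "eigen_proj A l = oproj (eig l)"
  by (simp add: eigen_proj_def oproj_def fun_eq_iff)

lemma comps_in: "comps A x l \<in> eig l"
  unfolding comps_def eigen_proj_eq by (rule oproj(1)[OF csubspace_eig closed_eig])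

lemma comps_orth: "z \<in> eig l \<Longrightarrow> cinner (x - comps A x l) z = 0"
  unfolding comps_def eigen_proj_eq by (rule oproj(2)[OF csubspace_eig closed_eig])

lemma comps_eqI: "y \<in> eig l \<Longrightarrow> (\<And>z. z \<in> eig l \<Longrightarrow> cinner (x - y) z = 0) \<Longrightarrow> comps A x l = y"
  unfolding comps_def eigen_proj_eq by (rule oproj_unique[OF csubspace_eig])

lemma bounded_linear_comps: "bounded_linear (\<lambda>x. comps A x l)"
  unfolding comps_def eigen_proj_eq by (rule bounded_linear_oproj[OF csubspace_eig closed_eig])

lemma norm_sum_eig:
  assumes "finite F" "\<And>l. w l \<in> eig l"
  shows "(norm (\<Sum>l\<in>F. w l))^2 = (\<Sum>l\<in>F. (norm (w l))^2)"
  using assms(1)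
proof induction
  case (insert j F)
  have "cinner (w j) (\<Sum>l\<in>F. w l) = (\<Sum>l\<in>F. cinner (w j) (w l))" by (rule cinner.sum_right)
  also have "\<dots> = 0" using insert(2) by (intro sum.neutral ballI eig_orthogonal[OF assms(2) assms(2)]) auto
  finally show ?case using insert by (simp add: norm_add_square)
qed simp

text \<open>Norms of the terms need not be summable, so the Cauchy property is taken from
  Pythagoras: tails of the orthogonal sum are tails of the sum of squares.\<close>

lemma summable_eig:
  assumes w: "\<And>l. w l \<in> eig l" and s: "(\<lambda>l. (norm (w l))^2) summable_on UNIV"
  shows "w summable_on UNIV"
proof -
  define S where "S F = (\<Sum>l\<in>F. (norm (w l))^2)" for F
  define L where "L = infsum (\<lambda>l. (norm (w l))^2) UNIV"
  have SL: "S F \<le> L" if "finite F" for F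
    unfolding S_def L_def using that by (intro finite_sum_le_infsum s) auto
  have "cauchy_filter (filtermap (sum w) (finite_subsets_at_top UNIV))"
    unfolding cauchy_filter_metric_filtermap
  proof (intro allI impI)
    fix e :: real assume e: "0 < e"
    have "(S \<longlongrightarrow> L) (finite_subsets_at_top UNIV)"
      unfolding S_def[abs_def] L_def using has_sum_infsum[OF s] by (simp add: has_sum_def)
    then have "\<forall>\<^sub>F F in finite_subsets_at_top UNIV. L - (e / 2)^2 < S F"
      using e by (intro order_tendstoD(1)) auto
    then obtain F0 where F0: "finite F0" "\<And>F. finite F \<Longrightarrow> F0 \<subseteq> F \<Longrightarrow> L - (e / 2)^2 < S F"
      by (auto simp: eventually_finite_subsets_at_top)
    \<comment> \<open>Pythagoras compares nested index sets only; two arbitrary sets are compared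
      through their union, at the cost of a factor 2.\<close>
    have near: "dist (sum w F) (sum w G) < e / 2" if "finite F" "F0 \<subseteq> F" "finite G" "F \<subseteq> G" for F G
    proof -
      have "sum w G - sum w F = sum w (G - F)" using that by (subst sum_diff) auto
      then have "dist (sum w F) (sum w G) = norm (sum w (G - F))"
        by (metis dist_commute dist_norm)
      then have "(dist (sum w F) (sum w G))^2 = S (G - F)"
        using norm_sum_eig[of "G - F" w] w that(3) by (simp add: S_def)
      also have "\<dots> = S G - S F" unfolding S_def using that by (subst sum_diff) auto
      also have "\<dots> < (e / 2)^2" using F0(2)[OF that(1,2)] SL[OF that(3)] by simp
      finally show ?thesis by (rule power2_less_imp_less) (use e in simp)
    qed
    show "\<exists>P. eventually P (finite_subsets_at_top UNIV) \<and> (\<forall>x y. P x \<and> P y \<longrightarrow> dist (sum w x) (sum w y) < e)"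
    proof (intro exI conjI allI impI)
      show "\<forall>\<^sub>F F in finite_subsets_at_top UNIV. finite F \<and> F0 \<subseteq> F"
        unfolding eventually_finite_subsets_at_top using F0(1) by auto
      fix F G assume FG: "(finite F \<and> F0 \<subseteq> F) \<and> finite G \<and> F0 \<subseteq> G"
      then have "dist (sum w F) (sum w (F \<union> G)) < e / 2" "dist (sum w G) (sum w (F \<union> G)) < e / 2"
        using near[of F "F \<union> G"] near[of G "F \<union> G"] by auto
      then show "dist (sum w F) (sum w G) < e"
        using dist_triangle2[of "sum w F" "sum w G" "sum w (F \<union> G)"] by linarith
    qed
  qed
  moreover have "complete (UNIV :: 'h set)"
    by (meson Cauchy_convergent UNIV_I complete_def convergent_def)
  ultimately obtain L' where "(sum w \<longlongrightarrow> L') (finite_subsets_at_top UNIV)"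
    using complete_uniform[where S=UNIV] by (force simp add: filterlim_def)
  then show ?thesis by (auto simp: summable_on_def has_sum_def)
qed

lemma has_sum_norm_eig:
  assumes w: "\<And>l. w l \<in> eig l" and x: "(w has_sum x) UNIV"
  shows "((\<lambda>l. (norm (w l))^2) has_sum (norm x)^2) UNIV"
proof -
  have "((\<lambda>F. (norm (sum w F))^2) \<longlongrightarrow> (norm x)^2) (finite_subsets_at_top UNIV)"
    using x unfolding has_sum_def by (intro tendsto_intros)
  moreover have "\<forall>\<^sub>F F in finite_subsets_at_top UNIV. (norm (sum w F))^2 = (\<Sum>l\<in>F. (norm (w l))^2)"
    using w by (intro eventually_finite_subsets_at_top_weakI norm_sum_eig)
  ultimately show ?thesis unfolding has_sum_def by (rule Lim_transform_eventually)
qed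

lemma comps_has_sum:
  assumes w: "\<And>l. w l \<in> eig l" and x: "(w has_sum x) UNIV"
  shows "comps A x = w"
proof
  fix l
  show "comps A x l = w l"
  proof (rule comps_eqI[OF w])
    fix z assume z: "z \<in> eig l"
    have "((\<lambda>j. cinner (w j) z) has_sum cinner x z) UNIV"
      by (rule has_sum_bounded_linear[OF cinner.bounded_linear_left x])
    moreover have "((\<lambda>j. cinner (w j) z) has_sum cinner (w l) z) UNIV"
      using eig_orthogonal[OF w z] by (intro has_sum_finite_neutralI[of "{l}"]) auto
    ultimately have "cinner x z = cinner (w l) z" by (rule has_sum_unique)
    then show "cinner (x - w l) z = 0" by (simp add: cinner.diff_left)
  qed
qed

text \<open>Bessel's inequality makes the expansion converge to some \<open>y\<close>;
  \<open>x - y\<close> is orthogonal to all eigenspaces and hence 0 by completeness.\<close>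

lemma spectral_expansion: "(comps A x has_sum x) UNIV"
proof -
  have "(\<lambda>l. (norm (comps A x l))^2) summable_on UNIV"
  proof (rule nonneg_bounded_partial_sums_imp_summable_on[where C = "(norm x)^2"])
    show "\<forall>\<^sub>F F in finite_subsets_at_top UNIV. (\<Sum>l\<in>F. (norm (comps A x l))^2) \<le> (norm x)^2"
    proof (intro eventually_finite_subsets_at_top_weakI)
      fix F :: "real set" assume F: "finite F"
      let ?y = "\<Sum>l\<in>F. comps A x l"
      have "cinner x (comps A x l) = cinner (comps A x l) (comps A x l)" for l
        using comps_orth[OF comps_in[of x l], of x] by (simp add: cinner.diff_left)
      then have "cinner x ?y = (\<Sum>l\<in>F. of_real ((norm (comps A x l))^2))"
        unfolding cinner.sum_right by (simp only: cinner_self)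
      also have "\<dots> = complex_of_real ((norm ?y)^2)"
        unfolding norm_sum_eig[of F "comps A x", OF F comps_in] by simp
      finally have "(norm (x - ?y))^2 = (norm x)^2 - (norm ?y)^2"
        by (simp add: norm_diff_square del: of_real_power)
      then show "(\<Sum>l\<in>F. (norm (comps A x l))^2) \<le> (norm x)^2"
        using norm_sum_eig[of F "comps A x", OF F comps_in] zero_le_power2[of "norm (x - ?y)"] by linarith
    qed
  qed auto
  from summable_eig[OF comps_in this] obtain y where y: "(comps A x has_sum y) UNIV"
    by (auto simp: summable_on_def)
  have "comps A y = comps A x" by (rule comps_has_sum[OF comps_in y])
  then have "cinner (x - y) z = 0" if "z \<in> eig l" for l z
    using comps_orth[OF that, of x] comps_orth[OF that, of y] by (simp add: cinner.diff_left)
  then have "x - y = 0" by (rule eig_complete)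
  then show ?thesis using y by simp
qed

lemma parseval: "((\<lambda>l. (norm (comps A x l))^2) has_sum (norm x)^2) UNIV"
  by (rule has_sum_norm_eig[OF comps_in spectral_expansion])

lemma vec_of_comps: "vec_of (comps A x) = x"
  unfolding vec_of_def using spectral_expansion by (rule infsumI)

lemma comps_vec_of:
  assumes "\<And>l. w l \<in> eig l" "(\<lambda>l. (norm (w l))^2) summable_on UNIV"
  shows "comps A (vec_of w) = w"
proof -
  have "(w has_sum vec_of w) UNIV"
    unfolding vec_of_def by (rule has_sum_infsum[OF summable_eig[OF assms]])
  with assms(1) show ?thesis by (rule comps_has_sum)
qed

end

section \<open>Orbits of a contraction semigroup\<close>

text \<open>Of \<open>N\<close> itself only nonnegativity is assumed, so orbits are studied through
  linear maps \<open>L\<close> into a normed space that are dominated by \<open>N\<close>. The modal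
  coordinates will be such maps.\<close>

locale contraction_semigroup =
  fixes X :: "'a::complex_vector set" and N :: "'a \<Rightarrow> real" and S :: "real \<Rightarrow> 'a \<Rightarrow> 'a" and G :: "'a unbounded_op"
  assumes sg: "c0_contraction_semigroup X N S" and gen: "is_generator X N S G"
    and N_nonneg: "\<And>x. 0 \<le> N x"
begin

lemma S_in: "0 \<le> t \<Longrightarrow> x \<in> X \<Longrightarrow> S t x \<in> X"
  and S_add: "0 \<le> t \<Longrightarrow> x \<in> X \<Longrightarrow> y \<in> X \<Longrightarrow> S t (x + y) = S t x + S t y"
  and S_scaleC: "0 \<le> t \<Longrightarrow> x \<in> X \<Longrightarrow> S t (c *\<^sub>C x) = c *\<^sub>C S t x"
  and S_plus: "0 \<le> s \<Longrightarrow> 0 \<le> t \<Longrightarrow> x \<in> X \<Longrightarrow> S (s + t) x = S s (S t x)"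
  and S_cont: "x \<in> X \<Longrightarrow> ((\<lambda>t. N (S t x - x)) \<longlongrightarrow> 0) (at_right 0)"
  and S_contr: "0 \<le> t \<Longrightarrow> x \<in> X \<Longrightarrow> N (S t x) \<le> N x"
  using sg by (auto simp: c0_contraction_semigroup_def clinear_on_def image_subset_iff)

lemma csubspace_X: "csubspace X"
  using sg by (auto simp: c0_contraction_semigroup_def clinear_on_def)

lemmas XD = csubspaceD[OF csubspace_X]

lemma S_scaleR: "0 \<le> t \<Longrightarrow> x \<in> X \<Longrightarrow> S t (r *\<^sub>R x) = r *\<^sub>R S t x"
  by (simp add: scaleR_scaleC S_scaleC)

lemma S_diff: "0 \<le> t \<Longrightarrow> x \<in> X \<Longrightarrow> y \<in> X \<Longrightarrow> S t (x - y) = S t x - S t y"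
  using S_add[of t "x - y" y] XD(6)[of x y] by simp

lemma dom_iff: "x \<in> X \<Longrightarrow> y \<in> X \<Longrightarrow> x \<in> op_dom G \<and> op_app G x = y \<longleftrightarrow>
    ((\<lambda>t. N ((1 / t) *\<^sub>R (S t x - x) - y)) \<longlongrightarrow> 0) (at_right 0)"
  using gen by (simp add: is_generator_def)

lemma dom_in: "z \<in> op_dom G \<Longrightarrow> z \<in> X" "z \<in> op_dom G \<Longrightarrow> op_app G z \<in> X"
  using gen by (auto simp: is_generator_def)

abbreviation "dq h z \<equiv> (1 / h) *\<^sub>R (S h z - z) - op_app G z"

lemma quotient_limit:
  assumes z: "z \<in> op_dom G"
  shows "((\<lambda>t. N (dq t z)) \<longlongrightarrow> 0) (at_right 0)"
  using dom_iff[OF dom_in[OF z]] z by simp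

lemma S_quotient:
  assumes z: "z \<in> op_dom G" and t: "0 \<le> t" and h: "0 < h"
  shows "S t (dq h z) = (1 / h) *\<^sub>R (S (t + h) z - S t z) - S t (op_app G z)"
    and "dq h z \<in> X"
proof -
  note zX = dom_in[OF z]
  have Sh: "S h z \<in> X" using h zX by (simp add: S_in)
  show "dq h z \<in> X"
    by (intro XD(6) XD(4) Sh zX)
  have "S t (dq h z) = (1 / h) *\<^sub>R (S t (S h z) - S t z) - S t (op_app G z)"
    by (simp add: S_diff S_scaleR t zX Sh XD(4,6))
  then show "S t (dq h z) = (1 / h) *\<^sub>R (S (t + h) z - S t z) - S t (op_app G z)"
    using S_plus[OF t _ zX(1), of h] h by simp
qed

text \<open>\<open>S t\<close> maps the defect of the difference quotient at \<open>z\<close> to the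
  one at \<open>S t z\<close>, and contractivity squeezes the latter.\<close>

lemma generator_commute:
  assumes z: "z \<in> op_dom G" and t: "0 \<le> t"
  shows "S t z \<in> op_dom G \<and> op_app G (S t z) = S t (op_app G z)"
proof -
  note zX = dom_in[OF z]
  have "((\<lambda>h. N ((1 / h) *\<^sub>R (S h (S t z) - S t z) - S t (op_app G z))) \<longlongrightarrow> 0) (at_right 0)"
  proof (rule tendsto_sandwich[OF _ _ tendsto_const quotient_limit[OF z]])
    show "\<forall>\<^sub>F h in at_right 0. N ((1 / h) *\<^sub>R (S h (S t z) - S t z) - S t (op_app G z))
        \<le> N (dq h z)"
      unfolding eventually_at_right_field
    proof (intro exI[of _ 1] conjI allI impI)
      fix h :: real assume h: "0 < h"
      have "S h (S t z) = S (t + h) z"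
        using S_plus[of h t z] h t zX(1) by (simp add: add.commute)
      then show "N ((1 / h) *\<^sub>R (S h (S t z) - S t z) - S t (op_app G z))
        \<le> N (dq h z)"
        using S_contr[OF t S_quotient(2)[OF z t h]] S_quotient(1)[OF z t h] by simp
    qed simp
  qed (simp add: N_nonneg)
  then show ?thesis using dom_iff[of "S t z" "S t (op_app G z)"] S_in[OF t] zX by simp
qed

lemma orbit_continuous_0:
  fixes L :: "'a \<Rightarrow> 'b::real_normed_vector"
  assumes L: "\<And>x y. L (x - y) = L x - L y" "\<And>x. x \<in> X \<Longrightarrow> norm (L x) \<le> N x" and x: "x \<in> X"
  shows "((\<lambda>t. L (S t x)) \<longlongrightarrow> L x) (at_right 0)"
proof (rule Lim_null[THEN iffD2], rule Lim_null_comparison[OF _ S_cont[OF x]])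
  show "\<forall>\<^sub>F t in at_right 0. norm (L (S t x) - L x) \<le> N (S t x - x)"
    unfolding eventually_at_right_field
  proof (intro exI[of _ 1] conjI allI impI)
    fix t :: real assume "0 < t"
    then have "S t x - x \<in> X" by (intro XD(6) S_in x) simp
    then show "norm (L (S t x) - L x) \<le> N (S t x - x)" using L(2) by (simp add: L(1)[symmetric])
  qed simp
qed

text \<open>The generator gives right limits at time 0 only. For the left derivative at
  \<open>t\<close> the quotient is based at the earlier time \<open>t'\<close>; this works because
  contractivity makes the estimates uniform in the base point.\<close>

lemma orbit_derivative:
  fixes L :: "'a \<Rightarrow> 'b::real_normed_vector"
  assumes L: "\<And>x y. L (x - y) = L x - L y" "\<And>r x. L (r *\<^sub>R x) = r *\<^sub>R L x" "\<And>x. x \<in> X \<Longrightarrow> norm (L x) \<le> N x"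
    and z: "z \<in> op_dom G" and t: "0 < t"
  shows "((\<lambda>t. L (S t z)) has_vector_derivative L (S t (op_app G z))) (at t)"
  unfolding has_vector_derivative_def has_derivative_at'
proof (intro conjI allI impI bounded_linear_scaleR_left)
  note zX = dom_in[OF z]
  let ?y = "op_app G z"
  fix e :: real assume e: "0 < e"
  have "\<forall>\<^sub>F h in at_right 0. N (dq h z) < e / 4 \<and> N (S h ?y - ?y) < e / 4"
    using e by (intro eventually_conj order_tendstoD(2)[OF quotient_limit[OF z]] order_tendstoD(2)[OF S_cont[OF zX(2)]]) auto
  then obtain d where d: "0 < d" "\<And>h. 0 < h \<Longrightarrow> h < d \<Longrightarrow> N (dq h z) < e / 4 \<and> N (S h ?y - ?y) < e / 4"
    unfolding eventually_at_right_field by auto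
  show "\<exists>d>0. \<forall>t'. 0 < norm (t' - t) \<and> norm (t' - t) < d \<longrightarrow>
      norm (L (S t' z) - L (S t z) - (t' - t) *\<^sub>R L (S t ?y)) / norm (t' - t) < e"
  proof (intro exI[of _ "min d t"] conjI allI impI)
    fix t' assume "0 < norm (t' - t) \<and> norm (t' - t) < min d t"
    then have ne: "t' \<noteq> t" and lt: "\<bar>t' - t\<bar> < d" and pos: "0 < t'" by auto
    define h where "h = \<bar>t' - t\<bar>"
    have h: "0 < h" "h < d" using ne lt by (auto simp: h_def)
    \<comment> \<open>Two errors at an arbitrary base point \<open>s\<close>: that of the difference
      quotient, and that of replacing the derivative at \<open>s\<close> by the one at
      \<open>s + h\<close>. The right quotient needs only the former, the left one both.\<close>
    have key: "norm (L (S s z) - L (S (s + h) z) + h *\<^sub>R L (S s ?y)) \<le> h * (e / 4)" "norm (L (S s ?y) - L (S (s + h) ?y)) \<le> e / 4"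
      if s: "0 \<le> s" for s
    proof -
      have "norm (L (S s (dq h z))) \<le> N (S s (dq h z))"
        by (intro L(3) S_in s S_quotient(2)[OF z s h(1)])
      also have "\<dots> \<le> N (dq h z)" by (intro S_contr s S_quotient(2)[OF z s h(1)])
      also have "\<dots> \<le> e / 4" using d(2)[OF h] by simp
      finally have "norm ((1 / h) *\<^sub>R (L (S (s + h) z) - L (S s z)) - L (S s ?y)) \<le> e / 4"
        unfolding S_quotient(1)[OF z s h(1)] by (simp add: L(1,2))
      then have "h * norm ((1 / h) *\<^sub>R (L (S (s + h) z) - L (S s z)) - L (S s ?y)) \<le> h * (e / 4)"
        using h by (intro mult_left_mono) auto
      moreover have "h * norm ((1 / h) *\<^sub>R (L (S (s + h) z) - L (S s z)) - L (S s ?y)) =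
          norm (h *\<^sub>R ((1 / h) *\<^sub>R (L (S (s + h) z) - L (S s z)) - L (S s ?y)))" using h by simp
      moreover have "h *\<^sub>R ((1 / h) *\<^sub>R (L (S (s + h) z) - L (S s z)) - L (S s ?y)) = - (L (S s z) - L (S (s + h) z) + h *\<^sub>R L (S s ?y))"
        using h by (simp add: scaleR_diff_right)
      ultimately show "norm (L (S s z) - L (S (s + h) z) + h *\<^sub>R L (S s ?y)) \<le> h * (e / 4)"
        by (simp only: norm_minus_cancel)
      have Sh: "S h ?y - ?y \<in> X" by (intro XD(6) S_in zX) (use h in simp)
      have "S (s + h) ?y - S s ?y = S s (S h ?y - ?y)"
        using S_plus[of s h ?y] s h zX S_in[of h ?y] by (simp add: S_diff)
      then have "norm (L (S (s + h) ?y) - L (S s ?y)) \<le> N (S s (S h ?y - ?y))"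
        using L(3)[OF S_in[OF s Sh]] by (simp add: L(1)[symmetric])
      also have "\<dots> \<le> N (S h ?y - ?y)" by (intro S_contr s Sh)
      also have "\<dots> \<le> e / 4" using d(2)[OF h] by simp
      finally show "norm (L (S s ?y) - L (S (s + h) ?y)) \<le> e / 4" by (simp add: norm_minus_commute)
    qed
    have "norm (L (S t' z) - L (S t z) - (t' - t) *\<^sub>R L (S t ?y)) \<le> h * (e / 4) + h * (e / 4)"
    proof (cases "t < t'")
      case True
      then have t': "t' = t + h" by (simp add: h_def)
      have "norm (L (S t' z) - L (S t z) - (t' - t) *\<^sub>R L (S t ?y)) = norm (L (S t z) - L (S (t + h) z) + h *\<^sub>R L (S t ?y))"
        unfolding t' by (subst norm_minus_cancel[symmetric]) (simp add: algebra_simps)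
      also have "\<dots> \<le> h * (e / 4)" using t by (intro key) simp
      also have "\<dots> \<le> h * (e / 4) + h * (e / 4)" using h e by simp
      finally show ?thesis .
    next
      case False
      then have t': "t = t' + h" using ne by (simp add: h_def)
      have "L (S t' z) - L (S t z) - (t' - t) *\<^sub>R L (S t ?y) =
          (L (S t' z) - L (S (t' + h) z) + h *\<^sub>R L (S t' ?y)) - h *\<^sub>R (L (S t' ?y) - L (S (t' + h) ?y))"
        unfolding t' by (simp add: algebra_simps)
      also have "norm \<dots> \<le> norm (L (S t' z) - L (S (t' + h) z) + h *\<^sub>R L (S t' ?y)) + norm (h *\<^sub>R (L (S t' ?y) - L (S (t' + h) ?y)))"
        by (rule norm_triangle_ineq4)
      also have "\<dots> \<le> h * (e / 4) + h * (e / 4)"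
        using key[of t'] pos h by (intro add_mono) (auto intro: mult_left_mono)
      finally show ?thesis .
    qed
    also have "\<dots> < h * e" using h e by simp
    finally show "norm (L (S t' z) - L (S t z) - (t' - t) *\<^sub>R L (S t ?y)) / norm (t' - t) < e"
      using h by (simp add: h_def divide_less_eq mult.commute)
  qed (use d t in auto)
qed

end

section \<open>Modal decomposition of the thermoelastic operator\<close>

text \<open>\<open>coupling\<close> bounds \<open>cb / (ca * cc)\<close> over the spectrum, which is
  what inverting the generator requires.\<close>

locale thermoelastic = positive_operator A + modal_coefficients m \<sigma> \<tau> \<alpha> \<beta> \<gamma>
  for A :: "'h::complex_hilbert_space unbounded_op" and m \<sigma> \<tau> \<alpha> \<beta> \<gamma> :: real +
  assumes coupling: "2 * \<alpha> \<le> \<beta> + 1"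
begin

abbreviation "X \<equiv> state_space A \<gamma>"
abbreviation "N \<equiv> state_norm A m \<sigma> \<tau> \<gamma>"
abbreviation "G \<equiv> thermo_op A m \<sigma> \<tau> \<alpha> \<beta> \<gamma>"

definition gap :: real where
  "gap = (SOME l0. 0 < l0 \<and> (\<forall>l x. x \<in> eig l \<longrightarrow> x \<noteq> 0 \<longrightarrow> l0 \<le> l))"

lemma gap: "0 < gap" "x \<in> eig l \<Longrightarrow> x \<noteq> 0 \<Longrightarrow> gap \<le> l"
proof -
  have "0 < gap \<and> (\<forall>l x. x \<in> eig l \<longrightarrow> x \<noteq> 0 \<longrightarrow> gap \<le> l)"
    unfolding gap_def using spectral_gap by (rule someI_ex)
  then show "0 < gap" "x \<in> eig l \<Longrightarrow> x \<noteq> 0 \<Longrightarrow> gap \<le> l" by auto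
qed

lemma eig_below_gap: "x \<in> eig l \<Longrightarrow> l < gap \<Longrightarrow> x = 0"
  using gap(2)[of x l] by force

lemma summable_compare:
  assumes "(\<lambda>l. (norm (f l :: 'b::real_normed_vector))^2) summable_on UNIV" "\<And>l. norm (g l :: 'c::real_normed_vector) \<le> C * norm (f l)"
  shows "(\<lambda>l. (norm (g l))^2) summable_on UNIV"
proof (rule summable_on_comparison_test)
  show "(\<lambda>l. C^2 * (norm (f l))^2) summable_on UNIV" by (intro summable_on_cmult_right assms(1))
  show "(norm (g l))^2 \<le> C^2 * (norm (f l))^2" for l
    using power_mono[OF assms(2) norm_ge_zero, of l 2] by (simp add: power_mult_distrib)
qed simp

text \<open>Weights need comparing only from \<open>gap\<close> on, since all components below it
  vanish; the comparison family \<open>f\<close> may live in another space.\<close>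

lemma scaleI:
  assumes "\<And>l. w l \<in> eig l" "(\<lambda>l. (norm (f l :: 'b::real_normed_vector))^2) summable_on UNIV"
    "\<And>l. gap \<le> l \<Longrightarrow> l powr r * norm (w l) \<le> C * norm (f l)" "0 \<le> C"
  shows "w \<in> scale A r"
proof -
  have "norm ((l powr r) *\<^sub>R w l) \<le> C * norm (f l)" for l
    using assms(3)[of l] eig_below_gap[OF assms(1), of l] assms(4) by (cases "gap \<le> l") auto
  from summable_compare[OF assms(2) this] show ?thesis using assms(1) by (simp add: scale_def)
qed

lemma scale_mono:
  assumes "w \<in> scale A r" "s \<le> r"
  shows "w \<in> scale A s"
proof (rule scaleI)
  show "w l \<in> eig l" for l using assms by (simp add: scale_def)
  show "(\<lambda>l. (norm ((l powr r) *\<^sub>R w l))^2) summable_on UNIV" using assms by (simp add: scale_def)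
  show "l powr s * norm (w l) \<le> gap powr (s - r) * norm ((l powr r) *\<^sub>R w l)" if "gap \<le> l" for l
  proof -
    have "l powr s = l powr (s - r) * l powr r" using that gap(1) by (simp add: powr_add[symmetric])
    moreover have "l powr (s - r) \<le> gap powr (s - r)" using that gap(1) assms by (intro powr_mono2') auto
    ultimately have "l powr s * norm (w l) \<le> gap powr (s - r) * (l powr r * norm (w l))"
      by (simp add: mult.assoc mult_right_mono)
    then show ?thesis by simp
  qed
qed simp

lemma scale_0: "w \<in> scale A r \<Longrightarrow> 0 \<le> r \<Longrightarrow> (\<lambda>l. (norm (w l))^2) summable_on UNIV"
proof -
  assume w: "w \<in> scale A r" and r: "0 \<le> r"
  from scale_mono[OF w r] have *: "(\<lambda>l. (norm ((l powr 0) *\<^sub>R w l))^2) summable_on UNIV" "\<And>l. w l \<in> eig l" by (auto simp: scale_def)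
  show "(\<lambda>l. (norm (w l))^2) summable_on UNIV"
  proof (rule summable_compare[OF *(1), of _ 1])
    \<comment> \<open>The convention \<open>0 powr 0 = 0\<close> would lose the component at
      \<open>l = 0\<close>, but that eigenspace is trivial.\<close>
    show "norm (w l) \<le> 1 * norm ((l powr 0) *\<^sub>R w l)" for l
      using eig_nonpos[OF *(2), of l] by (cases "l = 0") auto
  qed
qed

lemma power_domI: "w \<in> scale A r \<Longrightarrow> 0 \<le> r \<Longrightarrow> comps A (vec_of w) = w \<and> vec_of w \<in> power_dom A r"
proof -
  assume w: "w \<in> scale A r" and r: "0 \<le> r"
  have "comps A (vec_of w) = w"
    by (rule comps_vec_of) (use w scale_0[OF w r] in \<open>auto simp: scale_def\<close>)
  then show ?thesis using w by (simp add: power_dom_def)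
qed

lemma has_sum_op_power:
  assumes x: "x \<in> power_dom A s"
  shows "((\<lambda>l. (l powr s * norm (comps A x l))^2) has_sum (norm (op_power A s x))^2) UNIV"
proof -
  have in_eig: "\<And>l. ext_power A s x l \<in> eig l" unfolding ext_power_def scale_power_def by (intro eigD(4) comps_in)
  have "(\<lambda>l. (norm (ext_power A s x l))^2) summable_on UNIV"
    using x by (simp add: power_dom_def scale_def ext_power_def scale_power_def)
  from summable_eig[OF in_eig this] have "(ext_power A s x has_sum op_power A s x) UNIV"
    unfolding op_power_def vec_of_def by (rule has_sum_infsum)
  from has_sum_norm_eig[OF in_eig this] show ?thesis
    by (simp add: ext_power_def scale_power_def)
qed

text \<open>The coordinates of a state in one mode, weighted so that the energy becomes the Parseval
  sum \<open>N_square\<close> and the generator becomes \<open>modal_op\<close>.\<close>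

definition \<Phi> :: "real \<Rightarrow> 'h state \<Rightarrow> 'h state" where
  "\<Phi> l = (\<lambda>(u, v, \<theta>, q). (sqrt (\<sigma> * l) *\<^sub>R comps A u l, sqrt (M l) *\<^sub>R comps A v l, comps A \<theta> l, sqrt \<tau> *\<^sub>R comps A q l))"

lemma bounded_linear_\<Phi>: "bounded_linear (\<Phi> l)"
proof -
  have *: "\<Phi> l = (\<lambda>X. (sqrt (\<sigma> * l) *\<^sub>R comps A (fst X) l, sqrt (M l) *\<^sub>R comps A (fst (snd X)) l,
     comps A (fst (snd (snd X))) l, sqrt \<tau> *\<^sub>R comps A (snd (snd (snd X))) l))"
    by (auto simp: \<Phi>_def)
  show ?thesis unfolding *
    by (intro bounded_linear_Pair bounded_linear_compose[OF bounded_linear_scaleR_right]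
        bounded_linear_compose[OF bounded_linear_comps] bounded_linear_compose[OF bounded_linear_fst]
        bounded_linear_compose[OF bounded_linear_snd] bounded_linear_fst bounded_linear_snd bounded_linear_ident)
qed

lemma comps_minus: "comps A (- x) l = - comps A x l"
  and comps_scaleR: "comps A (r *\<^sub>R x) l = r *\<^sub>R comps A x l"
  using linear_neg[OF bounded_linear.linear[OF bounded_linear_comps]]
    linear_scale[OF bounded_linear.linear[OF bounded_linear_comps]] by blast+

lemma norm_state: "(norm (x, y, z, w))^2 = (norm x)^2 + (norm y)^2 + (norm z)^2 + (norm w)^2"
  by (simp add: norm_prod_def)

lemma Phi_below_gap: "l < gap \<Longrightarrow> \<Phi> l U = 0"
  by (cases U) (simp add: \<Phi>_def zero_prod_def eig_below_gap[OF comps_in])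

lemma norm_Phi:
  "(norm (\<Phi> l (u, v, \<theta>, q)))^2 = \<sigma> * (l powr (1/2) * norm (comps A u l))^2 + m * (l powr (\<gamma>/2) * norm (comps A v l))^2
    + (norm (comps A v l))^2 + (norm (comps A \<theta> l))^2 + \<tau> * (norm (comps A q l))^2"
proof (cases "gap \<le> l")
  case True
  then have l: "0 < l" using gap(1) by simp
  have "(l powr (\<gamma> / 2))^2 = l powr \<gamma>" using l by (simp add: power2_eq_square powr_add[symmetric])
  moreover have "(sqrt (M l))^2 = 1 + m * l powr \<gamma>" using M_pos[of l] by (simp add: M_def)
  moreover have "(sqrt (\<sigma> * l))^2 = \<sigma> * (l powr (1/2))^2" using l \<sigma> by (simp add: powr_half_sqrt)
  moreover have "(sqrt \<tau>)^2 = \<tau>" using \<tau> by simp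
  ultimately show ?thesis
    by (simp add: \<Phi>_def norm_state power_mult_distrib algebra_simps del: real_sqrt_pow2_iff real_sqrt_pow2 real_sqrt_mult)
next
  case False
  then show ?thesis using Phi_below_gap[of l] eig_below_gap[OF comps_in, of l] by simp
qed

lemma N_eq: "N (u, v, \<theta>, q) = sqrt (\<sigma> * (norm (op_power A (1/2) u))^2 + m * (norm (op_power A (\<gamma>/2) v))^2
    + (norm v)^2 + (norm \<theta>)^2 + \<tau> * (norm q)^2)"
  by (simp add: state_norm_def state_inner_def cinner_self del: of_real_power)

lemma N_nonneg: "0 \<le> N U"
  using m \<sigma> \<tau> by (cases U) (simp add: N_eq)

lemma N_square:
  assumes U: "U \<in> X"
  shows "((\<lambda>l. (norm (\<Phi> l U))^2) has_sum (N U)^2) UNIV"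
proof -
  obtain u v \<theta> q where U': "U = (u, v, \<theta>, q)" by (cases U)
  have dom: "u \<in> power_dom A (1/2)" "v \<in> power_dom A (\<gamma>/2)" using U by (auto simp: U' state_space_def)
  have "(N U)^2 = \<sigma> * (norm (op_power A (1/2) u))^2 + m * (norm (op_power A (\<gamma>/2) v))^2
    + (norm v)^2 + (norm \<theta>)^2 + \<tau> * (norm q)^2"
    using m \<sigma> \<tau> by (simp add: U' N_eq)
  moreover have "((\<lambda>l. (norm (\<Phi> l U))^2) has_sum \<sigma> * (norm (op_power A (1/2) u))^2 + m * (norm (op_power A (\<gamma>/2) v))^2
    + (norm v)^2 + (norm \<theta>)^2 + \<tau> * (norm q)^2) UNIV"
    unfolding U' norm_Phi
    by (intro has_sum_add has_sum_cmult_right has_sum_op_power dom parseval)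
  ultimately show ?thesis by simp
qed

lemma norm_Phi_le: assumes U: "U \<in> X" shows "norm (\<Phi> l U) \<le> N U"
proof -
  have "((\<lambda>l. (norm (\<Phi> l U))^2) has_sum (norm (\<Phi> l U))^2) {l}" by (rule has_sum_finiteI) auto
  then have "(norm (\<Phi> l U))^2 \<le> (N U)^2"
    by (rule has_sum_mono'[OF _ N_square[OF U]]) auto
  then show ?thesis using N_nonneg[of U] by (rule power2_le_imp_le)
qed

lemma Phi_inject:
  assumes "\<And>l. gap \<le> l \<Longrightarrow> \<Phi> l U = \<Phi> l U'"
  shows "U = U'"
proof -
  obtain u v \<theta> q u' v' \<theta>' q' where U: "U = (u, v, \<theta>, q)" "U' = (u', v', \<theta>', q')" by (cases U, cases U')
  have pos: "0 < M l" for l by (rule M_pos)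
  have "comps A u l = comps A u' l \<and> comps A v l = comps A v' l \<and> comps A \<theta> l = comps A \<theta>' l \<and> comps A q l = comps A q' l" for l
  proof (cases "gap \<le> l")
    case True
    then show ?thesis using assms[OF True] gap(1) \<sigma> \<tau> pos[of l] by (simp add: U \<Phi>_def)
  next
    case False
    then show ?thesis using eig_below_gap[OF comps_in, of l] by simp
  qed
  then have "comps A u = comps A u'" "comps A v = comps A v'" "comps A \<theta> = comps A \<theta>'" "comps A q = comps A q'" by auto
  then have "vec_of (comps A u) = vec_of (comps A u')" "vec_of (comps A v) = vec_of (comps A v')"
    "vec_of (comps A \<theta>) = vec_of (comps A \<theta>')" "vec_of (comps A q) = vec_of (comps A q')" by simp_all
  then show ?thesis by (simp add: U vec_of_comps)
qed

lemma norm_component_le: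
  "norm (fst X) \<le> norm X" "norm (fst (snd X)) \<le> norm X" "norm (fst (snd (snd X))) \<le> norm X"
  "norm (snd (snd (snd X))) \<le> norm X" for X :: "'h state"
  by (cases X, rule power2_le_imp_le, simp_all add: norm_state)+

text \<open>The converse of \<open>N_square\<close>: dividing by the weights returns a
  square-summable family to the domains required by the state space. Preimages under the generator
  are built this way.\<close>

lemma ex_Phi:
  assumes \<Psi>: "\<And>l. \<Psi> l \<in> eig l \<times> eig l \<times> eig l \<times> eig l"
    and s: "(\<lambda>l. (norm (\<Psi> l))^2) summable_on UNIV"
  shows "\<exists>U\<in>X. \<forall>l\<ge>gap. \<Phi> l U = \<Psi> l"
proof -
  define w1 where "w1 l = (1 / sqrt (\<sigma> * l)) *\<^sub>R fst (\<Psi> l)" for l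
  define w2 where "w2 l = (1 / sqrt (M l)) *\<^sub>R fst (snd (\<Psi> l))" for l
  define w3 where "w3 l = fst (snd (snd (\<Psi> l)))" for l
  define w4 where "w4 l = (1 / sqrt \<tau>) *\<^sub>R snd (snd (snd (\<Psi> l)))" for l
  have comp: "fst (\<Psi> l) \<in> eig l" "fst (snd (\<Psi> l)) \<in> eig l" "fst (snd (snd (\<Psi> l))) \<in> eig l" "snd (snd (snd (\<Psi> l))) \<in> eig l" for l
    using \<Psi>[of l] by (auto simp: mem_Times_iff)
  note nc = norm_component_le[of "\<Psi> _"]
  have ineig: "w1 l \<in> eig l" "w2 l \<in> eig l" "w3 l \<in> eig l" "w4 l \<in> eig l" for l
    unfolding w1_def w2_def w3_def w4_def by (intro eigD(4) comp)+
  have "w1 \<in> scale A (1/2)"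
  proof (rule scaleI[OF ineig(1) s])
    fix l assume "gap \<le> l"
    then have l: "0 < l" using gap(1) by simp
    then show "l powr (1/2) * norm (w1 l) \<le> 1 / sqrt \<sigma> * norm (\<Psi> l)"
      using nc(1)[of l] \<sigma> by (simp add: w1_def powr_half_sqrt real_sqrt_mult divide_right_mono)
  qed (use \<sigma> in simp)
  from power_domI[OF this] have u: "comps A (vec_of w1) = w1" "vec_of w1 \<in> power_dom A (1/2)" by auto
  have "w2 \<in> scale A (\<gamma>/2)"
  proof (rule scaleI[OF ineig(2) s])
    fix l assume "gap \<le> l"
    then have l: "0 < l" using gap(1) by simp
    have "m * l powr \<gamma> \<le> M l" by (simp add: M_def)
    then have "sqrt (m * l powr \<gamma>) \<le> sqrt (M l)" by simp
    moreover have "sqrt (l powr \<gamma>) = l powr (\<gamma>/2)"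
      using l by (simp add: powr_half_sqrt[symmetric] powr_powr)
    ultimately have "sqrt m * l powr (\<gamma>/2) \<le> sqrt (M l)" by (simp add: real_sqrt_mult)
    then have "l powr (\<gamma>/2) / sqrt (M l) \<le> 1 / sqrt m"
      using M_pos[of l] m by (simp add: field_simps)
    then have "l powr (\<gamma>/2) / sqrt (M l) * norm (fst (snd (\<Psi> l))) \<le> 1 / sqrt m * norm (\<Psi> l)"
      using nc(2)[of l] m by (intro mult_mono) auto
    then show "l powr (\<gamma>/2) * norm (w2 l) \<le> 1 / sqrt m * norm (\<Psi> l)"
      using M_pos[of l] by (simp add: w2_def)
  qed (use m in simp)
  from power_domI[OF this] \<gamma> have v: "comps A (vec_of w2) = w2" "vec_of w2 \<in> power_dom A (\<gamma>/2)" by auto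
  have \<theta>: "comps A (vec_of w3) = w3"
    by (intro comps_vec_of ineig summable_compare[OF s, of _ 1]) (use nc in \<open>simp add: w3_def\<close>)
  have q: "comps A (vec_of w4) = w4"
    by (intro comps_vec_of ineig summable_compare[OF s, of _ "1 / sqrt \<tau>"])
      (use nc(4) \<tau> in \<open>simp add: w4_def divide_right_mono\<close>)
  show ?thesis
  proof (intro bexI[of _ "(vec_of w1, vec_of w2, vec_of w3, vec_of w4)"] allI impI)
    show "(vec_of w1, vec_of w2, vec_of w3, vec_of w4) \<in> X" using u v by (simp add: state_space_def)
    fix l assume l: "gap \<le> l"
    have "\<Psi> l = (fst (\<Psi> l), fst (snd (\<Psi> l)), fst (snd (snd (\<Psi> l))), snd (snd (snd (\<Psi> l))))" by simp
    then show "\<Phi> l (vec_of w1, vec_of w2, vec_of w3, vec_of w4) = \<Psi> l"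
      using l gap(1) \<sigma> \<tau> M_pos[of l] by (simp add: \<Phi>_def u v \<theta> q w1_def w2_def w3_def w4_def)
  qed
qed

abbreviation "B l \<equiv> modal_op (ca l) (cb l) (cc l) cd :: 'h state \<Rightarrow> 'h state"

lemma coefficients:
  assumes "gap \<le> l"
  shows "ca l * sqrt (M l) = sqrt (\<sigma> * l)" "cb l * sqrt (M l) = l powr \<alpha>" "cc l * sqrt \<tau> = l powr (\<beta> / 2)"
    "cd * sqrt \<tau> = 1 / sqrt \<tau>" "ca l * sqrt (\<sigma> * l) = \<sigma> * l / sqrt (M l)" "cb l = l powr \<alpha> / sqrt (M l)"
    "cc l = l powr (\<beta> / 2) / sqrt \<tau>"
proof -
  have "sqrt \<tau> / \<tau> = 1 / sqrt \<tau>" using \<tau> by (simp add: field_simps)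
  then show "ca l * sqrt (M l) = sqrt (\<sigma> * l)" "cb l * sqrt (M l) = l powr \<alpha>" "cc l * sqrt \<tau> = l powr (\<beta> / 2)"
    "cd * sqrt \<tau> = 1 / sqrt \<tau>" "ca l * sqrt (\<sigma> * l) = \<sigma> * l / sqrt (M l)" "cb l = l powr \<alpha> / sqrt (M l)"
    "cc l = l powr (\<beta> / 2) / sqrt \<tau>"
    using M_pos[of l] gap(1) assms \<sigma> \<tau>
    by (simp_all add: ca_def cb_def cc_def cd_def real_sqrt_divide real_div_sqrt)
qed

lemma B_Phi:
  assumes l: "gap \<le> l"
  shows "B l (\<Phi> l (u, v, \<theta>, q)) =
    (sqrt (\<sigma> * l) *\<^sub>R comps A v l,
     (1 / sqrt (M l)) *\<^sub>R (l powr \<alpha> *\<^sub>R comps A \<theta> l - (\<sigma> * l) *\<^sub>R comps A u l),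
     l powr (\<beta> / 2) *\<^sub>R comps A q l - l powr \<alpha> *\<^sub>R comps A v l,
     (1 / sqrt \<tau>) *\<^sub>R (- comps A q l - l powr (\<beta> / 2) *\<^sub>R comps A \<theta> l))"
  using M_pos[of l] \<tau> by (simp add: modal_op_def \<Phi>_def coefficients[OF l] scaleR_diff_right)

text \<open>The link between the unbounded operator and the matrices: on its domain each summation
  in \<open>thermo_op\<close> converges, so components may be taken termwise.\<close>

lemma modal_G:
  assumes U: "U \<in> op_dom G" and l: "gap \<le> l"
  shows "\<Phi> l (op_app G U) = B l (\<Phi> l U)"
proof -
  obtain u v \<theta> q where U': "U = (u, v, \<theta>, q)" by (cases U)
  have l0: "0 < l" using l gap(1) by simp
  define f where "f = elastic_force A \<sigma> \<alpha> u \<theta>"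
  have f: "f \<in> scale A (- (\<gamma> / 2))" using U by (simp add: U' thermo_op_def f_def)
  then have fe: "f j \<in> eig j" for j by (simp add: scale_def)
  \<comment> \<open>A witness that \<open>f\<close> is in the range of I + m A^\<gamma>, as
    \<open>inv_into\<close> requires. That map multiplies mode \<open>j\<close> by
    \<open>M j\<close>, so whichever preimage \<open>inv_into\<close> picks is determined by
    \<open>Mw\<close>.\<close>
  define w0 where "w0 j = (1 / M j) *\<^sub>R f j" for j
  have w0: "w0 \<in> scale A (\<gamma> / 2)"
  proof (rule scaleI)
    show "w0 j \<in> eig j" for j unfolding w0_def by (intro eigD(4) fe)
    show "(\<lambda>j. (norm ((j powr (- (\<gamma> / 2))) *\<^sub>R f j))^2) summable_on UNIV" using f by (simp add: scale_def)
    fix j assume "gap \<le> j"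
    then have j: "0 < j" using gap(1) by simp
    have "m * j powr \<gamma> \<le> M j" by (simp add: M_def)
    moreover have "j powr \<gamma> = j powr (\<gamma>/2) * j powr (\<gamma>/2)" using j by (simp add: powr_add[symmetric])
    ultimately have "j powr (\<gamma>/2) / M j \<le> 1 / m * j powr (- (\<gamma>/2))"
      using M_pos[of j] m j by (simp add: powr_minus field_simps)
    then show "j powr (\<gamma> / 2) * norm (w0 j) \<le> 1 / m * norm ((j powr (- (\<gamma> / 2))) *\<^sub>R f j)"
      using M_pos[of j] mult_right_mono[of "j powr (\<gamma>/2) / M j" "1 / m * j powr (- (\<gamma>/2))" "norm (f j)"]
      by (simp add: w0_def)
  qed (use m in simp)
  let ?I = "\<lambda>w j. w j + m *\<^sub>R scale_power \<gamma> w j"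
  have I: "?I w j = M j *\<^sub>R w j" for w :: "real \<Rightarrow> 'h" and j by (simp add: scale_power_def M_def scaleR_add_left)
  have "?I w0 = f"
  proof
    fix j
    show "?I w0 j = f j" unfolding I using M_pos[of j] by (simp add: w0_def)
  qed
  then have fim: "f \<in> ?I ` scale A (\<gamma> / 2)" using w0 by (intro image_eqI[of _ _ w0]) auto
  define w where "w = inertia_inverse A m \<gamma> f"
  have w: "w \<in> scale A (\<gamma> / 2)" unfolding w_def inertia_inverse_def by (rule inv_into_into[OF fim])
  have Iw: "?I w = f" unfolding w_def inertia_inverse_def by (rule f_inv_into_f[OF fim])
  have Mw: "M j *\<^sub>R w j = f j" for j using I[of w j] fun_cong[OF Iw, of j] by simp
  have cw: "comps A (vec_of w) = w" using power_domI[OF w] \<gamma> by simp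
  obtain y where y: "(\<lambda>l. - ext_power A \<alpha> v l + ext_power A (\<beta> / 2) q l) = comps A y" using U by (auto simp: U' thermo_op_def)
  obtain y' where y': "(\<lambda>l. comps A q l + ext_power A (\<beta> / 2) \<theta> l) = comps A y'" using U by (auto simp: U' thermo_op_def)
  have y'': "(\<lambda>l. - comps A q l - ext_power A (\<beta> / 2) \<theta> l) = comps A (- y')"
  proof
    fix j show "- comps A q j - ext_power A (\<beta> / 2) \<theta> j = comps A (- y') j"
      unfolding comps_minus using fun_cong[OF y', of j] by (simp add: algebra_simps)
  qed
  have GU: "op_app G U = (v, - vec_of w, y, (1 / \<tau>) *\<^sub>R (- y'))"
    unfolding U' thermo_op_def snd_conv prod.case f_def[symmetric] w_def[symmetric] y y'' vec_of_comps ..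
  have "sqrt (M l) *\<^sub>R w l = (1 / sqrt (M l)) *\<^sub>R f l"
  proof -
    have "sqrt (M l) *\<^sub>R w l = (1 / M l * sqrt (M l)) *\<^sub>R f l"
      unfolding Mw[symmetric] using M_pos[of l] by simp
    also have "1 / M l * sqrt (M l) = 1 / sqrt (M l)" using M_pos[of l] by (simp add: field_simps)
    finally show ?thesis .
  qed
  moreover have "f l = - (l powr \<alpha> *\<^sub>R comps A \<theta> l - (\<sigma> * l) *\<^sub>R comps A u l)"
    using l0 by (simp add: f_def elastic_force_def ext_power_def scale_power_def)
  ultimately have 2: "sqrt (M l) *\<^sub>R comps A (- vec_of w) l = (1 / sqrt (M l)) *\<^sub>R (l powr \<alpha> *\<^sub>R comps A \<theta> l - (\<sigma> * l) *\<^sub>R comps A u l)"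
    by (simp only: comps_minus cw scaleR_minus_right minus_minus)
  have 3: "comps A y l = l powr (\<beta> / 2) *\<^sub>R comps A q l - l powr \<alpha> *\<^sub>R comps A v l"
    using fun_cong[OF y, of l] by (simp add: ext_power_def scale_power_def)
  have "sqrt \<tau> * (1 / \<tau>) = 1 / sqrt \<tau>" using \<tau> by (simp add: field_simps)
  moreover have "comps A (- y') l = - comps A q l - l powr (\<beta> / 2) *\<^sub>R comps A \<theta> l"
    using fun_cong[OF y'', of l] by (simp add: ext_power_def scale_power_def)
  ultimately have 4: "sqrt \<tau> *\<^sub>R comps A ((1 / \<tau>) *\<^sub>R (- y')) l = (1 / sqrt \<tau>) *\<^sub>R (- comps A q l - l powr (\<beta> / 2) *\<^sub>R comps A \<theta> l)"
    by (simp only: comps_scaleR scaleR_scaleR)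
  show ?thesis unfolding GU unfolding U' B_Phi[OF l] unfolding \<Phi>_def prod.case 2 3 4 ..
qed

text \<open>The domain conditions are read off from \<open>Y\<close>: its first component puts
  \<open>v\<close> in the domain of A^(1/2), its second gives the force as -M b with b in the domain
  of A^(\<gamma>/2), and the other two exhibit the remaining elements of the scale as
  vectors.\<close>

lemma in_dom_G:
  assumes U: "U \<in> X" and Y: "Y \<in> X" and eq: "\<And>l. gap \<le> l \<Longrightarrow> \<Phi> l Y = B l (\<Phi> l U)"
  shows "U \<in> op_dom G"
proof -
  obtain u v \<theta> q where U': "U = (u, v, \<theta>, q)" by (cases U)
  obtain a b c d where Y': "Y = (a, b, c, d)" by (cases Y)
  have "comps A a l = comps A v l \<and> M l *\<^sub>R comps A b l = l powr \<alpha> *\<^sub>R comps A \<theta> l - (\<sigma> * l) *\<^sub>R comps A u l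
      \<and> comps A c l = l powr (\<beta> / 2) *\<^sub>R comps A q l - l powr \<alpha> *\<^sub>R comps A v l
      \<and> \<tau> *\<^sub>R comps A d l = - comps A q l - l powr (\<beta> / 2) *\<^sub>R comps A \<theta> l" for l
  proof (cases "gap \<le> l")
    case True
    then have l: "0 < l" using gap(1) by simp
    note e = eq[OF True, unfolded U' B_Phi[OF True], unfolded Y' \<Phi>_def prod.case prod.inject]
    have "M l *\<^sub>R comps A b l = sqrt (M l) *\<^sub>R sqrt (M l) *\<^sub>R comps A b l"
      "\<tau> *\<^sub>R comps A d l = sqrt \<tau> *\<^sub>R sqrt \<tau> *\<^sub>R comps A d l"
      using M_pos[of l] \<tau> by simp_all
    then show ?thesis using e l \<sigma> \<tau> M_pos[of l] by simp
  next
    case False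
    then show ?thesis using eig_below_gap[OF comps_in, of l] by simp
  qed
  then have e: "comps A a l = comps A v l"
    "M l *\<^sub>R comps A b l = l powr \<alpha> *\<^sub>R comps A \<theta> l - (\<sigma> * l) *\<^sub>R comps A u l"
    "comps A c l = l powr (\<beta> / 2) *\<^sub>R comps A q l - l powr \<alpha> *\<^sub>R comps A v l"
    "\<tau> *\<^sub>R comps A d l = - comps A q l - l powr (\<beta> / 2) *\<^sub>R comps A \<theta> l" for l by auto
  have "comps A v = comps A a" using e(1) by auto
  moreover have "a \<in> power_dom A (1/2)" using Y by (simp add: Y' state_space_def)
  ultimately have v: "v \<in> power_dom A (1/2)" by (simp add: power_dom_def)
  have "elastic_force A \<sigma> \<alpha> u \<theta> \<in> scale A (- (\<gamma> / 2))"
  proof -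
    define f where "f = elastic_force A \<sigma> \<alpha> u \<theta>"
    have fM: "f l = - (M l *\<^sub>R comps A b l)" for l
    proof (cases "gap \<le> l")
      case True
      then show ?thesis unfolding e(2) using gap(1) by (simp add: f_def elastic_force_def ext_power_def scale_power_def)
    next
      case False
      then show ?thesis using eig_below_gap[OF comps_in, of l] by (simp add: f_def elastic_force_def ext_power_def scale_power_def)
    qed
    obtain \<Lambda> where \<Lambda>: "1 \<le> \<Lambda>" "\<And>l. gap \<le> l \<Longrightarrow> M l \<le> \<Lambda> * l powr \<gamma>"
      using pow_like_le[OF pow_like_M[OF gap(1)] pow_like_powr gap(1) order_refl] by auto
    have "f \<in> scale A (- (\<gamma> / 2))"
    proof (rule scaleI)
      show "f l \<in> eig l" for l unfolding fM by (intro eigD(5) eigD(4) comps_in)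
      show "(\<lambda>l. (norm ((l powr (\<gamma> / 2)) *\<^sub>R comps A b l))^2) summable_on UNIV"
        using Y by (simp add: Y' state_space_def power_dom_def scale_def)
      fix l assume l: "gap \<le> l"
      then have l0: "0 < l" using gap(1) by simp
      have "l powr (- (\<gamma> / 2)) * M l \<le> l powr (- (\<gamma> / 2)) * (\<Lambda> * l powr \<gamma>)"
        using \<Lambda>(2)[OF l] by (intro mult_left_mono) auto
      also have "\<dots> = \<Lambda> * (l powr (- (\<gamma> / 2)) * l powr \<gamma>)" by simp
      also have "l powr (- (\<gamma> / 2)) * l powr \<gamma> = l powr (\<gamma> / 2)" using l0 by (simp add: powr_add[symmetric])
      finally have "l powr (- (\<gamma> / 2)) * M l * norm (comps A b l) \<le> \<Lambda> * l powr (\<gamma> / 2) * norm (comps A b l)"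
        by (intro mult_right_mono) auto
      then show "l powr (- (\<gamma> / 2)) * norm (f l) \<le> \<Lambda> * norm ((l powr (\<gamma> / 2)) *\<^sub>R comps A b l)"
        using M_pos[of l] by (simp add: fM mult_ac)
    qed (use \<Lambda> in simp)
    then show ?thesis by (simp add: f_def)
  qed
  moreover have "(\<lambda>l. - ext_power A \<alpha> v l + ext_power A (\<beta> / 2) q l) = comps A c"
    by (rule ext) (simp add: e(3) ext_power_def scale_power_def)
  moreover have "(\<lambda>l. comps A q l + ext_power A (\<beta> / 2) \<theta> l) = comps A (- (\<tau> *\<^sub>R d))"
  proof
    fix l show "comps A q l + ext_power A (\<beta> / 2) \<theta> l = comps A (- (\<tau> *\<^sub>R d)) l"
      unfolding comps_minus comps_scaleR e(4) by (simp add: ext_power_def scale_power_def)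
  qed
  ultimately show ?thesis using U v by (auto simp: U' thermo_op_def)
qed

text \<open>Needed because \<open>polynomially_stable\<close> speaks of \<open>inv_into\<close>,
  which inverts the generator only on its range.\<close>

lemma G_surj:
  assumes Y: "Y \<in> X" and GX: "op_app G ` op_dom G \<subseteq> X"
  shows "\<exists>U\<in>op_dom G. op_app G U = Y"
proof -
  obtain a b c d where Y': "Y = (a, b, c, d)" by (cases Y)
  obtain L1 where L1: "1 \<le> L1" "\<And>l. gap \<le> l \<Longrightarrow> 1 \<le> L1 * ca l"
    using pow_like_le[OF pow_like_const[OF gap(1), of 1] pow_like_ca[OF gap(1)] gap(1)] \<gamma> by auto
  obtain L2 where L2: "1 \<le> L2" "\<And>l. gap \<le> l \<Longrightarrow> 1 \<le> L2 * cc l"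
    using pow_like_le[OF pow_like_const[OF gap(1), of 1] pow_like_cc[OF gap(1)] gap(1)] \<beta> by auto
  obtain L3 where L3: "1 \<le> L3" "\<And>l. gap \<le> l \<Longrightarrow> cb l \<le> L3 * (ca l * cc l)"
    using pow_like_le[OF pow_like_cb[OF gap(1)] pow_like_mult[OF pow_like_ca[OF gap(1)] pow_like_cc[OF gap(1)] gap(1)] gap(1)] coupling
    by (auto simp: field_simps)
  define y1 where "y1 l = fst (\<Phi> l Y)" for l
  define y2 where "y2 l = fst (snd (\<Phi> l Y))" for l
  define y3 where "y3 l = fst (snd (snd (\<Phi> l Y)))" for l
  define y4 where "y4 l = snd (snd (snd (\<Phi> l Y)))" for l
  note y_defs = y1_def y2_def y3_def y4_def
  \<comment> \<open>The rows of the modal system are solved in the order 1, 3, 4, 2, for velocity,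
    flux, temperature and displacement; each then has a single unknown.\<close>
  define x2 where "x2 l = (1 / ca l) *\<^sub>R y1 l" for l
  define x4 where "x4 l = (1 / cc l) *\<^sub>R (y3 l + cb l *\<^sub>R x2 l)" for l
  define z where "z l = y4 l + cd *\<^sub>R x4 l" for l
  define x3 where "x3 l = - ((1 / cc l) *\<^sub>R z l)" for l
  define x1 where "x1 l = (1 / ca l) *\<^sub>R (cb l *\<^sub>R x3 l - y2 l)" for l
  define \<Psi> where "\<Psi> l = (x1 l, x2 l, x3 l, x4 l)" for l
  have comp: "y1 l \<in> eig l" "y2 l \<in> eig l" "y3 l \<in> eig l" "y4 l \<in> eig l" for l
    by (auto simp: y_defs Y' \<Phi>_def intro: eigD(4) comps_in)
  have x2e: "x2 l \<in> eig l" for l unfolding x2_def by (intro eigD comp)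
  have x4e: "x4 l \<in> eig l" for l unfolding x4_def by (intro eigD(4) eigD(2) comp x2e)
  have x3e: "x3 l \<in> eig l" for l unfolding x3_def z_def by (intro eigD(5) eigD(4) eigD(2) comp x4e)
  have x1e: "x1 l \<in> eig l" for l unfolding x1_def by (intro eigD(4) eigD(6) comp x3e)
  have BPsi: "B l (\<Psi> l) = \<Phi> l Y" if l: "gap \<le> l" for l
    using pos_c[OF gap(1) l]
    by (intro prod_eqI) (simp_all add: \<Psi>_def modal_op_def x1_def x2_def x3_def x4_def z_def y_defs algebra_simps)
  \<comment> \<open>Bounds the flux \<open>x4\<close>: \<open>L2\<close> for 1/cc, and
    \<open>L3\<close> for cb/(ca cc), enlarged by the factor \<open>L2\<close>, which is at least
    1.\<close>
  define D where "D = L2 * (1 + L3)"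
  define C where "C = 4 * (L1 + D + L2 * (1 + cd * D) + (L3 * (1 + cd * D) + L1))"
  have bound: "norm (\<Psi> l) \<le> C * norm (\<Phi> l Y)" for l
  proof (cases "gap \<le> l")
    case l: True
    note p = pos_c[OF gap(1) l]
    define n where "n = norm (\<Phi> l Y)"
    have nc: "norm (y1 l) \<le> n" "norm (y2 l) \<le> n"
      "norm (y3 l) \<le> n" "norm (y4 l) \<le> n"
      unfolding n_def y_defs by (rule norm_component_le)+
    have n0: "0 \<le> n" by (simp add: n_def)
    have i: "1 / ca l \<le> L1" "1 / cc l \<le> L2" "cb l / ca l \<le> L3 * cc l" "cb l / (ca l * cc l) \<le> L3"
      using L1(2)[OF l] L2(2)[OF l] L3(2)[OF l] p by (simp_all add: field_simps)
    have n2: "norm (x2 l) \<le> L1 * n" 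
      using mult_mono[OF i(1) nc(1)] L1(1) p n0 by (simp add: x2_def)
    have bx2: "norm (cb l *\<^sub>R x2 l) \<le> L3 * cc l * n"
      using mult_mono[OF i(3) nc(1)] L3(1) p n0 by (simp add: x2_def)
    have n4: "norm (x4 l) \<le> D * n"
    proof -
      have "norm (x4 l) \<le> 1 / cc l * (n + L3 * cc l * n)"
        unfolding x4_def norm_scaleR using p nc(3) bx2
        by (intro mult_mono order_trans[OF norm_triangle_ineq add_mono]) auto
      also have "\<dots> = 1 / cc l * n + L3 * n" using p by (simp add: field_simps)
      also have "\<dots> \<le> L2 * n + L3 * n" using i(2) n0 by (intro add_mono mult_right_mono) auto
      also have "L3 * n \<le> L2 * (L3 * n)" using L2(1) L3(1) n0 mult_right_mono[of 1 L2 "L3 * n"] by simp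
      finally show ?thesis by (simp add: D_def algebra_simps)
    qed
    have s4: "norm (z l) \<le> (1 + cd * D) * n"
    proof -
      have "norm (z l) \<le> n + cd * (D * n)"
        unfolding z_def using cd_pos n4 nc(4) by (intro order_trans[OF norm_triangle_ineq add_mono]) auto
      then show ?thesis by (simp add: algebra_simps)
    qed
    have D0: "0 \<le> D" using L2 L3 by (simp add: D_def)
    have n3: "norm (x3 l) \<le> L2 * (1 + cd * D) * n"
      using mult_mono[OF i(2) s4] L2(1) p by (simp add: x3_def mult.assoc)
    have n1: "norm (x1 l) \<le> (L3 * (1 + cd * D) + L1) * n"
    proof -
      \<comment> \<open>The quotient is formed before estimating, because cb/ca alone may be
        unbounded and only the further factor 1/cc tames it.\<close>
      have "(1 / ca l) *\<^sub>R (cb l *\<^sub>R x3 l) = - ((cb l / (ca l * cc l)) *\<^sub>R z l)"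
        by (simp add: x3_def)
      then have "x1 l = - ((cb l / (ca l * cc l)) *\<^sub>R z l) - (1 / ca l) *\<^sub>R y2 l"
        by (simp only: x1_def scaleR_diff_right)
      also have "norm \<dots> \<le> norm ((cb l / (ca l * cc l)) *\<^sub>R z l) + norm ((1 / ca l) *\<^sub>R y2 l)"
        by (rule order_trans[OF norm_triangle_ineq4]) simp
      also have "\<dots> \<le> L3 * ((1 + cd * D) * n) + L1 * n"
        using mult_mono[OF i(4) s4] mult_mono[OF i(1) nc(2)] L3(1) L1(1) p n0 by (intro add_mono) auto
      finally show ?thesis by (simp add: algebra_simps)
    qed
    have "norm (\<Psi> l) \<le> norm (x1 l) + (norm (x2 l) + (norm (x3 l) + norm (x4 l)))"
      unfolding \<Psi>_def by (intro order_trans[OF norm_Pair_le] add_mono order_refl)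
    also have "\<dots> \<le> (L1 + D + L2 * (1 + cd * D) + (L3 * (1 + cd * D) + L1)) * n"
      using n1 n2 n3 n4 by (simp add: distrib_right)
    also have "\<dots> \<le> C * n"
      using L1(1) L2(1) L3(1) D0 cd_pos n0 by (intro mult_right_mono) (auto simp: C_def)
    finally show ?thesis by (simp add: n_def)
  next
    case False
    then show ?thesis using eig_below_gap[OF x1e, of l] eig_below_gap[OF x2e, of l] eig_below_gap[OF x3e, of l] eig_below_gap[OF x4e, of l]
        Phi_below_gap[of l Y] by (simp add: \<Psi>_def zero_prod_def[symmetric])
  qed
  have "(\<lambda>l. (norm (\<Phi> l Y))^2) summable_on UNIV" using N_square[OF Y] by (auto simp: summable_on_def)
  from summable_compare[OF this bound] have "\<exists>U\<in>X. \<forall>l\<ge>gap. \<Phi> l U = \<Psi> l"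
    by (intro ex_Phi) (auto simp: \<Psi>_def x1e x2e x3e x4e)
  then obtain U where U: "U \<in> X" "\<And>l. gap \<le> l \<Longrightarrow> \<Phi> l U = \<Psi> l" by auto
  have dom: "U \<in> op_dom G" by (rule in_dom_G[OF U(1) Y]) (simp add: U(2) BPsi)
  have "op_app G U = Y"
    by (rule Phi_inject) (simp add: modal_G[OF dom] U(2) BPsi)
  then show ?thesis using dom by blast
qed

section \<open>Assembly of the modes and the theorem\<close>

text \<open>With x = G z the claim bounds S t z by G z. The estimate of
  \<open>dissipative_decay\<close> holds in every mode with the same constant, so its squares may be
  summed by Parseval.\<close>

lemma polynomial_stability:
  assumes sg: "c0_contraction_semigroup X N S" and gen: "is_generator X N S G"
    and k: "0 \<le> k"
    and modes: "modes_decay gap k"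
  shows "polynomially_stable X N S G k"
proof -
  interpret contraction_semigroup X N S G
    by unfold_locales (rule sg, rule gen, rule N_nonneg)
  obtain K where K: "0 \<le> K" "\<And>l \<mu>. gap \<le> l \<Longrightarrow> modal_root l \<mu> \<Longrightarrow>
      Re \<mu> < 0 \<and> (\<forall>t>0. exp (Re \<mu> * t) \<le> K * cmod \<mu> * t powr (- k))"
    using modes by (auto simp: modes_decay_def)
  define C where "C = decay_const k 4 * K"
  have C0: "0 \<le> C" using K(1) decay_const_nonneg by (simp add: C_def)
  interpret \<Phi>: bounded_linear "\<Phi> l" for l by (rule bounded_linear_\<Phi>)
  have mode_decay: "norm (\<Phi> l (S t z)) \<le> C * t powr (- k) * norm (\<Phi> l (op_app G z))"
    if z: "z \<in> op_dom G" and t: "0 < t" for z t l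
  proof (cases "gap \<le> l")
    case l: True
    obtain \<mu>s where \<mu>s: "length \<mu>s = 4" "\<And>\<mu>. \<mu> \<in> set \<mu>s \<Longrightarrow> modal_root l \<mu>"
      "\<And>Z. foldr (\<lambda>\<mu> Z. B l Z - \<mu> *\<^sub>C Z) \<mu>s Z = 0"
      using ex_modal_roots[of "ca l" "cb l" "cc l" cd] by auto
    have BS: "B l (\<Phi> l (S s z)) = \<Phi> l (S s (op_app G z))" if "0 \<le> s" for s
      using generator_commute[OF z that] modal_G[OF _ l] by metis
    have d: "((\<lambda>s. \<Phi> l (S s z)) has_vector_derivative B l (\<Phi> l (S s z))) (at s)" if "0 < s" for s
      unfolding BS[OF less_imp_le[OF that]]
      by (rule orbit_derivative[OF \<Phi>.diff \<Phi>.scaleR norm_Phi_le z that])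
    \<comment> \<open>The derivative of the orbit solves the same dissipative system, so its norm
      decreases; the initial value is reached as a limit from the right, since differentiability is
      available only for positive times.\<close>
    have bound: "norm (B l (\<Phi> l (S s z))) \<le> norm (\<Phi> l (op_app G z))" if s: "0 < s" for s
    proof -
      define n where "n r = (norm (B l (\<Phi> l (S r z))))^2" for r
      have nd: "(n has_real_derivative 2 * Re (cinner (B l (B l (\<Phi> l (S r z)))) (B l (\<Phi> l (S r z))))) (at r)" if "0 < r" for r
        unfolding n_def
        by (rule has_real_derivative_norm_square) (rule bounded_linear.has_vector_derivative[OF bounded_linear_modal_op d[OF that]])
      have mono: "n s \<le> n r" if "0 < r" "r \<le> s" for r
      proof (rule DERIV_nonpos_imp_nonincreasing[OF that(2)])
        fix v assume "r \<le> v" "v \<le> s"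
        then have "0 < v" using that by simp
        from nd[OF this] modal_op_dissipative[OF less_imp_le[OF cd_pos]]
        show "\<exists>y. (n has_real_derivative y) (at v) \<and> y \<le> 0"
          by (intro exI conjI) (assumption, simp)
      qed
      have "((\<lambda>r. \<Phi> l (S r (op_app G z))) \<longlongrightarrow> \<Phi> l (op_app G z)) (at_right 0)"
        by (rule orbit_continuous_0[OF \<Phi>.diff norm_Phi_le dom_in(2)[OF z]])
      then have lim: "((\<lambda>r. (norm (\<Phi> l (S r (op_app G z))))^2) \<longlongrightarrow> (norm (\<Phi> l (op_app G z)))^2) (at_right 0)"
        by (intro tendsto_intros)
      have "n s \<le> (norm (\<Phi> l (op_app G z)))^2"
      proof (rule tendsto_lowerbound[OF lim])
        show "\<forall>\<^sub>F r in at_right 0. n s \<le> (norm (\<Phi> l (S r (op_app G z))))^2"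
          unfolding eventually_at_right_field
          using mono s BS by (intro exI[of _ s]) (auto simp: n_def)
      qed simp
      then show ?thesis unfolding n_def by (rule power2_le_imp_le) simp
    qed
    have "norm (\<Phi> l (S t z)) \<le> decay_const k (length \<mu>s) * K * t powr (- k) * norm (\<Phi> l (op_app G z))"
      by (rule dissipative_decay[where B = "B l" and V = UNIV and x = "\<lambda>s. \<Phi> l (S s z)"])
        (use k K \<mu>s l d bound t cd_pos in \<open>auto simp: bounded_linear_modal_op modal_op_scaleC csubspace_def less_imp_le
          intro: modal_op_dissipative\<close>)
    then show ?thesis by (simp add: C_def \<mu>s(1))
  next
    case False
    then show ?thesis using C0 by (simp add: Phi_below_gap)
  qed
  have decay: "N (S t z) \<le> C * t powr (- k) * N (op_app G z)" if z: "z \<in> op_dom G" and t: "0 < t" for z t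
  proof -
    have R: "((\<lambda>l. (C * t powr (- k))^2 * (norm (\<Phi> l (op_app G z)))^2) has_sum (C * t powr (- k))^2 * (N (op_app G z))^2) UNIV"
      by (intro has_sum_cmult_right N_square dom_in(2) z)
    have "((\<lambda>l. (norm (\<Phi> l (S t z)))^2) has_sum (N (S t z))^2) UNIV"
      using t by (intro N_square S_in dom_in(1) z) simp
    then have "(N (S t z))^2 \<le> (C * t powr (- k))^2 * (N (op_app G z))^2"
    proof (rule has_sum_mono[OF _ R])
      show "(norm (\<Phi> l (S t z)))^2 \<le> (C * t powr (- k))^2 * (norm (\<Phi> l (op_app G z)))^2" for l
        using power_mono[OF mode_decay[OF z t, of l] norm_ge_zero, of 2] by (simp add: power_mult_distrib)
    qed
    then have "(N (S t z))^2 \<le> (C * t powr (- k) * N (op_app G z))^2" by (simp add: power_mult_distrib)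
    then show ?thesis by (rule power2_le_imp_le) (use C0 N_nonneg in simp)
  qed
  show ?thesis
    unfolding polynomially_stable_def
  \<comment> \<open>\<open>C\<close> may be 0, while the definition asks for a positive
    constant.\<close>
  proof (intro exI[of _ "C + 1"] conjI allI impI ballI)
    fix t :: real and x assume t: "0 < t" and x: "x \<in> X"
    have "op_app G ` op_dom G \<subseteq> X" using dom_in(2) by auto
    from G_surj[OF x this] have im: "x \<in> op_app G ` op_dom G" by auto
    define z where "z = inv_into (op_dom G) (op_app G) x"
    have z: "z \<in> op_dom G" "op_app G z = x" unfolding z_def by (rule inv_into_into[OF im], rule f_inv_into_f[OF im])
    have "N (S t z) \<le> C * t powr (- k) * N x" using decay[OF z(1) t] z(2) by simp
    also have "\<dots> \<le> (C + 1) * t powr (- k) * N x" using N_nonneg by (intro mult_right_mono) auto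
    finally show "N (S t (inv_into (op_dom G) (op_app G) x)) \<le> (C + 1) * t powr (- k) * N x" by (simp add: z_def)
  qed (use C0 in simp)
qed

end

theorem theorem2p5:
  fixes A :: "'h::complex_hilbert_space unbounded_op"
    and m \<sigma> \<tau> \<alpha> \<beta> \<gamma> :: real
    and S :: "real \<Rightarrow> 'h state \<Rightarrow> 'h state"
  assumes "0 < m" and "0 < \<sigma>" and "0 < \<tau>"
    and "self_adjoint A" and "positive_definite A" and "compact_resolvent A"
    and "\<alpha> \<in> {0..1}" and "\<beta> \<in> {0..1}" and "\<gamma> \<in> {0<..1}"
    and "c0_contraction_semigroup (state_space A \<gamma>) (state_norm A m \<sigma> \<tau> \<gamma>) S"
    and "is_generator (state_space A \<gamma>) (state_norm A m \<sigma> \<tau> \<gamma>) S (thermo_op A m \<sigma> \<tau> \<alpha> \<beta> \<gamma>)"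
  shows "((\<alpha>, \<beta>, \<gamma>) \<in> V\<^sub>1 \<longrightarrow>
      polynomially_stable (state_space A \<gamma>) (state_norm A m \<sigma> \<tau> \<gamma>) S (thermo_op A m \<sigma> \<tau> \<alpha> \<beta> \<gamma>)
        ((2 * \<alpha> - \<gamma>) / (2 * (2 * \<alpha> - \<beta> - \<gamma>)))) \<and>
    ((\<alpha>, \<beta>, \<gamma>) \<in> V\<^sub>2 \<longrightarrow>
      polynomially_stable (state_space A \<gamma>) (state_norm A m \<sigma> \<tau> \<gamma>) S (thermo_op A m \<sigma> \<tau> \<alpha> \<beta> \<gamma>)
        ((1 - \<gamma>) / (2 * (- 2 * \<alpha> - \<beta> - \<gamma> + 2)))) \<and>
    ((\<alpha>, \<beta>, \<gamma>) \<in> V\<^sub>3 \<longrightarrow>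
      polynomially_stable (state_space A \<gamma>) (state_norm A m \<sigma> \<tau> \<gamma>) S (thermo_op A m \<sigma> \<tau> \<alpha> \<beta> \<gamma>)
        ((1 - \<gamma>) / (2 * (- 2 * \<alpha> + \<beta> + \<gamma>))))"
proof -
  have loc: "thermoelastic A m \<sigma> \<tau> \<alpha> \<beta> \<gamma>" if "2 * \<alpha> \<le> \<beta> + 1"
    using assms that by unfold_locales auto
  show ?thesis
  proof (intro conjI impI)
    assume "(\<alpha>, \<beta>, \<gamma>) \<in> V\<^sub>1"
    \<comment> \<open>All four pieces of the region satisfy these inequalities, so one argument
      covers them.\<close>
    then have V: "1 / 2 \<le> \<alpha>" "2 * \<alpha> \<le> \<beta> + 1" "\<gamma> < 2 * \<alpha> - \<beta>"
      by (auto simp: V\<^sub>1_def T\<^sub>1_def F\<^sub>1\<^sub>2_def F\<^sub>1\<^sub>4_def L\<^sub>1\<^sub>2\<^sub>4_def)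
    interpret thermoelastic A m \<sigma> \<tau> \<alpha> \<beta> \<gamma> by (rule loc) (use V in simp)
    show "polynomially_stable X N S G ((2 * \<alpha> - \<gamma>) / (2 * (2 * \<alpha> - \<beta> - \<gamma>)))"
      by (rule polynomial_stability[OF assms(10,11) _ modal_decay_V1[OF gap(1) V]]) (use V assms(8) in simp)
  next
    assume "(\<alpha>, \<beta>, \<gamma>) \<in> V\<^sub>2"
    then have V: "\<alpha> < 1 / 2" "\<gamma> < 1 - \<beta>"
      by (auto simp: V\<^sub>2_def T\<^sub>2_def F\<^sub>2_def)
    interpret thermoelastic A m \<sigma> \<tau> \<alpha> \<beta> \<gamma> by (rule loc) (use V assms(8) in simp)
    show "polynomially_stable X N S G ((1 - \<gamma>) / (2 * (- 2 * \<alpha> - \<beta> - \<gamma> + 2)))"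
      by (rule polynomial_stability[OF assms(10,11) _ modal_decay_V2[OF gap(1) V]]) (use V assms(8,9) in simp)
  next
    assume "(\<alpha>, \<beta>, \<gamma>) \<in> V\<^sub>3"
    then have V: "2 * \<alpha> < \<beta> + \<gamma>" "1 - \<gamma> \<le> \<beta>"
      by (auto simp: V\<^sub>3_def T\<^sub>3_def F\<^sub>2\<^sub>3_def)
    interpret thermoelastic A m \<sigma> \<tau> \<alpha> \<beta> \<gamma> by (rule loc) (use V assms(9) in simp)
    show "polynomially_stable X N S G ((1 - \<gamma>) / (2 * (- 2 * \<alpha> + \<beta> + \<gamma>)))"
      by (rule polynomial_stability[OF assms(10,11) _ modal_decay_V3[OF gap(1) V]]) (use V assms(9) in simp)
  qed
qed

end
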